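(* For the Virasoro conformal algebra $\mathrm{Vir}$ and the trivial module $\mathbb C$ (on which $\partial$ and $L$ act by zero), $$\dim\widetilde{\mathrm H}^q(\mathrm{Vir},\mathbb C)=\begin{cases}1&\text{if } q=0\text{ or }3,\\0&\text{otherwise,}\end{cases}$$ and $$\dim\mathrm H^q(\mathrm{Vir},\mathbb C)=\begin{cases}1&\text{if } q=0,\,2,\text{ or }3,\\0&\text{otherwise.}\end{cases}$$
   Context: Everything is over $\mathbb C$. A (Lie) conformal algebra is a $\mathbb C[\partial]$-module $A$ with a linear map $A\otimes A\to A[\lambda]$, $a\otimes b\mapsto[a_\lambda b]$, such that: $[(\partial a)_\lambda b]=-\lambda[a_\lambda b]$ and $[a_\lambda\,\partial b]=(\partial+\lambda)[a_\lambda b]$; $[a_\lambda b]=-[b_{-\lambda-\partial}a]$; $[a_\lambda[b_\mu c]]=[[a_\lambda b]_{\lambda+\mu}c]+[b_\mu[a_\lambda c]]$. The Virasoro conformal algebra $\mathrm{Vir}=\mathbb C[\partial]L$ is free of rank one over $\mathbb C[\partial]$ with $[L_\lambda L]=(\partial+2\lambda)L$. A conformal $A$-module is a $\mathbb C[\partial]$-module $M$ with a linear map $A\otimes M\to M[\lambda]$, $a\otimes v\mapsto a_\lambda v$, such that $a_\lambda(b_\mu v)-b_\mu(a_\lambda v)=[a_\lambda b]_{\lambda+\mu}v$, $(\partial a)_\lambda v=-\lambda a_\lambda v$, $a_\lambda(\partial v)=(\partial+\lambda)a_\lambda v$. Basic complex: $\widetilde C^n(A,M)$ ($n\ge 0$)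 is the space of linear maps $\gamma\colon A^{\otimes n}\to M[\lambda_1,\dots,\lambda_n]$, $a_1\otimes\dots\otimes a_n\mapsto\gamma_{\lambda_1,\dots,\lambda_n}(a_1,\dots,a_n)$, such that $\gamma_{\lambda_1,\dots,\lambda_n}(a_1,\dots,\partial a_i,\dots,a_n)=-\lambda_i\gamma_{\lambda_1,\dots,\lambda_n}(a_1,\dots,a_n)$ for all $i$, and $\gamma$ is skew-symmetric under simultaneous permutations of the $a_i$ and the $\lambda_i$ ($\widetilde C^0=M$). The differential is $$(d\gamma)_{\lambda_1,\dots,\lambda_{n+1}}(a_1,\dots,a_{n+1})=\sum_{i}(-1)^{i+1}{a_i}_{\lambda_i}\gamma_{\lambda_1,\dots,\widehat{\lambda_i},\dots,\lambda_{n+1}}(a_1,\dots,\widehat{a_i},\dots,a_{n+1})$$ $$+\sum_{i<j}(-1)^{i+j}\gamma_{\lambda_i+\lambda_j,\lambda_1,\dots,\widehat{\lambda_i},\dots,\widehat{\lambda_j},\dots,\lambda_{n+1}}([{a_i}_{\lambda_i}a_j],a_1,\dots,\widehat{a_i},\dots,\widehat{a_j},\dots,a_{n+1}),$$ with $\gamma$ extended linearly over polynomials in the $\lambda_i$. $\mathbb C[\partial]$ acts on $\widetilde C^n(A,M)$ by $(\partial\gamma)_{\lambda_1,\dots,\lambda_n}=(\partial_M+\sum_i\lambda_i)\gamma_{\lambda_1,\dots,\lambda_n}$, where $\partial_M$ is the action of $\partial$ on $M$; this commutes with $d$. $\widetilde{\mathrm H}^\bullet(A,M)$ (basic cohomology)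 is the cohomology of $\widetilde C^\bullet(A,M)$; $\mathrm H^\bullet(A,M)$ (reduced cohomology) is the cohomology of the quotient complex $C^\bullet(A,M)=\widetilde C^\bullet(A,M)/\partial\widetilde C^\bullet(A,M)$. *)

theory Defs
  imports
    "HOL-Computational_Algebra.Polynomial"
    "HOL-Combinatorics.Permutations"
    "HOL-Algebra.AbelCoset"
    "Jordan_Normal_Form.VS_Connect"
    "HOL-Library.Poly_Mapping"
begin

section \<open>Polynomials with coefficients in a vector space\<close>

text \<open>
  \<open>V[\<lambda>\<^sub>0, \<lambda>\<^sub>1, \<dots>]\<close>: finitely supported families of coefficients in \<open>V\<close>, indexed by exponent vectors
  \<open>nat \<Rightarrow>\<^sub>0 nat\<close>.  For \<open>V = complex\<close> this is a commutative ring (the multiplication of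
  \<^theory>\<open>HOL-Library.Poly_Mapping\<close> is the convolution).  Variables are numbered from 0.
  A complex vector space \<open>V\<close> is a type together with its scalar multiplication
  \<open>s :: complex \<Rightarrow> 'v \<Rightarrow> 'v\<close>, as in the locale \<^locale>\<open>vector_space\<close>.
\<close>

type_synonym 'v vpoly = "(nat \<Rightarrow>\<^sub>0 nat) \<Rightarrow>\<^sub>0 'v"

definition cst :: "'v::zero \<Rightarrow> 'v vpoly"
  where "cst v = Poly_Mapping.single 0 v"

definition X :: "nat \<Rightarrow> 'v::zero_neq_one vpoly"
  where "X i = Poly_Mapping.single (Poly_Mapping.single i 1) 1"

definition polys :: "nat \<Rightarrow> 'v::zero vpoly set"
  where "polys n = {P. \<forall>k \<in> Poly_Mapping.keys P. Poly_Mapping.keys k \<subseteq> {..<n}}"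

definition pmul :: "(complex \<Rightarrow> 'v::comm_monoid_add \<Rightarrow> 'v) \<Rightarrow> complex vpoly \<Rightarrow> 'v vpoly \<Rightarrow> 'v vpoly"
  where "pmul s p P =
    (\<Sum>k\<in>Poly_Mapping.keys p. \<Sum>l\<in>Poly_Mapping.keys P. Poly_Mapping.single (k + l) (s (Poly_Mapping.lookup p k) (Poly_Mapping.lookup P l)))"

text \<open>\<open>subst s [x\<^sub>0, \<dots>, x\<^bsub>n-1\<^esub>] P\<close> is \<open>P(x\<^sub>0, \<dots>, x\<^bsub>n-1\<^esub>)\<close>, for \<open>P\<close> in \<open>n\<close> variables.\<close>

definition subst :: "(complex \<Rightarrow> 'v::comm_monoid_add \<Rightarrow> 'v) \<Rightarrow> complex vpoly list \<Rightarrow> 'v vpoly \<Rightarrow> 'v vpoly"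
  where "subst s xs P =
    (\<Sum>k\<in>Poly_Mapping.keys P. pmul s (\<Prod>i<length xs. (xs ! i) ^ Poly_Mapping.lookup k i) (cst (Poly_Mapping.lookup P k)))"

text \<open>
  The extension of a linear map \<open>F : V \<rightarrow> W[\<lambda>\<^sub>0, \<dots>]\<close> to \<open>V[\<lambda>\<^sub>0, \<dots>]\<close> that is linear over polynomials
  in the \<open>\<lambda>\<^sub>i\<close>; \<open>s\<close> is the scalar multiplication of \<open>W\<close>.
\<close>

definition extend ::
  "(complex \<Rightarrow> 'w::comm_monoid_add \<Rightarrow> 'w) \<Rightarrow> ('v::zero \<Rightarrow> 'w vpoly) \<Rightarrow> 'v vpoly \<Rightarrow> 'w vpoly"
  where "extend s F P =
    (\<Sum>k\<in>Poly_Mapping.keys P. pmul s (Poly_Mapping.single k 1) (F (Poly_Mapping.lookup P k)))"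

section \<open>Conformal algebras and modules\<close>

text \<open>
  A \<open>\<complex>[\<partial>]\<close>-module is a complex vector space with a linear endomorphism.  The bracket
  \<open>[a\<^sub>\<lambda> b]\<close> is the one-variable polynomial \<open>br a b\<close>, and \<open>[a\<^sub>x b]\<close> is \<open>subst sA [x] (br a b)\<close>.
  In \<open>br_skew\<close>, the polynomial \<open>[b\<^bsub>-\<lambda>-\<partial>\<^esub> a]\<close> is \<open>\<Sum>\<^sub>j (-\<lambda>-\<partial>)\<^sup>j c\<^sub>j\<close> when \<open>[b\<^sub>\<lambda> a] = \<Sum>\<^sub>j \<lambda>\<^sup>j c\<^sub>j\<close>.
  In the Jacobi identities, \<open>\<lambda> = X 0\<close> and \<open>\<mu> = X 1\<close>.
\<close>

locale conformal_algebra = vector_space sA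
  for sA :: "complex \<Rightarrow> 'a::ab_group_add \<Rightarrow> 'a" +
  fixes dA :: "'a \<Rightarrow> 'a"
    and br :: "'a \<Rightarrow> 'a \<Rightarrow> 'a vpoly"
  assumes dA_linear: "Vector_Spaces.linear sA sA dA"
    and br_poly: "br a b \<in> polys 1"
    and br_add_left: "br (a + b) c = br a c + br b c"
    and br_add_right: "br a (b + c) = br a b + br a c"
    and br_scale_left: "br (sA r a) b = pmul sA (cst r) (br a b)"
    and br_scale_right: "br a (sA r b) = pmul sA (cst r) (br a b)"
    and br_d_left: "br (dA a) b = - pmul sA (X 0) (br a b)"
    and br_d_right: "br a (dA b) = Poly_Mapping.map dA (br a b) + pmul sA (X 0) (br a b)"
    and br_skew: "br a b = - (\<Sum>k\<in>Poly_Mapping.keys (br b a).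
          ((\<lambda>P. - pmul sA (X 0) P - Poly_Mapping.map dA P) ^^ Poly_Mapping.lookup k 0) (cst (Poly_Mapping.lookup (br b a) k)))"
    and br_jacobi:
      "extend sA (\<lambda>e. subst sA [X 0] (br a e)) (subst sA [X 1] (br b c)) =
       extend sA (\<lambda>e. subst sA [X 0 + X 1] (br e c)) (subst sA [X 0] (br a b)) +
       extend sA (\<lambda>e. subst sA [X 1] (br b e)) (subst sA [X 0] (br a c))"

locale conformal_module = conformal_algebra sA dA br + M: vector_space sM
  for sA :: "complex \<Rightarrow> 'a::ab_group_add \<Rightarrow> 'a" and dA br
    and sM :: "complex \<Rightarrow> 'm::ab_group_add \<Rightarrow> 'm" +
  fixes dM :: "'m \<Rightarrow> 'm"
    and act :: "'a \<Rightarrow> 'm \<Rightarrow> 'm vpoly"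
  assumes dM_linear: "Vector_Spaces.linear sM sM dM"
    and act_poly: "act a v \<in> polys 1"
    and act_add_left: "act (a + b) v = act a v + act b v"
    and act_add_right: "act a (v + w) = act a v + act a w"
    and act_scale_left: "act (sA r a) v = pmul sM (cst r) (act a v)"
    and act_scale_right: "act a (sM r v) = pmul sM (cst r) (act a v)"
    and act_d_left: "act (dA a) v = - pmul sM (X 0) (act a v)"
    and act_d_right: "act a (dM v) = Poly_Mapping.map dM (act a v) + pmul sM (X 0) (act a v)"
    and act_jacobi:
      "extend sM (\<lambda>w. subst sM [X 0] (act a w)) (subst sM [X 1] (act b v)) -
       extend sM (\<lambda>w. subst sM [X 1] (act b w)) (subst sM [X 0] (act a v)) =
       extend sM (\<lambda>e. subst sM [X 0 + X 1] (act e v)) (subst sA [X 0] (br a b))"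

section \<open>Complexes of vector spaces and their cohomology\<close>

definition quotient_space :: "(complex, 'v) module \<Rightarrow> 'v set \<Rightarrow> (complex, 'v set) module"
  where "quotient_space V W = \<lparr>carrier = a_rcosets\<^bsub>V\<^esub> W, mult = undefined, one = undefined,
    zero = W, add = set_add V, smult = (\<lambda>c S. \<Union>v\<in>S. W +>\<^bsub>V\<^esub> (c \<odot>\<^bsub>V\<^esub> v))\<rparr>"

definition cocycles ::
  "(nat \<Rightarrow> (complex, 'v) module) \<Rightarrow> (nat \<Rightarrow> 'v \<Rightarrow> 'v) \<Rightarrow> nat \<Rightarrow> 'v set"
  where "cocycles C d n = {x \<in> carrier (C n). d n x = \<zero>\<^bsub>C (Suc n)\<^esub>}"

definition coboundaries ::
  "(nat \<Rightarrow> (complex, 'v) module) \<Rightarrow> (nat \<Rightarrow> 'v \<Rightarrow> 'v) \<Rightarrow> nat \<Rightarrow> 'v set"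
  where "coboundaries C d n =
    (case n of 0 \<Rightarrow> {\<zero>\<^bsub>C 0\<^esub>} | Suc m \<Rightarrow> d m ` carrier (C m))"

definition cohomology ::
  "(nat \<Rightarrow> (complex, 'v) module) \<Rightarrow> (nat \<Rightarrow> 'v \<Rightarrow> 'v) \<Rightarrow> nat \<Rightarrow> (complex, 'v set) module"
  where "cohomology C d n =
    quotient_space ((C n)\<lparr>carrier := cocycles C d n\<rparr>) (coboundaries C d n)"

text \<open>\<open>vectorspace.dim\<close> is meaningful only for finite-dimensional spaces, so finiteness is part of this.\<close>

definition has_dim :: "(complex, 'v) module \<Rightarrow> nat \<Rightarrow> bool"
  where "has_dim V n \<longleftrightarrow> vectorspace class_ring V \<and> vectorspace.fin_dim class_ring V \<and>
    vectorspace.dim class_ring V = n"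

section \<open>Basic and reduced cohomology\<close>

definition omit :: "nat \<Rightarrow> 'b list \<Rightarrow> 'b list"
  where "omit i xs = take i xs @ drop (Suc i) xs"

context conformal_module
begin

text \<open>
  A linear map on \<open>A\<^sup>\<otimes>\<^sup>n\<close> is a multilinear map on lists of length \<open>n\<close>; it is set to 0 on all other
  lists, so that equality of cochains is equality of functions.
\<close>

definition basic_cochains :: "nat \<Rightarrow> ('a list \<Rightarrow> 'm vpoly) set"
  where "basic_cochains n = {\<gamma>.
    (\<forall>as. length as \<noteq> n \<longrightarrow> \<gamma> as = 0) \<and>
    (\<forall>as. length as = n \<longrightarrow> \<gamma> as \<in> polys n) \<and>
    (\<forall>as i a b. length as = n \<and> i < n \<longrightarrow>
        \<gamma> (as[i := a + b]) = \<gamma> (as[i := a]) + \<gamma> (as[i := b])) \<and>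
    (\<forall>as i c. length as = n \<and> i < n \<longrightarrow>
        \<gamma> (as[i := sA c (as ! i)]) = pmul sM (cst c) (\<gamma> as)) \<and>
    (\<forall>as i. length as = n \<and> i < n \<longrightarrow>
        \<gamma> (as[i := dA (as ! i)]) = - pmul sM (X i) (\<gamma> as)) \<and>
    (\<forall>as \<pi>. length as = n \<and> \<pi> permutes {..<n} \<longrightarrow>
        subst sM (map (\<lambda>i. X (\<pi> i)) [0..<n]) (\<gamma> (map (\<lambda>i. as ! \<pi> i) [0..<n])) =
        pmul sM (of_int (sign \<pi>)) (\<gamma> as))}"

definition basic_complex :: "nat \<Rightarrow> (complex, 'a list \<Rightarrow> 'm vpoly) module"
  where "basic_complex n = \<lparr>carrier = basic_cochains n, mult = undefined, one = undefined,
    zero = (\<lambda>_. 0), add = (\<lambda>\<gamma> \<delta> as. \<gamma> as + \<delta> as), smult = (\<lambda>c \<gamma> as. pmul sM (cst c) (\<gamma> as))\<rparr>"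

text \<open>Positions are numbered from 0, which changes neither \<open>(-1)\<^sup>i\<^sup>+\<^sup>j\<close> nor the sign of the first term of \<open>d\<close>.\<close>

definition basic_diff :: "nat \<Rightarrow> ('a list \<Rightarrow> 'm vpoly) \<Rightarrow> 'a list \<Rightarrow> 'm vpoly"
  where "basic_diff n \<gamma> as = (if length as \<noteq> Suc n then 0 else
    (\<Sum>i<Suc n. pmul sM ((-1) ^ i)
       (extend sM (\<lambda>v. subst sM [X i] (act (as ! i) v))
          (subst sM (omit i (map X [0..<Suc n])) (\<gamma> (omit i as))))) +
    (\<Sum>j<Suc n. \<Sum>i<j. pmul sM ((-1) ^ (i + j))
       (extend sM (\<lambda>b. subst sM ((X i + X j) # omit i (omit j (map X [0..<Suc n])))
                               (\<gamma> (b # omit i (omit j as))))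
          (subst sA [X i] (br (as ! i) (as ! j))))))"

definition basic_der :: "nat \<Rightarrow> ('a list \<Rightarrow> 'm vpoly) \<Rightarrow> 'a list \<Rightarrow> 'm vpoly"
  where "basic_der n \<gamma> as = Poly_Mapping.map dM (\<gamma> as) + pmul sM (\<Sum>i<n. X i) (\<gamma> as)"

definition reduced_complex :: "nat \<Rightarrow> (complex, ('a list \<Rightarrow> 'm vpoly) set) module"
  where "reduced_complex n = quotient_space (basic_complex n) (basic_der n ` basic_cochains n)"

definition reduced_diff :: "nat \<Rightarrow> ('a list \<Rightarrow> 'm vpoly) set \<Rightarrow> ('a list \<Rightarrow> 'm vpoly) set"
  where "reduced_diff n S = (\<Union>\<gamma>\<in>S.
    (basic_der (Suc n) ` basic_cochains (Suc n)) +>\<^bsub>basic_complex (Suc n)\<^esub> basic_diff n \<gamma>)"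

definition basic_cohomology :: "nat \<Rightarrow> (complex, ('a list \<Rightarrow> 'm vpoly) set) module"
  where "basic_cohomology = cohomology basic_complex basic_diff"

definition reduced_cohomology :: "nat \<Rightarrow> (complex, ('a list \<Rightarrow> 'm vpoly) set set) module"
  where "reduced_cohomology = cohomology reduced_complex reduced_diff"

end

section \<open>The Virasoro conformal algebra and its trivial module\<close>

text \<open>
  The element \<open>p(\<partial>)L\<close> of \<open>Vir = \<complex>[\<partial>]L\<close> is the polynomial \<open>p\<close>, so \<open>\<partial>\<close> is \<open>pCons 0\<close> and \<open>L = 1\<close>.
  Sesquilinearity and \<open>[L\<^sub>\<lambda> L] = (\<partial> + 2\<lambda>)L\<close> force
  \<open>[p(\<partial>)L\<^sub>\<lambda> q(\<partial>)L] = p(-\<lambda>) q(\<partial> + \<lambda>) (\<partial> + 2\<lambda>) L\<close>; the ring \<open>complex poly vpoly\<close> is \<open>\<complex>[\<partial>][\<lambda>\<^sub>0, \<dots>]\<close>,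
  with \<open>Del\<close> for \<open>\<partial>\<close>, and \<open>ev x p\<close> is \<open>p(x)\<close>.
\<close>

definition Del :: "complex poly vpoly"
  where "Del = cst [:0, 1:]"

definition ev :: "complex poly vpoly \<Rightarrow> complex poly \<Rightarrow> complex poly vpoly"
  where "ev x p = poly (map_poly (\<lambda>c. cst [:c:]) p) x"

definition vir_bracket :: "complex poly \<Rightarrow> complex poly \<Rightarrow> complex poly vpoly"
  where "vir_bracket p q = ev (- X 0) p * ev (Del + X 0) q * (Del + 2 * X 0)"

section \<open>\<open>Vir\<close> is a conformal algebra and \<open>\<complex>\<close> a conformal \<open>Vir\<close>-module\<close>

definition emb :: "complex vpoly \<Rightarrow> complex poly vpoly"
  where "emb p = Poly_Mapping.map (\<lambda>c. [:c:]) p"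

lemma pm_sum: "(\<Sum>k\<in>Poly_Mapping.keys P. Poly_Mapping.single k (Poly_Mapping.lookup P k)) =
    (P :: 'v::comm_monoid_add vpoly)"
  by (rule poly_mapping_eqI) (auto simp: lookup_sum lookup_single when_def sum.delta in_keys_iff)

lemma pm_induct [case_names single add]:
  fixes P :: "'v::comm_monoid_add vpoly"
  assumes single: "\<And>k c. Q (Poly_Mapping.single k c)"
    and add: "\<And>P R. Q P \<Longrightarrow> Q R \<Longrightarrow> Q (P + R)"
  shows "Q P"
proof -
  have "Q (\<Sum>k\<in>K. Poly_Mapping.single k (c k))" if "finite K" for K and c :: "_ \<Rightarrow> 'v"
    using that
  proof induction
    case empty
    have "Q (Poly_Mapping.single 0 0)" by (rule single)
    then show ?case by simp
  qed (auto intro: assms)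
  from this[of "Poly_Mapping.keys P" "Poly_Mapping.lookup P"] show ?thesis
    by (simp add: pm_sum)
qed

lemma keys_sum_superset:
  fixes P :: "'v::zero vpoly" and F :: "_ \<Rightarrow> 'v \<Rightarrow> 'w::comm_monoid_add"
  assumes "\<And>k. F k 0 = 0" "finite K" "Poly_Mapping.keys P \<subseteq> K"
  shows "(\<Sum>k\<in>Poly_Mapping.keys P. F k (Poly_Mapping.lookup P k)) = (\<Sum>k\<in>K. F k (Poly_Mapping.lookup P k))"
  using assms by (intro sum.mono_neutral_left) (auto simp: in_keys_iff)

lemma keys_sum_add:
  fixes P R :: "'v::comm_monoid_add vpoly" and F :: "_ \<Rightarrow> 'v \<Rightarrow> 'w::comm_monoid_add"
  assumes z: "\<And>k. F k 0 = 0" and a: "\<And>k u v. F k (u + v) = F k u + F k v"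
  shows "(\<Sum>k\<in>Poly_Mapping.keys (P + R). F k (Poly_Mapping.lookup (P + R) k)) =
     (\<Sum>k\<in>Poly_Mapping.keys P. F k (Poly_Mapping.lookup P k)) +
     (\<Sum>k\<in>Poly_Mapping.keys R. F k (Poly_Mapping.lookup R k))"
proof -
  let ?K = "Poly_Mapping.keys P \<union> Poly_Mapping.keys R"
  have "Poly_Mapping.keys (P + R) \<subseteq> ?K" by (rule Poly_Mapping.keys_add)
  then have "(\<Sum>k\<in>Poly_Mapping.keys (P + R). F k (Poly_Mapping.lookup (P + R) k)) = (\<Sum>k\<in>?K. F k (Poly_Mapping.lookup (P + R) k))"
    using z by (intro keys_sum_superset) auto
  also have "\<dots> = (\<Sum>k\<in>?K. F k (Poly_Mapping.lookup P k)) + (\<Sum>k\<in>?K. F k (Poly_Mapping.lookup R k))"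
    by (simp add: lookup_add a sum.distrib)
  finally show ?thesis
    using z by (simp add: keys_sum_superset[where K="?K"])
qed

lemma keys_sum_single:
  fixes F :: "_ \<Rightarrow> 'v::zero \<Rightarrow> 'w::comm_monoid_add"
  assumes z: "\<And>k. F k 0 = 0"
  shows "(\<Sum>k\<in>Poly_Mapping.keys (Poly_Mapping.single l c). F k (Poly_Mapping.lookup (Poly_Mapping.single l c) k)) = F l c"
  using z by (cases "c = 0") auto

lemma lookup_emb: "Poly_Mapping.lookup (emb p) k = [:Poly_Mapping.lookup p k:]"
  by (simp add: emb_def map.rep_eq when_def)

lemma emb_add: "emb (p + q) = emb p + emb q"
  by (rule poly_mapping_eqI) (simp add: lookup_emb lookup_add)

lemma emb_single: "emb (Poly_Mapping.single k c) = Poly_Mapping.single k [:c:]"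
  by (rule poly_mapping_eqI) (simp add: lookup_emb lookup_single when_def)

lemma emb_mult: "emb (p * q) = emb p * emb q"
proof (induction p rule: pm_induct)
  case (single k c)
  show ?case
  proof (induction q rule: pm_induct)
    case (single k c)
    then show ?case by (simp add: emb_single mult_single mult.commute)
  qed (simp add: emb_add distrib_left)
qed (simp add: emb_add distrib_right)

lemma emb_1: "emb 1 = 1"
  by (metis emb_single one_poly_mapping.abs_eq pCons_one single_one)

lemma emb_0: "emb 0 = 0"
  by (rule poly_mapping_eqI) (simp add: lookup_emb)

lemma emb_minus: "emb (- p) = - emb p"
  by (metis add_eq_0_iff emb_0 emb_add)

lemma emb_X: "emb (X i) = X i"
  by (simp add: X_def emb_single one_pCons)

lemma emb_power: "emb (p ^ n) = emb p ^ n"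
  by (induction n) (simp_all add: emb_1 emb_mult)

lemma emb_prod: "emb (\<Prod>i\<in>I. f i) = (\<Prod>i\<in>I. emb (f i))"
  by (induction I rule: infinite_finite_induct) (simp_all add: emb_1 emb_mult)

lemma pmul_add_right:
  assumes "vector_space s" shows "pmul s p (P + R) = pmul s p P + pmul s p R"
proof -
  interpret vector_space s by fact
  show ?thesis unfolding pmul_def
    by (simp add: sum.distrib[symmetric] keys_sum_add[where F="\<lambda>l c. Poly_Mapping.single (_ + l) (s _ c)"]
         scale_right_distrib single_add)
qed

lemma pmul_add_left:
  assumes "vector_space s" shows "pmul s (p + q) P = pmul s p P + pmul s q P"
proof -
  interpret vector_space s by fact
  show ?thesis unfolding pmul_def
    by (subst keys_sum_add[where F="\<lambda>k c. \<Sum>l\<in>Poly_Mapping.keys P. Poly_Mapping.single (k + l) (s c (Poly_Mapping.lookup P l))"])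
       (simp_all add: scale_left_distrib single_add sum.distrib)
qed

lemma pmul_single:
  assumes "vector_space s"
  shows "pmul s (Poly_Mapping.single k c) (Poly_Mapping.single l v) = Poly_Mapping.single (k + l) (s c v)"
proof -
  interpret vector_space s by fact
  show ?thesis by (cases "c = 0"; cases "v = 0") (simp_all add: pmul_def)
qed

lemma vs_smult: "vector_space (Polynomial.smult :: complex \<Rightarrow> complex poly \<Rightarrow> complex poly)"
  by unfold_locales (simp_all add: smult_add_right smult_add_left)

lemma vs_mult: "vector_space ((*) :: complex \<Rightarrow> complex \<Rightarrow> complex)"
  by unfold_locales (simp_all add: distrib_left distrib_right)

lemma pmul_emb: "pmul Polynomial.smult p P = emb p * P"
proof (induction p rule: pm_induct)
  case (single k c)
  show ?case
  proof (induction P rule: pm_induct)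
    case (single l v)
    then show ?case by (simp add: pmul_single[OF vs_smult] emb_single mult_single)
  qed (simp add: pmul_add_right[OF vs_smult] distrib_left)
qed (simp add: emb_add distrib_right pmul_add_left[OF vs_smult])

lemma cst_add: "cst (u + v) = cst u + cst v" by (simp add: cst_def single_add)
lemma cst_0: "cst 0 = 0" by (simp add: cst_def)
lemma cst_1: "cst 1 = 1" by (simp add: cst_def)
lemma cst_mult: "cst (u * v) = cst u * cst v" by (simp add: cst_def mult_single)

lemma ev_0: "ev x 0 = 0" by (simp add: ev_def)
lemma ev_pCons: "ev x (pCons a p) = cst [:a:] + x * ev x p"
  by (cases "a = 0 \<and> p = 0") (auto simp add: ev_def cst_0 map_poly_pCons)
lemma ev_const: "ev x [:a:] = cst [:a:]"
  by (simp add: ev_pCons ev_0)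
lemma ev_add: "ev x (p + q) = ev x p + ev x q"
proof (induction p arbitrary: q)
  case (pCons a p)
  show ?case
  proof (cases q)
    case (pCons b q')
    have "cst [:a + b:] = cst [:a:] + cst [:b:]" by (simp flip: cst_add)
    then show ?thesis using pCons.IH by (simp add: pCons ev_pCons pCons.IH algebra_simps)
  qed
qed (simp add: ev_0)
lemma ev_smult: "ev x (Polynomial.smult c p) = cst [:c:] * ev x p"
proof (induction p)
  case (pCons a p)
  have "cst [:c * a:] = cst [:c:] * cst [:a:]" by (simp add: mult.commute flip: cst_mult)
  then show ?case by (simp add: pCons ev_pCons distrib_left mult_ac)
qed (simp add: ev_0)
lemma ev_mult: "ev x (p * q) = ev x p * ev x q"
  by (induction p) (simp_all add: ev_0 ev_pCons ev_add ev_smult algebra_simps cst_0)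
lemma ev_1: "ev x 1 = 1"
  by (simp add: one_pCons ev_const) (simp add: cst_1 flip: one_pCons)
lemma ev_Del: "ev Del p = cst p"
proof (induction p)
  case (pCons a p)
  have "pCons a p = [:a:] + [:0, 1:] * p" by simp
  then have "cst (pCons a p) = cst [:a:] + cst [:0, 1:] * cst p" by (simp flip: cst_add cst_mult)
  then show ?case by (simp add: ev_pCons pCons flip: Del_def)
qed (simp add: ev_0 cst_0)

text \<open>
  The map \<open>\<complex>[\<partial>][\<lambda>\<^sub>0, \<dots>] \<rightarrow> \<complex>[\<partial>][\<lambda>\<^sub>0, \<dots>]\<close> sending a monomial \<open>\<lambda>\<^sup>k\<close> to \<open>g k\<close> and \<open>\<partial>\<close> to \<open>z\<close>; a ring
  homomorphism if \<open>g\<close> is multiplicative.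
\<close>

definition evh :: "((nat \<Rightarrow>\<^sub>0 nat) \<Rightarrow> complex poly vpoly) \<Rightarrow> complex poly vpoly \<Rightarrow> complex poly vpoly \<Rightarrow> complex poly vpoly"
  where "evh g z P = (\<Sum>k\<in>Poly_Mapping.keys P. g k * ev z (Poly_Mapping.lookup P k))"

lemma evh_add: "evh g z (P + R) = evh g z P + evh g z R"
  unfolding evh_def by (rule keys_sum_add[where F="\<lambda>k c. g k * ev z c"]) (simp_all add: ev_0 ev_add distrib_left)

lemma evh_single: "evh g z (Poly_Mapping.single k c) = g k * ev z c"
  unfolding evh_def by (rule keys_sum_single[where F="\<lambda>k c. g k * ev z c"]) (simp_all add: ev_0)

lemma evh_0: "evh g z 0 = 0" by (simp add: evh_def)
lemma evh_minus: "evh g z (- P) = - evh g z P"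
  by (metis evh_0 evh_add add_eq_0_iff)

context
  fixes g :: "(nat \<Rightarrow>\<^sub>0 nat) \<Rightarrow> complex poly vpoly"
  assumes g0: "g 0 = 1" and gadd: "\<And>k l. g (k + l) = g k * g l"
begin

lemma evh_mult: "evh g z (P * R) = evh g z P * evh g z R"
proof (induction P rule: pm_induct)
  case (single k c)
  show ?case
  proof (induction R rule: pm_induct)
    case (single l v)
    then show ?case by (simp add: evh_single mult_single gadd ev_mult mult_ac)
  qed (simp add: evh_add distrib_left)
qed (simp add: evh_add distrib_right)

lemma evh_1: "evh g z 1 = 1"
  using evh_single[of g z 0 1] by (simp add: g0 ev_1)

lemma evh_cst: "evh g z (cst p) = ev z p"
  by (simp add: cst_def evh_single g0)

lemma evh_Del: "evh g z Del = z"
  by (simp add: Del_def evh_cst ev_pCons ev_0 cst_0) (simp add: cst_1 flip: one_pCons)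

lemma evh_X: "evh g z (X i) = g (Poly_Mapping.single i 1)"
  by (simp add: X_def evh_single ev_1)

lemma evh_ev: "evh g z (ev x p) = ev (evh g z x) p"
  by (induction p) (simp_all add: ev_0 evh_0 ev_pCons evh_add evh_mult evh_cst ev_const)

lemma evh_2: "evh g z 2 = 2"
  by (metis evh_1 evh_add one_add_one)

lemmas evh_simps = evh_mult evh_1 evh_cst evh_Del evh_X evh_ev evh_2 evh_add evh_0 evh_minus

end

definition subst_wt :: "complex vpoly list \<Rightarrow> (nat \<Rightarrow>\<^sub>0 nat) \<Rightarrow> complex poly vpoly"
  where "subst_wt xs k = emb (\<Prod>i<length xs. (xs ! i) ^ Poly_Mapping.lookup k i)"
definition mono_wt :: "(nat \<Rightarrow>\<^sub>0 nat) \<Rightarrow> complex poly vpoly"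
  where "mono_wt k = Poly_Mapping.single k 1"

lemma subst_wt: "subst_wt xs 0 = 1" "subst_wt xs (k + l) = subst_wt xs k * subst_wt xs l"
  by (simp_all add: subst_wt_def emb_1 lookup_add power_add prod.distrib emb_mult)
lemma mono_wt: "mono_wt 0 = 1" "mono_wt (k + l) = mono_wt k * mono_wt l"
  by (simp_all add: mono_wt_def mult_single)

lemma subst_evh: "subst Polynomial.smult xs P = evh (subst_wt xs) Del P"
  by (simp add: subst_def evh_def subst_wt_def pmul_emb ev_Del)

lemma subst_wt1: "subst_wt [x] (Poly_Mapping.single 0 1) = emb x"
  "subst_wt [x] 1 = emb x"
  by (simp_all add: subst_wt_def)

lemma subst_bracket:
  "subst Polynomial.smult [x] (vir_bracket p q) = ev (- emb x) p * ev (Del + emb x) q * (Del + 2 * emb x)"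
  by (simp add: subst_evh vir_bracket_def evh_simps[of "subst_wt [x]", OF subst_wt] subst_wt1 del: One_nat_def)

lemma evh_mono_emb: "evh mono_wt z (emb y) = emb y"
proof (induction y rule: pm_induct)
  case (single k c)
  have "evh mono_wt z (emb (Poly_Mapping.single k c)) = mono_wt k * cst [:c:]"
    by (simp add: emb_single evh_single ev_const)
  also have "\<dots> = Poly_Mapping.single k [:c:]" by (simp add: mono_wt_def cst_def mult_single)
  finally show ?case by (simp add: emb_single)
qed (simp add: emb_add evh_add)

lemma extend_right:
  "extend Polynomial.smult (\<lambda>e. subst Polynomial.smult [x] (vir_bracket a e)) P =
     ev (- emb x) a * (Del + 2 * emb x) * evh mono_wt (Del + emb x) P"
  by (simp add: extend_def subst_bracket pmul_emb emb_single evh_def sum_distrib_left mono_wt_def mult_ac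
     flip: one_pCons)

lemma extend_left:
  "extend Polynomial.smult (\<lambda>e. subst Polynomial.smult [x] (vir_bracket e c)) P =
     ev (Del + emb x) c * (Del + 2 * emb x) * evh mono_wt (- emb x) P"
  by (simp add: extend_def subst_bracket pmul_emb emb_single evh_def sum_distrib_left mono_wt_def mult_ac
     flip: one_pCons)

lemma evh_mono_minus_emb: "evh mono_wt z (- emb y) = - emb y"
  by (simp add: evh_minus evh_mono_emb)

lemma emb_cst: "emb (cst c) = cst [:c:]"
  by (simp add: cst_def emb_single)

lemma map_Del: "Poly_Mapping.map (pCons 0) P = Del * (P :: complex poly vpoly)"
proof (induction P rule: pm_induct)
  case (single k c)
  show ?case by (simp add: Del_def cst_def mult_single)
next
  case (add P R)
  have "Poly_Mapping.map (pCons 0) (P + R) = Poly_Mapping.map (pCons 0) P + Poly_Mapping.map (pCons 0) R"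
    by (rule poly_mapping_eqI) (auto simp: map.rep_eq when_def lookup_add)
  then show ?case by (simp add: add distrib_left)
qed

lemma funpow_mult: "((\<lambda>P. - (X 0 * P) - Del * P) ^^ n) Q = (- X 0 - Del) ^ n * (Q :: complex poly vpoly)"
  by (induction n) (simp_all add: algebra_simps)

lemma polys_add: "P \<in> polys n \<Longrightarrow> R \<in> polys n \<Longrightarrow> P + R \<in> polys n"
  using Poly_Mapping.keys_add[of P R] unfolding polys_def by blast
lemma polys_minus: "P \<in> polys n \<Longrightarrow> - P \<in> polys n" for P :: "'a::ab_group_add vpoly"
  by (simp add: polys_def)
lemma polys_mult: "P \<in> polys n \<Longrightarrow> R \<in> polys n \<Longrightarrow> P * R \<in> polys n" for P :: "'a::comm_ring_1 vpoly"
proof -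
  assume P: "P \<in> polys n" and R: "R \<in> polys n"
  show ?thesis unfolding polys_def
  proof (intro CollectI ballI subsetI)
    fix k i assume "k \<in> Poly_Mapping.keys (P * R)" "i \<in> Poly_Mapping.keys k"
    moreover obtain a b where "k = a + b" "a \<in> Poly_Mapping.keys P" "b \<in> Poly_Mapping.keys R"
      using calculation(1) keys_mult[of P R] by auto
    ultimately show "i \<in> {..<n}"
      using P R Poly_Mapping.keys_add[of a b] unfolding polys_def by blast
  qed
qed
lemma polys_cst: "cst c \<in> polys n" by (simp add: polys_def cst_def)
lemma polys_X: "i < n \<Longrightarrow> X i \<in> polys n" by (simp add: polys_def X_def)
lemma polys_2: "2 \<in> (polys n :: 'a::comm_ring_1 vpoly set)"
  by (metis polys_add polys_cst cst_1 one_add_one)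
lemma polys_ev: "x \<in> polys n \<Longrightarrow> ev x p \<in> polys n"
proof (induction p)
  case 0
  show ?case by (metis ev_0 cst_0 polys_cst)
qed (auto simp: ev_pCons intro!: polys_add polys_mult polys_cst)

lemma vir_bracket_L: "vir_bracket 1 1 = Del + 2 * X 0"
  by (simp add: vir_bracket_def ev_1)

global_interpretation Vir: conformal_algebra Polynomial.smult "pCons 0" vir_bracket
proof (intro conformal_algebra.intro conformal_algebra_axioms.intro)
  fix a b c :: "complex poly" and r s :: complex
  show "Vector_Spaces.linear (Polynomial.smult :: complex \<Rightarrow> _) Polynomial.smult (pCons 0)"
    by (simp add: Vector_Spaces.linear_iff vs_smult)
  show "vir_bracket a b \<in> polys 1"
    by (auto simp: vir_bracket_def Del_def intro!: polys_mult polys_ev polys_add polys_minus polys_X polys_cst polys_2)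
  show "vir_bracket (a + b) c = vir_bracket a c + vir_bracket b c"
   "vir_bracket a (b + c) = vir_bracket a b + vir_bracket a c"
    by (simp_all add: vir_bracket_def ev_add algebra_simps)
  show "vir_bracket (Polynomial.smult r a) b = pmul Polynomial.smult (cst r) (vir_bracket a b)"
    "vir_bracket a (Polynomial.smult r b) = pmul Polynomial.smult (cst r) (vir_bracket a b)"
    by (simp_all add: vir_bracket_def ev_smult pmul_emb emb_cst algebra_simps)
  show "vir_bracket (pCons 0 a) b = - pmul Polynomial.smult (X 0) (vir_bracket a b)"
    "vir_bracket a (pCons 0 b) = Poly_Mapping.map (pCons 0) (vir_bracket a b) + pmul Polynomial.smult (X 0) (vir_bracket a b)"
    by (simp_all add: vir_bracket_def ev_pCons pmul_emb emb_X map_Del cst_0 algebra_simps)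
  show "vir_bracket a b = - (\<Sum>k\<in>Poly_Mapping.keys (vir_bracket b a).
          ((\<lambda>P. - pmul Polynomial.smult (X 0) P - Poly_Mapping.map (pCons 0) P) ^^ Poly_Mapping.lookup k 0)
          (cst (Poly_Mapping.lookup (vir_bracket b a) k)))"
  proof -
    let ?g = "\<lambda>k. (- X 0 - Del) ^ Poly_Mapping.lookup k (0::nat) :: complex poly vpoly"
    have g: "?g 0 = 1" "?g (k + l) = ?g k * ?g l" for k l
      by (simp_all add: lookup_add power_add)
    have "evh ?g Del (vir_bracket b a) = - vir_bracket a b"
      by (simp add: vir_bracket_def evh_simps[of ?g, OF g]) (simp add: algebra_simps)
    then show ?thesis
      by (simp add: pmul_emb map_Del emb_X funpow_mult evh_def ev_Del)
  qed
  show "extend Polynomial.smult (\<lambda>e. subst Polynomial.smult [X 0] (vir_bracket a e)) (subst Polynomial.smult [X 1] (vir_bracket b c)) =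
       extend Polynomial.smult (\<lambda>e. subst Polynomial.smult [X 0 + X 1] (vir_bracket e c)) (subst Polynomial.smult [X 0] (vir_bracket a b)) +
       extend Polynomial.smult (\<lambda>e. subst Polynomial.smult [X 1] (vir_bracket b e)) (subst Polynomial.smult [X 0] (vir_bracket a c))"
    unfolding extend_left extend_right unfolding subst_bracket
    by (simp add: evh_simps[of mono_wt, OF mono_wt] evh_mono_minus_emb evh_mono_emb emb_add)
       (simp add: algebra_simps)
qed (rule vs_smult)

lemma map_zero: "Poly_Mapping.map (\<lambda>_. 0) P = 0"
  by (rule poly_mapping_eqI) (simp add: map.rep_eq when_def)

global_interpretation Vir_triv: conformal_module Polynomial.smult "pCons 0" vir_bracket
    "(*) :: complex \<Rightarrow> complex \<Rightarrow> complex" "\<lambda>_. 0" "\<lambda>_ _. 0"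
proof (intro conformal_module.intro conformal_module_axioms.intro)
  have [simp]: "pmul (*) p (0 :: complex vpoly) = 0" for p by (simp add: pmul_def)
  have [simp]: "subst (*) p (0 :: complex vpoly) = 0" for p by (simp add: subst_def)
  have [simp]: "extend (*) (\<lambda>_. (0 :: complex vpoly)) P = 0" for P :: "'b::zero vpoly" by (simp add: extend_def)
  fix a b :: "complex poly" and r s v w :: complex
  show "Vector_Spaces.linear (*) (*) (\<lambda>_::complex. 0::complex)"
    by (simp add: Vector_Spaces.linear_iff vs_mult)
  show "0 \<in> (polys 1 :: complex vpoly set)" by (simp add: polys_def)
  show "conformal_algebra Polynomial.smult (pCons 0) vir_bracket" by unfold_locales
qed (rule vs_mult, simp_all add: pmul_def subst_def extend_def map_zero)

end

theory Submission
  imports Defs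
begin

text \<open>
  A cochain in \<open>n\<close> arguments is determined by its value \<open>f\<close> on \<open>(L, \<dots>, L)\<close>, a skew-symmetric polynomial
  in \<open>\<lambda>\<^sub>1, \<dots>, \<lambda>\<^sub>n\<close>; the differential becomes
  \<open>(d f)(\<lambda>\<^sub>1, \<dots>) = \<Sum>\<^bsub>i<j\<^esub> (-1)\<^sup>i\<^sup>+\<^sup>j (\<lambda>\<^sub>i - \<lambda>\<^sub>j) f(\<lambda>\<^sub>i + \<lambda>\<^sub>j, \<dots>)\<close>.  With \<open>\<iota>\<^sub>\<mu>\<close> the insertion of \<open>\<mu>\<close> as
  first argument and \<open>\<theta>\<^sub>\<mu>\<close> the Lie derivative, Cartan's formula \<open>\<iota>\<^sub>\<mu> d + d \<iota>\<^sub>\<mu> = - \<theta>\<^sub>\<mu>\<close> (in the sign conventions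
  used here) yields \<open>d\<^sup>2 = 0\<close>.  Differentiating it at \<open>\<mu> = 0\<close> shows that \<open>\<partial>/\<partial>\<mu> \<iota>\<^sub>\<mu>\<close> at \<open>\<mu> = 0\<close> is a homotopy
  between 0 and (degree \<open>- n\<close>).  So only skew-symmetric polynomials of degree \<open>n\<close> in \<open>n\<close> variables
  contribute.  Their degree is at least \<open>n (n - 1) / 2\<close>, which leaves \<open>n \<le> 3\<close>: the constants, the
  coboundary \<open>\<lambda>\<^sub>1\<^sup>2 - \<lambda>\<^sub>2\<^sup>2\<close> of \<open>- \<lambda>\<^sub>1\<close>, the Vandermonde polynomial \<open>\<Lambda>\<close> in three variables, and \<open>\<lambda>\<^sub>1\<close>, which is not closed.
  On functions \<open>\<partial>\<close> is multiplication by \<open>\<Sum>\<^sub>i \<lambda>\<^sub>i\<close>, which is injective for \<open>n \<ge> 1\<close>.  A reduced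
  cocycle \<open>f\<close> has \<open>d f = \<partial> h\<close> with \<open>h\<close> closed, and subtracting a preimage of \<open>h\<close> reduces to the basic
  case, except that \<open>h = \<Lambda>\<close> is not exact while \<open>\<partial> \<Lambda>\<close> is: \<open>\<partial> \<Lambda> = d(\<lambda>\<^sub>1 \<lambda>\<^sub>2 (\<lambda>\<^sub>1 - \<lambda>\<^sub>2))\<close>.  This is the extra
  class in degree 2.
\<close>

text \<open>
  For \<open>(*)\<close> as scalar multiplication this rule is associativity from right to left, and the simplifier
  loops when it is combined with \<open>mult_ac\<close>.
\<close>

declare Vir_triv.M.scale_scale [simp del]

section \<open>Lie derivative and differential on functions\<close>

text \<open>In the slot that receives the bracket, \<partial> becomes \<open>- (m + y)\<close>, so
  the factor \<partial> + 2 \<lambda> of the bracket at \<lambda> = \<open>m\<close> turns into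
  \<open>m - y\<close>. The new argument stays in its place instead of moving to the front: this
  makes sense without skew-symmetry and suits recursion on the list.\<close>

fun lie_der :: "complex \<Rightarrow> (complex list \<Rightarrow> complex) \<Rightarrow> complex list \<Rightarrow> complex" where
  "lie_der m f [] = 0"
| "lie_der m f (y # xs) = (m - y) * f ((m + y) # xs) + lie_der m (\<lambda>ys. f (y # ys)) xs"

text \<open>
  Cartan's formula serves as the recursion; for skew-symmetric functions this is the usual sum
  (\<open>cdiff_eq_sum\<close>), but the identities below hold for all functions.
\<close>

fun cdiff :: "(complex list \<Rightarrow> complex) \<Rightarrow> complex list \<Rightarrow> complex" where
  "cdiff f [] = 0"
| "cdiff f (m # xs) = - lie_der m f xs - cdiff (\<lambda>ys. f (m # ys)) xs"

section \<open>Linearity and the Cartan calculus\<close>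

lemma lie_der_lin: "lie_der m (\<lambda>ys. a * f ys + b * g ys) xs = a * lie_der m f xs + b * lie_der m g xs"
proof (induction xs arbitrary: f g)
  case (Cons y xs)
  show ?case
    using Cons.IH[of "\<lambda>ys. f (y # ys)" "\<lambda>ys. g (y # ys)"] by (simp add: algebra_simps)
qed simp

lemma cdiff_lin: "cdiff (\<lambda>ys. a * f ys + b * g ys) xs = a * cdiff f xs + b * cdiff g xs"
proof (induction xs arbitrary: f g)
  case (Cons y xs)
  show ?case
    using Cons.IH[of "\<lambda>ys. f (y # ys)" "\<lambda>ys. g (y # ys)"] lie_der_lin[of y a f b g xs]
    by (simp add: algebra_simps)
qed simp

lemma lie_der_scale: "lie_der m (\<lambda>ys. a * f ys) xs = a * lie_der m f xs"
  using lie_der_lin[of m a f 0 f xs] by simp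
lemma lie_der_add: "lie_der m (\<lambda>ys. f ys + g ys) xs = lie_der m f xs + lie_der m g xs"
  using lie_der_lin[of m 1 f 1 g xs] by simp
lemma lie_der_diff: "lie_der m (\<lambda>ys. f ys - g ys) xs = lie_der m f xs - lie_der m g xs"
  using lie_der_lin[of m 1 f "-1" g xs] by simp
lemma lie_der_uminus: "lie_der m (\<lambda>ys. - f ys) xs = - lie_der m f xs"
  using lie_der_lin[of m "-1" f 0 f xs] by simp
lemma cdiff_scale: "cdiff (\<lambda>ys. a * f ys) xs = a * cdiff f xs"
  using cdiff_lin[of a f 0 f xs] by simp
lemma cdiff_add: "cdiff (\<lambda>ys. f ys + g ys) xs = cdiff f xs + cdiff g xs"
  using cdiff_lin[of 1 f 1 g xs] by simp
lemma cdiff_diff: "cdiff (\<lambda>ys. f ys - g ys) xs = cdiff f xs - cdiff g xs"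
  using cdiff_lin[of 1 f "-1" g xs] by simp
lemma cdiff_uminus: "cdiff (\<lambda>ys. - f ys) xs = - cdiff f xs"
  using cdiff_lin[of "-1" f 0 f xs] by simp
lemma cdiff_zero: "cdiff (\<lambda>_. 0) xs = 0"
  using cdiff_lin[of 0 undefined 0 undefined xs] by simp

text \<open>Modifications of different slots commute. In a single slot the claim is \<open>(m - y) *
  (n - m - y) - (n - y) * (m - n - y) = - (m - n) * (m + n - y)\<close>, the Jacobi identity of the
  bracket.\<close>

lemma lie_der_commutator:
  "lie_der m (lie_der n f) xs - lie_der n (lie_der m f) xs = - (m - n) * lie_der (m + n) f xs"
proof (induction xs arbitrary: f)
  case (Cons y xs)
  show ?case
    using Cons.IH[of "\<lambda>ys. f (y # ys)"]
    by (simp add: lie_der_add lie_der_scale) (simp add: algebra_simps)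
qed simp

text \<open>Unfolding the recursion at a head \<open>y\<close> leaves the commutator of
  \<open>lie_der m\<close> and \<open>lie_der y\<close>, which produces the term
  \<open>(m - y) * lie_der (m + y) f xs\<close>, and the claim for \<open>f\<close> with
  \<open>y\<close> inserted.\<close>

lemma lie_der_cdiff: "lie_der m (cdiff f) xs = cdiff (lie_der m f) xs"
proof (induction xs arbitrary: f)
  case (Cons y xs)
  show ?case
    using Cons.IH[of "\<lambda>ys. f (y # ys)"] lie_der_commutator[of m y f xs]
    by (simp add: lie_der_diff lie_der_uminus cdiff_add cdiff_scale) (simp add: algebra_simps)
qed simp

text \<open>Two uses of the recursion at a head \<open>y\<close> give
  \<open>cdiff (lie_der y f)\<close> minus \<open>lie_der y (cdiff f)\<close>, which cancel, and the
  double differential of \<open>f\<close> with \<open>y\<close> inserted, which is covered by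
  induction.\<close>

lemma cdiff_cdiff: "cdiff (cdiff f) xs = 0"
proof (induction xs arbitrary: f)
  case (Cons y xs)
  then show ?case
    by (simp add: lie_der_cdiff cdiff_diff cdiff_uminus)
qed simp

text \<open>Replacing an entry \<open>y\<close> by \<open>m + y\<close> raises the total by
  \<open>m\<close>, whatever the slot. The constant \<open>c\<close> absorbs the arguments that the
  recursion has already split off.\<close>

lemma lie_der_sum_list_mult:
  "lie_der m (\<lambda>ys. (c + sum_list ys) * f ys) xs = (c + m + sum_list xs) * lie_der m f xs"
proof (induction xs arbitrary: f c)
  case (Cons y xs)
  show ?case
    using Cons.IH[of "c + y" "\<lambda>ys. f (y # ys)"] by (simp add: algebra_simps)
qed simp

lemma cdiff_sum_list_mult:
  "cdiff (\<lambda>ys. (c + sum_list ys) * f ys) xs = (c + sum_list xs) * cdiff f xs"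
proof (induction xs arbitrary: f c)
  case (Cons y xs)
  show ?case
    using Cons.IH[of "c + y" "\<lambda>ys. f (y # ys)"]
    by (simp add: lie_der_sum_list_mult) (simp add: algebra_simps)
qed simp

text \<open>The factor \<open>t\<close> is what \<open>m - y\<close> gains under dilation. Through
  \<open>cdiff_dilate\<close> it means that the differential raises the degree by one, which later
  separates homogeneous components.\<close>

lemma lie_der_dilate: "t * lie_der m (\<lambda>ys. f (map ((*) t) ys)) xs = lie_der (t * m) f (map ((*) t) xs)"
proof (induction xs arbitrary: f)
  case (Cons y xs)
  show ?case
    using Cons.IH[of "\<lambda>ys. f (t * y # ys)"] by (simp add: algebra_simps)
qed simp

lemma cdiff_dilate: "t * cdiff (\<lambda>ys. f (map ((*) t) ys)) xs = cdiff f (map ((*) t) xs)"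
proof (induction xs arbitrary: f)
  case (Cons y xs)
  show ?case
    using Cons.IH[of "\<lambda>ys. f (t * y # ys)"] lie_der_dilate[of t y f xs] by (simp add: ring_distribs)
qed simp

lemma lie_der_length:
  assumes "\<And>ys. length ys \<noteq> n \<Longrightarrow> f ys = 0" "length xs \<noteq> n"
  shows "lie_der m f xs = 0"
  using assms
proof (induction xs arbitrary: f n)
  case (Cons y xs)
  show ?case
  proof (cases n)
    case 0
    then have "f (y # ys) = 0" for ys using Cons.prems by simp
    moreover have "lie_der m (\<lambda>_. 0) xs = 0" using lie_der_scale[of m 0 f xs] by simp
    ultimately show ?thesis using 0 Cons.prems by simp
  next
    case (Suc k)
    then show ?thesis using Cons.prems Cons.IH[of k "\<lambda>ys. f (y # ys)"] by simp
  qed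
qed simp

lemma cdiff_length:
  assumes "\<And>ys. length ys \<noteq> n \<Longrightarrow> f ys = 0" "length xs \<noteq> Suc n"
  shows "cdiff f xs = 0"
  using assms
proof (induction xs arbitrary: f n)
  case (Cons y xs)
  have 1: "lie_der y f xs = 0" using Cons.prems by (intro lie_der_length[of n]) auto
  show ?case
  proof (cases n)
    case 0
    then have "f (y # ys) = 0" for ys using Cons.prems by simp
    then show ?thesis using 1 by (simp add: cdiff_zero)
  next
    case (Suc k)
    then show ?thesis using Cons.prems Cons.IH[of k "\<lambda>ys. f (y # ys)"] 1 by simp
  qed
qed simp

section \<open>Skew-symmetric functions on lists\<close>

definition skew :: "(complex list \<Rightarrow> complex) \<Rightarrow> bool" where
  "skew f \<longleftrightarrow> (\<forall>as x y bs. f (as @ x # y # bs) = - f (as @ y # x # bs))"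

lemma skewD: "skew f \<Longrightarrow> f (as @ x # y # bs) = - f (as @ y # x # bs)"
  unfolding skew_def by blast

lemma skewI: "(\<And>as x y bs. f (as @ x # y # bs) = - f (as @ y # x # bs)) \<Longrightarrow> skew f"
  unfolding skew_def by blast

lemma skew_Cons:
  assumes "skew f"
  shows "skew (\<lambda>ys. f (x # ys))"
proof (rule skewI)
  fix as a b bs
  show "f (x # as @ a # b # bs) = - f (x # as @ b # a # bs)"
    using skewD[OF assms, of "x # as" a b bs] by simp
qed

lemma skew_swap_head: "skew f \<Longrightarrow> f (x # y # bs) = - f (y # x # bs)"
  using skewD[of f "[]" x y bs] by simp

lemma skew_lin:
  assumes "skew f" "skew g"
  shows "skew (\<lambda>ys. a * f ys + b * g ys)"
proof (rule skewI)
  fix as x y bs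
  show "a * f (as @ x # y # bs) + b * g (as @ x # y # bs) =
      - (a * f (as @ y # x # bs) + b * g (as @ y # x # bs))"
    using skewD[OF assms(1), of as x y bs] skewD[OF assms(2), of as x y bs] by simp
qed

lemma skew_lie_der_aux:
  assumes "skew f"
  shows "lie_der m f (as @ x # y # bs) = - lie_der m f (as @ y # x # bs)"
  using assms
proof (induction as arbitrary: f)
  case Nil
  have "(\<lambda>ys. f (x # y # ys)) = (\<lambda>ys. - f (y # x # ys))"
    using skew_swap_head[OF Nil] by blast
  then show ?case
    using skew_swap_head[OF Nil, of "m + x" y bs] skew_swap_head[OF Nil, of x "m + y" bs]
    by (simp add: lie_der_uminus algebra_simps)
next
  case (Cons a as)
  show ?case
    using Cons.IH[OF skew_Cons[OF Cons.prems], of a] skewD[OF Cons.prems, of "(m + a) # as" x y bs]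
    by (simp add: algebra_simps)
qed

text \<open>With \<open>x\<close> and \<open>y\<close> at the head, two steps of the recursion give
  \<open>(x - y) * f ((x + y) # bs)\<close> up to sign, two Lie derivatives that the swap exchanges
  with opposite signs, and the differential of \<open>f\<close> with both inserted; each part
  changes sign.\<close>

lemma skew_cdiff_aux:
  assumes "skew f"
  shows "cdiff f (as @ x # y # bs) = - cdiff f (as @ y # x # bs)"
  using assms
proof (induction as arbitrary: f)
  case Nil
  have "(\<lambda>ys. f (x # y # ys)) = (\<lambda>ys. - f (y # x # ys))"
    using skew_swap_head[OF Nil] by blast
  then show ?case
    by (simp add: cdiff_uminus algebra_simps)
next
  case (Cons a as)
  show ?case
    using Cons.IH[OF skew_Cons[OF Cons.prems], of a] skew_lie_der_aux[OF Cons.prems, of a as x y bs]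
    by (simp add: algebra_simps)
qed

lemma skew_cdiff: "skew f \<Longrightarrow> skew (cdiff f)"
  by (rule skewI) (rule skew_cdiff_aux)

lemma skew_move_front: "skew f \<Longrightarrow> f (as @ x # bs) = (- 1) ^ length as * f (x # as @ bs)"
proof (induction as arbitrary: f)
  case (Cons a as)
  show ?case
    using Cons.IH[OF skew_Cons[OF Cons.prems], of a] skew_swap_head[OF Cons.prems, of a x "as @ bs"] by simp
qed simp

lemma omit_Cons: "omit 0 (x # xs) = xs" "omit (Suc i) (x # xs) = x # omit i xs"
  by (simp_all add: omit_def)

text \<open>The modified argument passes \<open>j\<close> entries on its way to the front, which
  costs the sign \<open>(-1) ^ j\<close>.\<close>

lemma lie_der_eq_sum:
  assumes "skew f"
  shows "lie_der m f xs = (\<Sum>j<length xs. (-1) ^ j * (m - xs ! j) * f ((m + xs ! j) # omit j xs))"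
  using assms
proof (induction xs arbitrary: f)
  case (Cons y xs)
  have "f (y # (m + xs ! j) # omit j xs) = - f ((m + xs ! j) # y # omit j xs)" for j
    using skew_swap_head[OF Cons.prems] .
  then show ?case using Cons.IH[OF skew_Cons[OF Cons.prems]]
    by (simp add: sum.lessThan_Suc_shift omit_Cons sum_negf del: sum.lessThan_Suc)
qed simp

text \<open>The pairs with \<open>i = 0\<close> come from the Lie derivative, the others from the
  recursive call. This links the recursion to the second sum in \<open>basic_diff\<close>.\<close>

lemma cdiff_eq_sum:
  assumes "skew f"
  shows "cdiff f xs = (\<Sum>j<length xs. \<Sum>i<j. (-1) ^ (i + j) * (xs ! i - xs ! j) * f ((xs ! i + xs ! j) # omit i (omit j xs)))"
  using assms
proof (induction xs arbitrary: f)
  case (Cons y xs)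
  have "f (y # (xs ! i + xs ! j) # omit i (omit j xs)) = - f ((xs ! i + xs ! j) # y # omit i (omit j xs))" for i j
    using skew_swap_head[OF Cons.prems] .
  then show ?case using Cons.IH[OF skew_Cons[OF Cons.prems]] lie_der_eq_sum[OF Cons.prems, of y xs]
    by (simp add: sum.lessThan_Suc_shift omit_Cons sum_negf sum.distrib sum_subtractf del: sum.lessThan_Suc)
qed simp

section \<open>Evaluation of polynomials\<close>

text \<open>Variables beyond the end of the list count as 1. This is the convention of
  \<open>subst\<close> too, so that \<open>evl_subst\<close> holds for every
  \<open>P\<close>.\<close>

definition mon :: "complex list \<Rightarrow> (nat \<Rightarrow>\<^sub>0 nat) \<Rightarrow> complex" where
  "mon xs k = (\<Prod>i<length xs. xs ! i ^ Poly_Mapping.lookup k i)"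

lemma mon_0: "mon xs 0 = 1"
  by (simp add: mon_def)

lemma mon_add: "mon xs (k + l) = mon xs k * mon xs l"
  by (simp add: mon_def lookup_add power_add prod.distrib)

lemma mon_single: "i < length xs \<Longrightarrow> mon xs (Poly_Mapping.single i 1) = xs ! i"
proof -
  assume i: "i < length xs"
  have "mon xs (Poly_Mapping.single i 1) = (\<Prod>j<length xs. if i = j then xs ! j else 1)"
    unfolding mon_def by (rule prod.cong) (auto simp: lookup_single when_def)
  then show ?thesis using i by simp
qed

text \<open>The map \<open>h\<close> on coefficients serves two rings: the identity for the values
  of cochains, and evaluation at \<partial> = z for brackets, whose coefficients lie in
  \<complex>[\<partial>].\<close>

definition weval :: "('v::comm_ring_1 \<Rightarrow> complex) \<Rightarrow> complex list \<Rightarrow> 'v vpoly \<Rightarrow> complex" where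
  "weval h xs P = (\<Sum>k\<in>Poly_Mapping.keys P. mon xs k * h (Poly_Mapping.lookup P k))"

locale coeff_hom =
  fixes h :: "'v::comm_ring_1 \<Rightarrow> complex"
  assumes h_add: "h (a + b) = h a + h b" and h_mult: "h (a * b) = h a * h b" and h_1: "h 1 = 1"
begin

lemma h_0: "h 0 = 0"
  using h_add[of 0 0] by simp

lemma weval_0: "weval h xs 0 = 0"
  by (simp add: weval_def)

lemma weval_single: "weval h xs (Poly_Mapping.single k c) = mon xs k * h c"
  unfolding weval_def by (rule keys_sum_single[where F="\<lambda>k c. mon xs k * h c"]) (simp add: h_0)

lemma weval_add: "weval h xs (P + R) = weval h xs P + weval h xs R"
  unfolding weval_def
  by (rule keys_sum_add[where F="\<lambda>k c. mon xs k * h c"]) (simp_all add: h_0 h_add distrib_left)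

lemma weval_mult: "weval h xs (P * R) = weval h xs P * weval h xs R"
proof (induction P rule: pm_induct)
  case (single k c)
  show ?case
  proof (induction R rule: pm_induct)
    case (single l v)
    then show ?case by (simp add: weval_single mult_single mon_add h_mult mult_ac)
  qed (simp add: weval_add distrib_left)
qed (simp add: weval_add distrib_right)

lemma weval_cst: "weval h xs (cst c) = h c"
  by (simp add: cst_def weval_single mon_0)

lemma weval_1: "weval h xs 1 = 1"
  by (metis cst_1 h_1 weval_cst)

lemma weval_minus: "weval h xs (- P) = - weval h xs P"
  by (metis add_eq_0_iff weval_0 weval_add)

lemma weval_X: "i < length xs \<Longrightarrow> weval h xs (X i) = xs ! i"
  using mon_single[of i xs] by (simp add: X_def weval_single h_1)

lemma weval_sum: "weval h xs (\<Sum>i\<in>I. F i) = (\<Sum>i\<in>I. weval h xs (F i))"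
  by (induction I rule: infinite_finite_induct) (simp_all add: weval_0 weval_add)

lemma weval_prod: "weval h xs (\<Prod>i\<in>I. F i) = (\<Prod>i\<in>I. weval h xs (F i))"
  by (induction I rule: infinite_finite_induct) (simp_all add: weval_1 weval_mult)

lemma weval_power: "weval h xs (P ^ n) = weval h xs P ^ n"
  by (induction n) (simp_all add: weval_1 weval_mult)

lemmas weval_simps = weval_0 weval_1 weval_add weval_minus weval_mult weval_cst weval_sum weval_prod weval_power

end

interpretation id_hom: coeff_hom "\<lambda>c. c"
  by unfold_locales simp_all
interpretation poly_hom: coeff_hom "\<lambda>p. poly p z" for z
  by unfold_locales simp_all

abbreviation evl :: "complex list \<Rightarrow> complex vpoly \<Rightarrow> complex" where
  "evl \<equiv> weval (\<lambda>c. c)"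

abbreviation pevl :: "complex \<Rightarrow> complex list \<Rightarrow> complex poly vpoly \<Rightarrow> complex" where
  "pevl z \<equiv> weval (\<lambda>p. poly p z)"

lemma pmul_mult: "pmul (*) p P = p * P"
proof (induction p rule: pm_induct)
  case (single k c)
  show ?case
  proof (induction P rule: pm_induct)
    case (single l v)
    then show ?case by (simp add: pmul_single[OF vs_mult] mult_single)
  qed (simp add: pmul_add_right[OF vs_mult] distrib_left)
qed (simp add: distrib_right pmul_add_left[OF vs_mult])

lemma pevl_ev: "pevl z xs (ev P q) = poly q (pevl z xs P)"
  by (induction q) (simp_all add: ev_0 ev_pCons poly_hom.weval_simps)

lemma pevl_Del: "pevl z xs Del = z"
  by (simp add: Del_def poly_hom.weval_cst)

lemma evl_subst: "evl ys (subst (*) xs P) = evl (map (evl ys) xs) P"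
  by (simp add: subst_def pmul_mult id_hom.weval_simps weval_def[of _ "map _ _"] mon_def)

text \<open>A cochain sees the argument \<open>b\<close> of a slot only through the value of
  \<open>b\<close> at \<partial> = z, where \<open>- z\<close> is the variable of the slot.
  Inserting a bracket therefore amounts to evaluating it at that \<partial>.\<close>

lemma evl_extend:
  assumes "\<And>b. evl xs (F b) = poly b z * r"
  shows "evl xs (extend (*) F P) = pevl z xs P * r"
  unfolding extend_def
  by (simp add: pmul_mult id_hom.weval_simps id_hom.weval_single assms weval_def[of "\<lambda>p. poly p z"]
      sum_distrib_right mult.assoc)

lemma polys_0: "0 \<in> polys n"
  by (simp add: polys_def)

lemma polys_1: "(1 :: 'v::comm_ring_1 vpoly) \<in> polys n"
  by (metis polys_cst cst_1)

lemma polys_sum: "(\<And>i. i \<in> I \<Longrightarrow> F i \<in> polys n) \<Longrightarrow> (\<Sum>i\<in>I. F i) \<in> polys n"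
  by (induction I rule: infinite_finite_induct) (simp_all add: polys_0 polys_add)

lemma polys_prod:
  fixes F :: "_ \<Rightarrow> 'v::comm_ring_1 vpoly"
  shows "(\<And>i. i \<in> I \<Longrightarrow> F i \<in> polys n) \<Longrightarrow> (\<Prod>i\<in>I. F i) \<in> polys n"
  by (induction I rule: infinite_finite_induct) (simp_all add: polys_1 polys_mult)

lemma polys_power: "P \<in> polys n \<Longrightarrow> P ^ m \<in> polys n" for P :: "'v::comm_ring_1 vpoly"
  by (induction m) (simp_all add: polys_1 polys_mult)

lemma polys_subst: "(\<And>x. x \<in> set xs \<Longrightarrow> x \<in> polys n) \<Longrightarrow> subst (*) xs P \<in> polys n"
  unfolding subst_def pmul_mult
  by (intro polys_sum polys_mult polys_prod polys_power polys_cst) simp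

lemma polys_extend:
  assumes "P \<in> polys n" "\<And>b. F b \<in> polys n"
  shows "extend (*) F P \<in> polys n"
  unfolding extend_def pmul_mult
proof (intro polys_sum polys_mult assms)
  fix k assume "k \<in> Poly_Mapping.keys P"
  then show "Poly_Mapping.single k 1 \<in> polys n"
    using assms(1) by (auto simp: polys_def)
qed

lemma polys_subst_bracket:
  assumes "i < n"
  shows "subst Polynomial.smult [X i] (vir_bracket a b) \<in> polys n"
  unfolding subst_bracket emb_X Del_def
  by (intro polys_mult polys_ev polys_add polys_minus polys_X polys_cst polys_2 assms)

lemma pevl_subst_bracket:
  assumes "i < length xs"
  shows "pevl z xs (subst Polynomial.smult [X i] (vir_bracket a b)) =
    poly a (- (xs ! i)) * poly b (z + xs ! i) * (z + 2 * xs ! i)"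
proof -
  have "pevl z xs 2 = 2"
    by (metis one_add_one poly_hom.weval_1 poly_hom.weval_add)
  then show ?thesis
    using assms by (simp add: subst_bracket emb_X pevl_ev poly_hom.weval_simps pevl_Del poly_hom.weval_X)
qed

section \<open>Polynomials are determined by their values\<close>

lemma monomials_independent:
  fixes e :: "'k \<Rightarrow> nat \<Rightarrow> nat" and c :: "'k \<Rightarrow> complex"
  assumes "finite K"
    and "\<And>k l. k \<in> K \<Longrightarrow> l \<in> K \<Longrightarrow> (\<forall>i<n. e k i = e l i) \<Longrightarrow> k = l"
    and "\<And>xs. length xs = n \<Longrightarrow> (\<Sum>k\<in>K. c k * (\<Prod>i<n. xs ! i ^ e k i)) = 0"
    and "k \<in> K"
  shows "c k = 0"
  using assms
proof (induction n arbitrary: K)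
  case 0
  have "K = {k}" using 0(2,4) by auto
  then show ?case using 0(3)[of "[]"] by simp
next
  case (Suc n)
  let ?K = "{l \<in> K. e l n = e k n}"
  show ?case
  proof (rule Suc.IH[of ?K])
    show "finite ?K" using Suc.prems(1) by simp
    show "k \<in> ?K" using Suc.prems(4) by simp
    show "l = l'" if "l \<in> ?K" "l' \<in> ?K" "\<forall>i<n. e l i = e l' i" for l l'
      using Suc.prems(2)[of l l'] that less_Suc_eq by auto
    fix xs :: "complex list" assume xs: "length xs = n"
    \<comment> \<open>With the first \<open>n\<close> variables frozen, the sum is a polynomial in
      the last one. It vanishes everywhere, and its coefficient at \<open>e k n\<close> is the sum
      over \<open>?K\<close>, whose members still differ in the first \<open>n\<close>
      exponents.\<close>
    define p where "p = (\<Sum>l\<in>K. Polynomial.monom (c l * (\<Prod>i<n. xs ! i ^ e l i)) (e l n))"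
    have "poly p t = 0" for t
    proof -
      have "poly p t = (\<Sum>l\<in>K. c l * (\<Prod>i<Suc n. (xs @ [t]) ! i ^ e l i))"
        using xs by (simp add: p_def poly_sum poly_monom nth_append mult.assoc)
      also have "\<dots> = 0" using xs by (intro Suc.prems(3)) simp
      finally show ?thesis .
    qed
    then have "p = 0" using poly_all_0_iff_0 by blast
    then have "coeff p (e k n) = 0" by simp
    then show "(\<Sum>l\<in>?K. c l * (\<Prod>i<n. xs ! i ^ e l i)) = 0"
      using Suc.prems(1) by (simp add: p_def coeff_sum sum.inter_filter)
  qed
qed

lemma polys_exponents_eq:
  assumes "k \<in> Poly_Mapping.keys p" "l \<in> Poly_Mapping.keys q" "p \<in> polys n" "q \<in> polys n"
    "\<forall>i<n. Poly_Mapping.lookup k i = Poly_Mapping.lookup l i"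
  shows "k = l"
proof (rule poly_mapping_eqI)
  fix i
  have "Poly_Mapping.lookup k i = 0" "Poly_Mapping.lookup l i = 0" if "\<not> i < n"
    using assms(1-4) that unfolding polys_def by (auto simp: in_keys_iff subset_iff)
  then show "Poly_Mapping.lookup k i = Poly_Mapping.lookup l i" using assms(5) by metis
qed

lemma evl_eq_0_imp:
  assumes p: "p \<in> polys n" and z: "\<And>xs. length xs = n \<Longrightarrow> evl xs p = 0"
  shows "p = 0"
proof -
  have "Poly_Mapping.lookup p k = 0" if "k \<in> Poly_Mapping.keys p" for k
  proof (rule monomials_independent[where K="Poly_Mapping.keys p" and n=n and e="Poly_Mapping.lookup" and c="Poly_Mapping.lookup p"])
    show "l = l'" if "l \<in> Poly_Mapping.keys p" "l' \<in> Poly_Mapping.keys p" "\<forall>i<n. Poly_Mapping.lookup l i = Poly_Mapping.lookup l' i" for l l'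
      using polys_exponents_eq[OF that(1,2) p p that(3)] .
    show "(\<Sum>k\<in>Poly_Mapping.keys p. Poly_Mapping.lookup p k * (\<Prod>i<n. xs ! i ^ Poly_Mapping.lookup k i)) = 0"
      if "length xs = n" for xs
      using z[OF that] that by (simp add: weval_def mon_def mult.commute)
  qed (use that in simp_all)
  then show ?thesis by (metis in_keys_iff poly_mapping_eqI lookup_zero)
qed

lemma evl_inj:
  assumes "p \<in> polys n" "q \<in> polys n" "\<And>xs. length xs = n \<Longrightarrow> evl xs p = evl xs q"
  shows "p = q"
proof -
  have "p - q = 0"
  proof (rule evl_eq_0_imp)
    show "p - q \<in> polys n" using polys_add[OF assms(1) polys_minus[OF assms(2)]] by simp
    show "evl xs (p - q) = 0" if "length xs = n" for xs
      using assms(3)[OF that] id_hom.weval_add[of xs p "- q"] by (simp add: id_hom.weval_minus)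
  qed
  then show ?thesis by simp
qed

section \<open>Arbitrary permutations of the arguments\<close>

lemma map_nth_transpose:
  fixes as bs cs :: "'x list"
  defines "a \<equiv> length as" and "b \<equiv> length as + length bs + 1"
  shows "map (\<lambda>i. (as @ x # bs @ y # cs) ! Transposition.transpose a b i) [0..<length (as @ x # bs @ y # cs)] = as @ y # bs @ x # cs"
proof -
  let ?xs = "as @ x # bs @ y # cs"
  have ab: "a < length ?xs" "b < length ?xs" by (simp_all add: a_def b_def)
  have "?xs ! b = y" by (simp add: b_def nth_append)
  moreover have "?xs ! a = x" by (simp add: a_def)
  moreover have "map (\<lambda>i. zs ! Transposition.transpose a b i) [0..<length zs] = zs[a := zs ! b, b := zs ! a]"
    if "a < length zs" "b < length zs" for zs :: "'x list"
    using that by (intro nth_equalityI) (simp_all add: nth_list_update Transposition.transpose_def)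
  from this[OF ab]
  have "map (\<lambda>i. ?xs ! Transposition.transpose a b i) [0..<length ?xs] = ?xs[a := ?xs ! b, b := ?xs ! a]" .
  moreover have "?xs[a := y, b := x] = as @ y # bs @ x # cs"
    by (simp add: a_def b_def list_update_append)
  ultimately show ?thesis by simp
qed

text \<open>\<open>skew\<close> speaks of neighbours only. So \<open>y\<close> is moved forward over
  \<open>bs\<close>, swapped with \<open>x\<close>, and \<open>x\<close> is moved back over
  \<open>bs\<close>; the two signs \<open>(- 1) ^ length bs\<close> cancel.\<close>

lemma skew_transpose:
  assumes "skew f"
  shows "f (as @ x # bs @ y # cs) = - f (as @ y # bs @ x # cs)"
proof -
  have g: "skew (\<lambda>zs. f (as @ zs))" for as
  proof (rule skewI)
    fix bs x y cs
    show "f (as @ bs @ x # y # cs) = - f (as @ bs @ y # x # cs)"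
      using skewD[OF assms, of "as @ bs" x y cs] by simp
  qed
  have "f (as @ x # bs @ y # cs) = (- 1) ^ length bs * f (as @ x # y # bs @ cs)"
    using skew_move_front[OF g[of "as @ [x]"], of bs y cs] by simp
  also have "f (as @ x # y # bs @ cs) = - f (as @ y # x # bs @ cs)"
    by (rule skewD[OF assms])
  also have "(- 1) ^ length bs * - f (as @ y # x # bs @ cs) = - ((- 1) ^ length bs * f (as @ y # x # bs @ cs))"
    by simp
  also have "(- 1) ^ length bs * f (as @ y # x # bs @ cs) = f (as @ y # bs @ x # cs)"
    using skew_move_front[OF g[of "as @ [y]"], of bs x cs] by simp
  finally show ?thesis .
qed

lemma skew_permute:
  assumes f: "skew f" and \<pi>: "\<pi> permutes {..<n}" and xs: "length xs = n"
  shows "f (map (\<lambda>i. xs ! \<pi> i) [0..<n]) = of_int (sign \<pi>) * f xs"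
proof -
  have tr: "f (map (\<lambda>i. xs ! Transposition.transpose a b i) [0..<n]) = - f xs" if "a < b" "b < n" "length xs = n" for a b xs
  proof -
    define as bs cs where "as = take a xs" and "bs = take (b - Suc a) (drop (Suc a) xs)" and "cs = drop (Suc b) xs"
    have 1: "xs = as @ xs ! a # drop (Suc a) xs"
      using that unfolding as_def by (intro id_take_nth_drop) simp
    have "drop (Suc a) xs = bs @ drop (Suc a) xs ! (b - Suc a) # drop (Suc (b - Suc a)) (drop (Suc a) xs)"
      using that unfolding bs_def by (intro id_take_nth_drop) simp
    then have "drop (Suc a) xs = bs @ xs ! b # cs"
      using that by (simp add: cs_def)
    then have 2: "xs = as @ xs ! a # bs @ xs ! b # cs" using 1 by simp
    have l: "a = length as" "b = length as + length bs + 1" using that by (auto simp: as_def bs_def)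
    define x y where "x = xs ! a" and "y = xs ! b"
    have 3: "xs = as @ x # bs @ y # cs" using 2 by (simp only: x_def y_def)
    have "map (\<lambda>i. xs ! Transposition.transpose a b i) [0..<n] = as @ y # bs @ x # cs"
      unfolding l that(3)[symmetric] 3 by (rule map_nth_transpose)
    then show ?thesis
      using skew_transpose[OF f, of as x bs y cs] 3 by simp
  qed
  \<comment> \<open>All lists are quantified over because the induction step applies the hypothesis
    to a list in which two entries have been swapped.\<close>
  have "\<forall>xs. length xs = n \<longrightarrow> f (map (\<lambda>i. xs ! \<pi> i) [0..<n]) = of_int (sign \<pi>) * f xs"
    using \<pi> finite_lessThan[of n]
  proof (induction rule: permutes_induct)
    case id
    show ?case by (auto simp: sign_id intro!: arg_cong[where f=f] nth_equalityI)
  next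
    case (swap a b p)
    show ?case
    proof (intro allI impI)
      fix xs :: "complex list" assume xs: "length xs = n"
      let ?ys = "map (\<lambda>i. xs ! Transposition.transpose a b i) [0..<n]"
      have 1: "map (\<lambda>i. xs ! (Transposition.transpose a b \<circ> p) i) [0..<n] = map (\<lambda>i. ?ys ! p i) [0..<n]"
        using permutes_in_image[OF swap.hyps(4)] by (intro map_cong) auto
      have 2: "f ?ys = - f xs"
      proof (cases "a < b")
        case True
        then show ?thesis using tr[of a b xs] swap.hyps xs by simp
      next
        case False
        then show ?thesis using tr[of b a xs] swap.hyps xs by (simp add: transpose_commute)
      qed
      have 3: "sign (Transposition.transpose a b \<circ> p) = - sign p"
      proof -
        have "permutation p" using swap.hyps permutes_imp_permutation by blast
        then show ?thesis
          using swap.hyps by (simp add: sign_compose permutation_swap_id sign_swap_id)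
      qed
      have "f (map (\<lambda>i. ?ys ! p i) [0..<n]) = of_int (sign p) * f ?ys"
        using swap.IH by (elim allE impE) simp_all
      then show "f (map (\<lambda>i. xs ! (Transposition.transpose a b \<circ> p) i) [0..<n]) =
          of_int (sign (Transposition.transpose a b \<circ> p)) * f xs"
        unfolding 1 2 3 by simp
    qed
  qed
  then show ?thesis using xs by blast
qed

section \<open>Cochains as skew-symmetric polynomials\<close>

text \<open>Functions instead of polynomials, so that the identities for \<open>cdiff\<close> apply
  directly. The value 0 on other lengths makes equality of functions correspond to equality of
  cochains.\<close>

definition skew_polys :: "nat \<Rightarrow> (complex list \<Rightarrow> complex) set" where
  "skew_polys n = {f. skew f \<and> (\<exists>p\<in>polys n. \<forall>xs. f xs = (if length xs = n then evl xs p else 0))}"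

text \<open>Sesquilinearity turns an argument p(\<partial>) L in slot l into the factor p(-x) at the
  value x of the variable of that slot. Hence a cochain is its value \<open>f\<close> on (L, ..., L)
  times these factors.\<close>

definition represents :: "nat \<Rightarrow> (complex list \<Rightarrow> complex) \<Rightarrow> (complex poly list \<Rightarrow> complex vpoly) \<Rightarrow> bool" where
  "represents n f \<gamma> \<longleftrightarrow> (\<forall>as. length as \<noteq> n \<longrightarrow> \<gamma> as = 0) \<and>
     (\<forall>as. length as = n \<longrightarrow> \<gamma> as \<in> polys n \<and>
        (\<forall>xs. length xs = n \<longrightarrow> evl xs (\<gamma> as) = (\<Prod>l<n. poly (as ! l) (- (xs ! l))) * f xs))"

lemma represents_evl:
  "represents n f \<gamma> \<Longrightarrow> length as = n \<Longrightarrow> length xs = n \<Longrightarrow>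
    evl xs (\<gamma> as) = (\<Prod>l<n. poly (as ! l) (- (xs ! l))) * f xs"
  unfolding represents_def by blast

lemma represents_polys: "represents n f \<gamma> \<Longrightarrow> length as = n \<Longrightarrow> \<gamma> as \<in> polys n"
  unfolding represents_def by blast

lemma represents_length: "represents n f \<gamma> \<Longrightarrow> length as \<noteq> n \<Longrightarrow> \<gamma> as = 0"
  unfolding represents_def by blast

lemma represents_unique:
  assumes "represents n f \<gamma>" "represents n f \<delta>"
  shows "\<gamma> = \<delta>"
proof
  fix as
  show "\<gamma> as = \<delta> as"
  proof (cases "length as = n")
    case True
    show ?thesis
    proof (rule evl_inj)
      show "evl xs (\<gamma> as) = evl xs (\<delta> as)" if "length xs = n" for xs
        using represents_evl[OF assms(1) True that] represents_evl[OF assms(2) True that] by simp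
    qed (use True assms in \<open>auto intro: represents_polys\<close>)
  next
    case False
    then show ?thesis using assms by (simp add: represents_length)
  qed
qed

lemma skew_polys_length: "f \<in> skew_polys n \<Longrightarrow> length xs \<noteq> n \<Longrightarrow> f xs = 0"
  unfolding skew_polys_def by auto

lemma skew_polys_skew: "f \<in> skew_polys n \<Longrightarrow> skew f"
  unfolding skew_polys_def by auto

lemma represents_1: "represents n f \<gamma> \<Longrightarrow> length xs = n \<Longrightarrow> f xs = evl xs (\<gamma> (replicate n 1))"
  using represents_evl[of n f \<gamma> "replicate n 1" xs] by simp

lemma represents_fun_unique:
  assumes "f \<in> skew_polys n" "g \<in> skew_polys n" "represents n f \<gamma>" "represents n g \<gamma>"
  shows "f = g"
proof
  fix xs
  show "f xs = g xs"
    using assms by (cases "length xs = n") (auto simp: represents_1 skew_polys_length)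
qed

lemma skew_polysI:
  assumes "skew f" "represents n f \<gamma>" "\<And>xs. length xs \<noteq> n \<Longrightarrow> f xs = 0"
  shows "f \<in> skew_polys n"
  unfolding skew_polys_def
  using assms represents_polys[OF assms(2), of "replicate n 1"] represents_1[OF assms(2)] by auto

lemma represents_exists:
  assumes "f \<in> skew_polys n"
  shows "\<exists>\<gamma>. represents n f \<gamma>"
proof -
  obtain p where p: "p \<in> polys n" "\<And>xs. f xs = (if length xs = n then evl xs p else 0)"
    using assms unfolding skew_polys_def by auto
  \<comment> \<open>The polynomial obtained from \<open>a\<close> by substituting
    \<open>- X l\<close> for \<partial>: the factor contributed by the argument \<open>a\<close> in
    slot \<open>l\<close>.\<close>
  define u where "u a l = poly (map_poly cst a) (- X l :: complex vpoly)" for a l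
  have u: "u a l \<in> polys n" "length xs = n \<Longrightarrow> evl xs (u a l) = poly a (- (xs ! l))" if "l < n" for a l xs
  proof -
    have 0: "u 0 l = 0" by (simp add: u_def)
    have 1: "u (pCons c a) l = cst c - X l * u a l" for c a
      by (cases "c = 0 \<and> a = 0") (auto simp: u_def map_poly_pCons cst_0)
    show "u a l \<in> polys n"
    proof (induction a)
      case (pCons c a)
      have "cst c + - X l * u a l \<in> polys n"
        using that pCons by (intro polys_add polys_mult polys_cst polys_minus polys_X)
      then show ?case by (simp add: 1)
    qed (simp add: 0 polys_0)
    show "evl xs (u a l) = poly a (- (xs ! l))" if "length xs = n"
    proof (induction a)
      case (pCons c a)
      have "evl xs (cst c + - X l * u a l) = c + - (xs ! l) * evl xs (u a l)"
        using that \<open>l < n\<close> by (simp only: id_hom.weval_simps id_hom.weval_X)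
      then show ?case using pCons by (simp add: 1)
    qed (simp add: 0 id_hom.weval_0)
  qed
  define \<gamma> where "\<gamma> as = (if length as = n then (\<Prod>l<n. u (as ! l) l) * p else 0)" for as
  have "represents n f \<gamma>"
    unfolding represents_def
  proof (intro conjI allI impI)
    show "\<gamma> as = 0" if "length as \<noteq> n" for as using that by (simp add: \<gamma>_def)
    show "\<gamma> as \<in> polys n" if "length as = n" for as
      using that u(1) p(1) by (auto simp: \<gamma>_def intro!: polys_mult polys_prod)
    show "evl xs (\<gamma> as) = (\<Prod>l<n. poly (as ! l) (- (xs ! l))) * f xs"
      if "length as = n" "length xs = n" for as xs
      using that u(2) p(2) by (simp add: \<gamma>_def id_hom.weval_mult id_hom.weval_prod)
  qed
  then show ?thesis by blast
qed

lemma prod_list_update: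
  fixes g :: "'x \<Rightarrow> nat \<Rightarrow> 'y::comm_monoid_mult"
  assumes "length as = n" "i < n"
  shows "(\<Prod>l<n. g (as[i := a] ! l) l) = g a i * (\<Prod>l\<in>{..<n} - {i}. g (as ! l) l)"
proof -
  have "(\<Prod>l<n. g (as[i := a] ! l) l) = g a i * (\<Prod>l\<in>{..<n} - {i}. g (as[i := a] ! l) l)"
    using assms by (subst prod.remove[of _ i]) auto
  then show ?thesis by simp
qed

text \<open>By \<open>evl_inj\<close> every condition on cochains can be checked on values.
  Additivity, scaling and \<partial> concern a single factor of the product; under a permutation the
  product is only reindexed and \<open>f\<close> gains the sign.\<close>

lemma represents_cochain:
  assumes f: "skew f" and r: "represents n f \<gamma>"
  shows "\<gamma> \<in> Vir_triv.basic_cochains n"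
proof -
  have pl: "(\<Prod>l<n. poly (as[i := a] ! l) (- (xs ! l))) = poly a (- (xs ! i)) * (\<Prod>l\<in>{..<n} - {i}. poly (as ! l) (- (xs ! l)))"
    if "length as = n" "i < n" for as :: "complex poly list" and xs i a
    using prod_list_update[OF that, of "\<lambda>a l. poly a (- (xs ! l))"] .
  have pl': "(\<Prod>l<n. poly (as ! l) (- (xs ! l))) = poly (as ! i) (- (xs ! i)) * (\<Prod>l\<in>{..<n} - {i}. poly (as ! l) (- (xs ! l)))"
    if "length as = n" "i < n" for as :: "complex poly list" and xs i
    using pl[OF that, of "as ! i"] by simp
  note P = represents_polys[OF r] and E = represents_evl[OF r]
  show ?thesis
    unfolding Vir_triv.basic_cochains_def mem_Collect_eq pmul_mult
  proof (intro conjI allI impI)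
    show "\<gamma> as = 0" if "length as \<noteq> n" for as using represents_length[OF r that] .
    show "\<gamma> as \<in> polys n" if "length as = n" for as using P[OF that] .
    fix as :: "complex poly list" and i
    { fix a b assume as: "length as = n \<and> i < n"
      show "\<gamma> (as[i := a + b]) = \<gamma> (as[i := a]) + \<gamma> (as[i := b])"
        by (rule evl_inj[of _ n])
           (use as in \<open>simp_all add: P E polys_add id_hom.weval_add pl distrib_right\<close>) }
    { fix c assume as: "length as = n \<and> i < n"
      show "\<gamma> (as[i := Polynomial.smult c (as ! i)]) = cst c * \<gamma> as"
        by (rule evl_inj[of _ n])
           (use as in \<open>simp_all add: P E polys_mult polys_cst id_hom.weval_mult id_hom.weval_cst pl pl'[of as i]\<close>) }
    { assume as: "length as = n \<and> i < n"
      show "\<gamma> (as[i := pCons 0 (as ! i)]) = - (X i * \<gamma> as)"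
        by (rule evl_inj[of _ n])
           (use as in \<open>simp_all add: P E polys_mult polys_X polys_minus id_hom.weval_mult id_hom.weval_minus id_hom.weval_X pl pl'[of as i]\<close>) }
    fix \<pi> assume as: "length as = n \<and> \<pi> permutes {..<n}"
    have \<pi>: "\<pi> i < n" if "i < n" for i using permutes_in_image[of \<pi> "{..<n}" i] as that by simp
    show "subst (*) (map (\<lambda>i. X (\<pi> i)) [0..<n]) (\<gamma> (map (\<lambda>i. as ! \<pi> i) [0..<n])) = of_int (sign \<pi>) * \<gamma> as"
    proof (rule evl_inj)
      show "subst (*) (map (\<lambda>i. X (\<pi> i)) [0..<n]) (\<gamma> (map (\<lambda>i. as ! \<pi> i) [0..<n])) \<in> polys n"
        using \<pi> by (intro polys_subst) (auto intro!: polys_X)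
      have sgn: "of_int (sign \<pi>) = (cst (of_int (sign \<pi>)) :: complex vpoly)"
        by (cases \<pi> rule: sign_cases) (simp_all add: cst_1, metis add.inverse_unique cst_0 cst_1 cst_add add.right_inverse)
      show "of_int (sign \<pi>) * \<gamma> as \<in> polys n"
        unfolding sgn using P as by (auto intro!: polys_mult polys_cst)
      fix xs :: "complex list" assume xs: "length xs = n"
      have "evl xs (subst (*) (map (\<lambda>i. X (\<pi> i)) [0..<n]) (\<gamma> (map (\<lambda>i. as ! \<pi> i) [0..<n]))) =
          evl (map (\<lambda>i. xs ! \<pi> i) [0..<n]) (\<gamma> (map (\<lambda>i. as ! \<pi> i) [0..<n]))"
        unfolding evl_subst using \<pi> xs by (intro arg_cong2[where f=evl]) (auto simp: id_hom.weval_X)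
      also have "\<dots> = (\<Prod>l<n. poly (as ! \<pi> l) (- (xs ! \<pi> l))) * f (map (\<lambda>i. xs ! \<pi> i) [0..<n])"
        by (subst E) auto
      also have "(\<Prod>l<n. poly (as ! \<pi> l) (- (xs ! \<pi> l))) = (\<Prod>l<n. poly (as ! l) (- (xs ! l)))"
        using as by (intro prod.permute[symmetric, unfolded o_def]) auto
      also have "f (map (\<lambda>i. xs ! \<pi> i) [0..<n]) = of_int (sign \<pi>) * f xs"
        using skew_permute[OF f] as xs by blast
      finally show "evl xs (subst (*) (map (\<lambda>i. X (\<pi> i)) [0..<n]) (\<gamma> (map (\<lambda>i. as ! \<pi> i) [0..<n]))) =
          evl xs (of_int (sign \<pi>) * \<gamma> as)"
        unfolding sgn using E as xs by (simp add: id_hom.weval_mult id_hom.weval_cst)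
    qed
  qed
qed

lemma cochain_represents:
  assumes \<gamma>: "\<gamma> \<in> Vir_triv.basic_cochains n"
  obtains f where "f \<in> skew_polys n" "represents n f \<gamma>"
proof -
  note c = \<gamma>[unfolded Vir_triv.basic_cochains_def mem_Collect_eq pmul_mult]
  have len: "\<gamma> as = 0" if "length as \<noteq> n" for as using c that by blast
  have pol: "\<gamma> as \<in> polys n" if "length as = n" for as using c that by blast
  have add: "\<gamma> (as[i := a + b]) = \<gamma> (as[i := a]) + \<gamma> (as[i := b])" if "length as = n" "i < n" for as i a b
    using c that by blast
  have scale: "\<gamma> (as[i := Polynomial.smult r (as ! i)]) = cst r * \<gamma> as" if "length as = n" "i < n" for as i r
    using c that by blast
  have der: "\<gamma> (as[i := pCons 0 (as ! i)]) = - (X i * \<gamma> as)" if "length as = n" "i < n" for as i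
    using c that by blast
  have perm: "subst (*) (map (\<lambda>i. X (\<pi> i)) [0..<n]) (\<gamma> (map (\<lambda>i. as ! \<pi> i) [0..<n])) = of_int (sign \<pi>) * \<gamma> as"
    if "length as = n" "\<pi> permutes {..<n}" for as \<pi>
    using c that by blast
  \<comment> \<open>Horner's scheme: adding a constant term and multiplying by \<partial> in slot
    \<open>i\<close> act on values as they do on the number
    \<open>poly a (- (xs ! i))\<close>.\<close>
  have upd: "evl xs (\<gamma> (as[i := a])) = poly a (- (xs ! i)) * evl xs (\<gamma> (as[i := 1]))"
    if "length as = n" "i < n" "length xs = n" for as i a xs
  proof (induction a)
    case 0
    have "\<gamma> (as[i := 0]) = 0"
      using add[OF that(1,2), of 0 0] by simp
    then show ?case by (simp add: id_hom.weval_0)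
  next
    case (pCons r a)
    have "pCons r a = Polynomial.smult r 1 + pCons 0 a" by (simp add: one_pCons)
    then have "\<gamma> (as[i := pCons r a]) = \<gamma> (as[i := Polynomial.smult r 1]) + \<gamma> (as[i := pCons 0 a])"
      using add[OF that(1,2)] by metis
    also have "\<gamma> (as[i := Polynomial.smult r 1]) = cst r * \<gamma> (as[i := 1])"
      using scale[of "as[i := 1]" i r] that by simp
    also have "\<gamma> (as[i := pCons 0 a]) = - (X i * \<gamma> (as[i := a]))"
      using der[of "as[i := a]" i] that by simp
    finally have "evl xs (\<gamma> (as[i := pCons r a])) = evl xs (cst r * \<gamma> (as[i := 1]) + - (X i * \<gamma> (as[i := a])))"
      by (rule arg_cong)
    then show ?case
      using that pCons.IH by (simp only: id_hom.weval_simps id_hom.weval_X) (simp add: algebra_simps)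
  qed
  define f where "f xs = (if length xs = n then evl xs (\<gamma> (replicate n 1)) else 0)" for xs
  have val: "evl xs (\<gamma> as) = (\<Prod>l<n. poly (as ! l) (- (xs ! l))) * f xs" if as: "length as = n" and xs: "length xs = n" for as xs
  proof -
    \<comment> \<open>The arguments are replaced by L, which is the polynomial 1, from left to
      right; \<open>m\<close> counts those already replaced, each leaving its factor behind.\<close>
    have "evl xs (\<gamma> as) = (\<Prod>l<m. poly (as ! l) (- (xs ! l))) * evl xs (\<gamma> (replicate m 1 @ drop m as))" if "m \<le> n" for m
      using that
    proof (induction m)
      case (Suc m)
      let ?bs = "replicate m 1 @ drop m as"
      have "?bs[m := as ! m] = ?bs" "?bs[m := 1] = replicate (Suc m) 1 @ drop (Suc m) as" "length ?bs = n"
        using Suc.prems as by (auto simp: list_update_append Cons_nth_drop_Suc[symmetric] replicate_append_same[symmetric] list_eq_iff_nth_eq nth_append)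
      then have "evl xs (\<gamma> ?bs) = poly (as ! m) (- (xs ! m)) * evl xs (\<gamma> (replicate (Suc m) 1 @ drop (Suc m) as))"
        using upd[of ?bs m xs "as ! m"] Suc.prems xs by simp
      then show ?case using Suc by simp
    qed simp
    from this[of n] show ?thesis using as xs by (simp add: f_def)
  qed
  have r: "represents n f \<gamma>"
    unfolding represents_def using len pol val by blast
  have "skew f"
  proof (rule skewI)
    fix as bs :: "complex list" and x y
    let ?xs = "as @ x # y # bs"
    show "f ?xs = - f (as @ y # x # bs)"
    proof (cases "length ?xs = n")
      case True
      \<comment> \<open>The length of an empty middle block is written out so that
        \<open>map_nth_transpose\<close> applies to two neighbours.\<close>
      define \<pi> where "\<pi> = Transposition.transpose (length as) (length as + length ([] :: complex list) + 1)"
      have \<pi>: "\<pi> permutes {..<n}" unfolding \<pi>_def using True by (intro permutes_swap_id) auto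
      have \<pi>': "\<pi> i < n" if "i < n" for i using permutes_in_image[OF \<pi>, of i] that by simp
      have "map (\<lambda>i. ?xs ! \<pi> i) [0..<n] = as @ y # x # bs"
        unfolding \<pi>_def True[symmetric] using map_nth_transpose[of as x "[]" y bs] by simp
      then have "evl (as @ y # x # bs) (\<gamma> (replicate n 1)) = evl (map (\<lambda>i. ?xs ! \<pi> i) [0..<n]) (\<gamma> (replicate n 1))"
        by simp
      also have "\<dots> = evl ?xs (subst (*) (map (\<lambda>i. X (\<pi> i)) [0..<n]) (\<gamma> (replicate n 1)))"
        unfolding evl_subst using \<pi>' True by (intro arg_cong2[where f=evl]) (auto simp: id_hom.weval_X)
      also have "map (\<lambda>i. replicate n 1 ! \<pi> i) [0..<n] = replicate n (1 :: complex poly)"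
        using \<pi>' by (auto intro!: nth_equalityI)
      then have "subst (*) (map (\<lambda>i. X (\<pi> i)) [0..<n]) (\<gamma> (replicate n 1)) = of_int (sign \<pi>) * \<gamma> (replicate n 1)"
        using perm[of "replicate n 1", OF _ \<pi>] by simp
      also have "sign \<pi> = - 1" by (simp add: \<pi>_def sign_swap_id)
      finally show ?thesis using True by (simp add: f_def id_hom.weval_minus)
    qed (simp add: f_def)
  qed
  then have "f \<in> skew_polys n"
    using r by (rule skew_polysI) (simp add: f_def)
  then show ?thesis using r that by blast
qed

section \<open>Lists with deleted entries and the differential\<close>

lemma length_omit: "i < length xs \<Longrightarrow> length (omit i xs) = length xs - 1"
  by (simp add: omit_def)

lemma map_omit: "map g (omit i xs) = omit i (map g xs)"
  by (simp add: omit_def take_map drop_map)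

lemma nth_omit_less: "i < j \<Longrightarrow> j < length xs \<Longrightarrow> omit j xs ! i = xs ! i"
  by (simp add: omit_def nth_append)

lemma map2_omit: "length xs = length ys \<Longrightarrow> map2 g (omit i xs) (omit i ys) = omit i (map2 g xs ys)"
  by (simp add: omit_def zip_append take_map drop_map take_zip drop_zip)

lemma prod_list_omit: "i < length ws \<Longrightarrow> prod_list ws = ws ! i * prod_list (omit i ws)"
  for ws :: "'x::comm_monoid_mult list"
  unfolding omit_def by (subst id_take_nth_drop[of i ws]) (simp_all add: mult_ac)

lemma set_omit: "set (omit i xs) \<subseteq> set xs"
  unfolding omit_def by (auto dest: in_set_takeD in_set_dropD)

lemma prod_nth_eq_prod_list:
  "length as = n \<Longrightarrow> length xs = n \<Longrightarrow> (\<Prod>l<n. g (as ! l) (xs ! l)) = prod_list (map2 g as xs)"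
proof (induction as arbitrary: n xs)
  case (Cons a as)
  then obtain x ys where "xs = x # ys" by (cases xs) auto
  then show ?case using Cons by (auto simp: prod.lessThan_Suc_shift simp del: prod.lessThan_Suc)
qed simp

text \<open>Entry \<open>j\<close> is deleted first, as in \<open>basic_diff\<close>; since
  \<open>i < j\<close>, the index \<open>i\<close> then still points to the same entry.\<close>

lemma prod_list_omit2:
  fixes g :: "'x \<Rightarrow> 'y \<Rightarrow> 'z::comm_monoid_mult"
  assumes "length as = length xs" "i < j" "j < length xs"
  shows "prod_list (map2 g as xs) =
    g (as ! i) (xs ! i) * g (as ! j) (xs ! j) * prod_list (map2 g (omit i (omit j as)) (omit i (omit j xs)))"
proof -
  have "prod_list (map2 g as xs) = g (as ! j) (xs ! j) * prod_list (omit j (map2 g as xs))"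
    using assms by (subst prod_list_omit[of j]) auto
  also have "omit j (map2 g as xs) = map2 g (omit j as) (omit j xs)"
    using assms by (simp add: map2_omit)
  also have "prod_list \<dots> = g (as ! i) (xs ! i) * prod_list (omit i (map2 g (omit j as) (omit j xs)))"
    using assms by (subst prod_list_omit[of i]) (auto simp: length_omit nth_omit_less)
  also have "omit i (map2 g (omit j as) (omit j xs)) = map2 g (omit i (omit j as)) (omit i (omit j xs))"
    using assms by (simp add: map2_omit length_omit)
  finally show ?thesis by (simp add: mult_ac)
qed

text \<open>The action is zero, so only the sum over pairs survives. Each of its terms splits into
  the factors prescribed by \<open>represents\<close> and the corresponding term of
  \<open>cdiff_eq_sum\<close>.\<close>

lemma represents_diff:
  assumes f: "f \<in> skew_polys n" and r: "represents n f \<gamma>"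
  shows "represents (Suc n) (cdiff f) (Vir_triv.basic_diff n \<gamma>)"
proof -
  define F where "F as i j = extend (*)
      (\<lambda>b. subst (*) ((X i + X j) # omit i (omit j (map X [0..<Suc n]))) (\<gamma> (b # omit i (omit j as))))
      (subst Polynomial.smult [X i] (vir_bracket (as ! i) (as ! j)))" for as i j
  have act0: "extend (*) (\<lambda>v. subst (*) [X i] (0 :: complex vpoly)) Q = 0" for i and Q :: "complex vpoly"
    by (simp add: extend_def subst_def pmul_def)
  have diff: "Vir_triv.basic_diff n \<gamma> as = (\<Sum>j<Suc n. \<Sum>i<j. cst ((- 1) ^ (i + j)) * F as i j)"
    if "length as = Suc n" for as
  proof -
    have "(- 1) ^ m = (cst ((- 1) ^ m) :: complex vpoly)" for m
    proof (induction m)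
      case (Suc m)
      have "cst (- 1) = (- 1 :: complex vpoly)"
        by (metis add.inverse_unique cst_0 cst_1 cst_add add.right_inverse)
      then show ?case using Suc by (simp only: power_Suc cst_mult)
    qed (simp add: cst_1)
    then show ?thesis
      using that unfolding Vir_triv.basic_diff_def F_def pmul_mult act0 by simp
  qed
  have sub: "x \<in> polys (Suc n)" if "i < j" "j < Suc n" "x \<in> set ((X i + X j) # omit i (omit j (map X [0..<Suc n])))"
    for i j and x :: "complex vpoly"
  proof -
    have "x = X i + X j \<or> x \<in> set (map X [0..<Suc n])"
      using that(3) set_omit[of i "omit j (map X [0..<Suc n])"] set_omit[of j "map X [0..<Suc n]"] by auto
    then show ?thesis using that(1,2) by (auto intro!: polys_add polys_X)
  qed
  have Fp: "F as i j \<in> polys (Suc n)" if "i < j" "j < Suc n" for as i j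
    unfolding F_def using that by (intro polys_extend polys_subst polys_subst_bracket sub[of i j]) auto
  have FE: "evl xs (F as i j) = (\<Prod>l<Suc n. poly (as ! l) (- (xs ! l))) *
      ((xs ! i - xs ! j) * f ((xs ! i + xs ! j) # omit i (omit j xs)))"
    if "i < j" "j < Suc n" "length as = Suc n" "length xs = Suc n" for as xs i j
  proof -
    define as' xs' where "as' = omit i (omit j as)" and "xs' = omit i (omit j xs)"
    let ?W = "\<lambda>as xs. prod_list (map2 (\<lambda>a x. poly a (- x)) as xs)"
    have l: "length (b # as') = n" "length (x # xs') = n" for b x
      using that by (auto simp: as'_def xs'_def length_omit)
    have "map (evl xs) (map X [0..<Suc n]) = xs"
      using that(4) by (intro nth_equalityI) (simp_all add: id_hom.weval_X del: upt_Suc)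
    then have m: "map (evl xs) ((X i + X j) # omit i (omit j (map X [0..<Suc n]))) = (xs ! i + xs ! j) # xs'"
      using that by (simp add: xs'_def map_omit id_hom.weval_add id_hom.weval_X del: upt_Suc map_map)
    have v: "evl xs (subst (*) ((X i + X j) # omit i (omit j (map X [0..<Suc n]))) (\<gamma> (b # as'))) =
        poly b (- (xs ! i + xs ! j)) * (?W as' xs' * f ((xs ! i + xs ! j) # xs'))" for b
    proof -
      have "(\<Prod>l<n. poly ((b # as') ! l) (- (((xs ! i + xs ! j) # xs') ! l))) = ?W (b # as') ((xs ! i + xs ! j) # xs')"
        using l by (intro prod_nth_eq_prod_list)
      then show ?thesis
        unfolding evl_subst m represents_evl[OF r l] by simp
    qed
    have "evl xs (F as i j) = pevl (- (xs ! i + xs ! j)) xs (subst Polynomial.smult [X i] (vir_bracket (as ! i) (as ! j)))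
        * (?W as' xs' * f ((xs ! i + xs ! j) # xs'))"
      unfolding F_def as'_def[symmetric] by (rule evl_extend) (rule v)
    \<comment> \<open>At \<partial> = \<open>- (xs ! i + xs ! j)\<close> the factor for
      \<open>as ! j\<close>, taken at \<partial> + \<open>xs ! i\<close>, is evaluated at
      \<open>- (xs ! j)\<close>, and \<partial> + 2 \<open>xs ! i\<close> becomes
      \<open>xs ! i - xs ! j\<close>.\<close>
    also have "\<dots> = (poly (as ! i) (- (xs ! i)) * poly (as ! j) (- (xs ! j)) * ?W as' xs') *
        ((xs ! i - xs ! j) * f ((xs ! i + xs ! j) # xs'))"
      using that by (subst pevl_subst_bracket) (auto simp: algebra_simps)
    also have "poly (as ! i) (- (xs ! i)) * poly (as ! j) (- (xs ! j)) * ?W as' xs' = ?W as xs"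
      unfolding as'_def xs'_def using that by (intro prod_list_omit2[symmetric]) auto
    also have "\<dots> = (\<Prod>l<Suc n. poly (as ! l) (- (xs ! l)))"
      using that by (intro prod_nth_eq_prod_list[symmetric])
    finally show ?thesis unfolding xs'_def .
  qed
  show ?thesis
    unfolding represents_def
  proof (intro conjI allI impI)
    show "Vir_triv.basic_diff n \<gamma> as = 0" if "length as \<noteq> Suc n" for as
      using that by (simp add: Vir_triv.basic_diff_def)
    show "Vir_triv.basic_diff n \<gamma> as \<in> polys (Suc n)" if "length as = Suc n" for as
      unfolding diff[OF that] by (intro polys_sum polys_mult polys_cst Fp) auto
    show "evl xs (Vir_triv.basic_diff n \<gamma> as) = (\<Prod>l<Suc n. poly (as ! l) (- (xs ! l))) * cdiff f xs"
      if "length as = Suc n" "length xs = Suc n" for as xs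
    proof -
      have "evl xs (Vir_triv.basic_diff n \<gamma> as) = (\<Sum>j<Suc n. \<Sum>i<j. (- 1) ^ (i + j) * evl xs (F as i j))"
        unfolding diff[OF that(1)] by (simp only: id_hom.weval_sum id_hom.weval_mult id_hom.weval_cst)
      also have "\<dots> = (\<Sum>j<Suc n. \<Sum>i<j. (\<Prod>l<Suc n. poly (as ! l) (- (xs ! l))) *
          ((- 1) ^ (i + j) * (xs ! i - xs ! j) * f ((xs ! i + xs ! j) # omit i (omit j xs))))"
        using that by (intro sum.cong refl) (simp add: FE del: prod.lessThan_Suc)
      also have "\<dots> = (\<Prod>l<Suc n. poly (as ! l) (- (xs ! l))) * cdiff f xs"
        unfolding cdiff_eq_sum[OF skew_polys_skew[OF f]] that(2) sum_distrib_left ..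
      finally show ?thesis .
    qed
  qed
qed

lemma cdiff_skew_polys:
  assumes "f \<in> skew_polys n"
  shows "cdiff f \<in> skew_polys (Suc n)"
proof -
  obtain \<gamma> where "represents n f \<gamma>" using represents_exists[OF assms] by blast
  then have "represents (Suc n) (cdiff f) (Vir_triv.basic_diff n \<gamma>)" by (rule represents_diff[OF assms])
  then show ?thesis
    by (rule skew_polysI[OF skew_cdiff[OF skew_polys_skew[OF assms]]])
       (rule cdiff_length[of n], simp_all add: skew_polys_length[OF assms])
qed

section \<open>The action of \<partial> and linear combinations on functions\<close>

lemma represents_der:
  assumes "represents n f \<gamma>"
  shows "represents n (\<lambda>xs. sum_list xs * f xs) (Vir_triv.basic_der n \<gamma>)"
  unfolding represents_def Vir_triv.basic_der_def pmul_mult map_zero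
proof (intro conjI allI impI)
  fix as :: "complex poly list"
  show "0 + (\<Sum>i<n. X i) * \<gamma> as = 0" if "length as \<noteq> n" using represents_length[OF assms that] by simp
  assume as: "length as = n"
  show "0 + (\<Sum>i<n. X i) * \<gamma> as \<in> polys n"
    using represents_polys[OF assms as] by (auto intro!: polys_mult polys_sum polys_X)
  fix xs :: "complex list" assume xs: "length xs = n"
  have "evl xs (\<Sum>i<n. X i) = sum_list xs"
    using xs by (simp add: id_hom.weval_sum id_hom.weval_X sum_list_sum_nth atLeast0LessThan)
  then show "evl xs (0 + (\<Sum>i<n. X i) * \<gamma> as) = (\<Prod>l<n. poly (as ! l) (- (xs ! l))) * (sum_list xs * f xs)"
    using represents_evl[OF assms as xs] by (simp add: id_hom.weval_mult)
qed

lemma sum_list_mult_skew_polys: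
  assumes "f \<in> skew_polys n"
  shows "(\<lambda>xs. sum_list xs * f xs) \<in> skew_polys n"
proof -
  obtain \<gamma> where "represents n f \<gamma>" using represents_exists[OF assms] by blast
  moreover have "skew (\<lambda>xs. sum_list xs * f xs)"
  proof (rule skewI)
    fix as x y bs
    show "sum_list (as @ x # y # bs) * f (as @ x # y # bs) = - (sum_list (as @ y # x # bs) * f (as @ y # x # bs))"
      using skewD[OF skew_polys_skew[OF assms], of as x y bs] by (simp add: add.left_commute)
  qed
  ultimately show ?thesis
    by (intro skew_polysI[OF _ represents_der]) (auto simp: skew_polys_length[OF assms])
qed

lemma represents_lin:
  assumes "represents n f \<gamma>" "represents n g \<delta>"
  shows "represents n (\<lambda>xs. a * f xs + b * g xs) (\<lambda>as. cst a * \<gamma> as + cst b * \<delta> as)"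
  unfolding represents_def
proof (intro conjI allI impI)
  fix as :: "complex poly list"
  show "cst a * \<gamma> as + cst b * \<delta> as = 0" if "length as \<noteq> n"
    using represents_length[OF assms(1) that] represents_length[OF assms(2) that] by simp
  assume as: "length as = n"
  show "cst a * \<gamma> as + cst b * \<delta> as \<in> polys n"
    using represents_polys[OF assms(1) as] represents_polys[OF assms(2) as] by (intro polys_add polys_mult polys_cst)
  fix xs :: "complex list" assume xs: "length xs = n"
  show "evl xs (cst a * \<gamma> as + cst b * \<delta> as) = (\<Prod>l<n. poly (as ! l) (- (xs ! l))) * (a * f xs + b * g xs)"
    using represents_evl[OF assms(1) as xs] represents_evl[OF assms(2) as xs]
    by (simp add: id_hom.weval_simps algebra_simps)
qed

lemma lin_skew_polys:
  assumes "f \<in> skew_polys n" "g \<in> skew_polys n"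
  shows "(\<lambda>xs. a * f xs + b * g xs) \<in> skew_polys n"
proof -
  obtain \<gamma> \<delta> where "represents n f \<gamma>" "represents n g \<delta>"
    using represents_exists assms by metis
  then show ?thesis
    using assms by (intro skew_polysI[OF _ represents_lin] skew_lin) (auto simp: skew_polys_length skew_polys_skew)
qed

lemma scale_skew_polys: "f \<in> skew_polys n \<Longrightarrow> (\<lambda>xs. a * f xs) \<in> skew_polys n"
  using lin_skew_polys[of f n f a 0] by simp

lemma diff_skew_polys: "f \<in> skew_polys n \<Longrightarrow> g \<in> skew_polys n \<Longrightarrow> (\<lambda>xs. f xs - g xs) \<in> skew_polys n"
  using lin_skew_polys[of f n g 1 "- 1"] by simp

section \<open>The homotopy\<close>

lemma lie_der_cong:
  "(\<And>ys. length ys = length xs \<Longrightarrow> f ys = g ys) \<Longrightarrow> lie_der m f xs = lie_der m g xs"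
proof (induction xs arbitrary: f g)
  case (Cons y xs)
  show ?case
    using Cons.IH[of "\<lambda>ys. f (y # ys)" "\<lambda>ys. g (y # ys)"] Cons.prems by simp
qed simp

lemma lie_der_sum: "lie_der m (\<lambda>ys. \<Sum>i\<in>I. F i ys) xs = (\<Sum>i\<in>I. lie_der m (F i) xs)"
proof (induction I rule: infinite_finite_induct)
  case empty
  show ?case using lie_der_scale[of m 0 "\<lambda>_. 0" xs] by simp
next
  case (infinite I)
  then show ?case using lie_der_scale[of m 0 "\<lambda>_. 0" xs] by simp
qed (simp add: lie_der_add)

lemma cdiff_sum: "cdiff (\<lambda>ys. \<Sum>i\<in>I. F i ys) xs = (\<Sum>i\<in>I. cdiff (F i) xs)"
  by (induction I rule: infinite_finite_induct) (simp_all add: cdiff_zero cdiff_add)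

lemma lie_der_has_derivative:
  assumes "\<And>ys. ((\<lambda>t. F t ys) has_field_derivative G ys) (at a)"
  shows "((\<lambda>t. lie_der m (F t) xs) has_field_derivative lie_der m G xs) (at a)"
  using assms
proof (induction xs arbitrary: F G)
  case (Cons y xs)
  show ?case
    using Cons.IH[of "\<lambda>t ys. F t (y # ys)" "\<lambda>ys. G (y # ys)"] Cons.prems
    by (auto intro!: DERIV_add DERIV_cmult)
qed simp

lemma cdiff_has_derivative:
  assumes "\<And>ys. ((\<lambda>t. F t ys) has_field_derivative G ys) (at a)"
  shows "((\<lambda>t. cdiff (F t) xs) has_field_derivative cdiff G xs) (at a)"
  using assms
proof (induction xs arbitrary: F G)
  case (Cons y xs)
  show ?case
    using Cons.IH[of "\<lambda>t ys. F t (y # ys)" "\<lambda>ys. G (y # ys)"] Cons.prems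
    by (auto intro!: DERIV_diff DERIV_minus lie_der_has_derivative)
qed simp

text \<open>A polynomial with infinitely many roots is zero. With \<open>t\<close> as a dilation
  this isolates single degrees; \<open>t = 0\<close> is left out because a factor \<open>t\<close>
  from \<open>cdiff_dilate\<close> is cancelled first.\<close>

lemma coeff_eq_0_of_sum_powers:
  fixes c :: "nat \<Rightarrow> complex"
  assumes "\<And>t. t \<noteq> 0 \<Longrightarrow> (\<Sum>m\<le>M. t ^ m * c m) = 0" "m \<le> M"
  shows "c m = 0"
proof -
  define p where "p = (\<Sum>m\<le>M. Polynomial.monom (c m) m)"
  have "poly p t = 0" if "t \<noteq> 0" for t
    using assms(1)[OF that] by (simp add: p_def poly_sum poly_monom mult.commute)
  then have "UNIV - {0} \<subseteq> {t. poly p t = 0}" by blast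
  moreover have "infinite (UNIV - {0 :: complex})" by (simp add: infinite_UNIV_char_0)
  ultimately have "p = 0" using poly_roots_finite finite_subset by blast
  moreover have "coeff p m = c m" using assms(2) by (simp add: p_def coeff_sum)
  ultimately show ?thesis by simp
qed

section \<open>Homogeneous components\<close>

definition mdeg :: "nat \<Rightarrow> (nat \<Rightarrow>\<^sub>0 nat) \<Rightarrow> nat" where
  "mdeg n k = (\<Sum>i<n. Poly_Mapping.lookup k i)"

definition hskew :: "nat \<Rightarrow> nat \<Rightarrow> (complex list \<Rightarrow> complex) set" where
  "hskew n m = {f. skew f \<and> (\<exists>p\<in>polys n. (\<forall>k\<in>Poly_Mapping.keys p. mdeg n k = m) \<and>
      (\<forall>xs. f xs = (if length xs = n then evl xs p else 0)))}"

lemma hskewE: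
  assumes "f \<in> hskew n m"
  obtains p where "skew f" "p \<in> polys n" "\<And>k. k \<in> Poly_Mapping.keys p \<Longrightarrow> mdeg n k = m"
    "\<And>xs. length xs = n \<Longrightarrow> f xs = evl xs p" "\<And>xs. length xs \<noteq> n \<Longrightarrow> f xs = 0"
  using assms unfolding hskew_def by auto

lemma hskewI:
  assumes "skew f" "p \<in> polys n" "\<And>k. k \<in> Poly_Mapping.keys p \<Longrightarrow> mdeg n k = m"
    "\<And>xs. f xs = (if length xs = n then evl xs p else 0)"
  shows "f \<in> hskew n m"
  using assms unfolding hskew_def by auto

lemma hskew_skew_polys: "f \<in> hskew n m \<Longrightarrow> f \<in> skew_polys n"
  unfolding hskew_def skew_polys_def by auto

lemma mon_dilate: "mon (map ((*) t) xs) k = t ^ mdeg (length xs) k * mon xs k"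
  by (simp add: mon_def mdeg_def power_mult_distrib prod.distrib power_sum)

lemma hskew_dilate:
  assumes "f \<in> hskew n m"
  shows "f (map ((*) t) xs) = t ^ m * f xs"
proof -
  obtain p where p: "\<And>k. k \<in> Poly_Mapping.keys p \<Longrightarrow> mdeg n k = m"
    "\<And>xs. length xs = n \<Longrightarrow> f xs = evl xs p" "\<And>xs. length xs \<noteq> n \<Longrightarrow> f xs = 0"
    using assms by (rule hskewE) blast
  show ?thesis
  proof (cases "length xs = n")
    case True
    then show ?thesis
      using p by (simp add: weval_def mon_dilate sum_distrib_left mult.assoc)
  qed (simp add: p)
qed

lemma keys_sum_single_subset:
  "Poly_Mapping.keys (\<Sum>k\<in>K. Poly_Mapping.single (g k) (c k)) \<subseteq> g ` K"
proof (induction K rule: infinite_finite_induct)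
  case (insert k K)
  have "Poly_Mapping.keys (Poly_Mapping.single (g k) (c k)) \<subseteq> {g k}" by simp
  then show ?case
    using insert Poly_Mapping.keys_add[of "Poly_Mapping.single (g k) (c k)" "\<Sum>k\<in>K. Poly_Mapping.single (g k) (c k)"]
    by auto
qed simp_all

lemma evl_sum_single: "evl xs (\<Sum>k\<in>K. Poly_Mapping.single (g k) (c k)) = (\<Sum>k\<in>K. mon xs (g k) * c k)"
  by (simp add: id_hom.weval_sum id_hom.weval_single)

text \<open>The monomials are sorted by degree. Skew-symmetry passes to the components since
  dilation by \<open>t\<close> multiplies the one of degree \<open>m\<close> by
  \<open>t ^ m\<close>, so an identity for \<open>f\<close> at all dilations holds degree by
  degree.\<close>

lemma skew_polys_decompose:
  assumes "f \<in> skew_polys n"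
  obtains M h where "\<And>m. h m \<in> hskew n m" "\<And>xs. f xs = (\<Sum>m\<le>M. h m xs)"
proof -
  obtain p where p: "p \<in> polys n" "\<And>xs. f xs = (if length xs = n then evl xs p else 0)"
    using assms unfolding skew_polys_def by auto
  define K where "K m = {k \<in> Poly_Mapping.keys p. mdeg n k = m}" for m
  define q where "q m = (\<Sum>k\<in>K m. Poly_Mapping.single k (Poly_Mapping.lookup p k))" for m
  define h where "h m xs = (if length xs = n then evl xs (q m) else 0)" for m xs
  define M where "M = Max (insert 0 (mdeg n ` Poly_Mapping.keys p))"
  have M: "mdeg n k \<le> M" if "k \<in> Poly_Mapping.keys p" for k
    using that unfolding M_def by (intro Max_ge) auto
  have qk: "Poly_Mapping.keys (q m) \<subseteq> K m" for m
    using keys_sum_single_subset[of "\<lambda>k. k" _ "K m"] unfolding q_def by simp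
  have sum: "f xs = (\<Sum>m\<le>N. h m xs)" if "M \<le> N" for N xs
  proof (cases "length xs = n")
    case True
    have "(\<Sum>m\<le>N. evl xs (q m)) = (\<Sum>m\<le>N. \<Sum>k\<in>K m. mon xs k * Poly_Mapping.lookup p k)"
      unfolding q_def evl_sum_single ..
    also have "\<dots> = (\<Sum>k\<in>Poly_Mapping.keys p. mon xs k * Poly_Mapping.lookup p k)"
      unfolding K_def using M that by (intro sum.group) (auto intro: le_trans)
    finally show ?thesis using True p(2) by (simp add: h_def weval_def)
  qed (simp add: p(2) h_def)
  have dil: "h m (map ((*) t) xs) = t ^ m * h m xs" for m t xs
    by (simp add: h_def q_def evl_sum_single mon_dilate sum_distrib_left K_def mult.assoc)
  have "skew (h m)" for m
  proof (rule skewI)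
    fix as bs :: "complex list" and x y
    let ?u = "as @ x # y # bs" and ?v = "as @ y # x # bs"
    \<comment> \<open>The component may lie above \<open>M\<close>, so the sum is prolonged until it
      includes degree \<open>m\<close>.\<close>
    define N where "N = max M m"
    have "(\<Sum>m\<le>N. t ^ m * (h m ?u + h m ?v)) = 0" for t
    proof -
      have "(\<Sum>m\<le>N. t ^ m * (h m ?u + h m ?v)) = f (map ((*) t) ?u) + f (map ((*) t) ?v)"
        unfolding sum[of N, unfolded N_def, simplified] by (simp add: N_def dil distrib_left sum.distrib del: map_append list.map)
      also have "\<dots> = 0"
        using skewD[OF skew_polys_skew[OF assms], of "map ((*) t) as" "t * x" "t * y" "map ((*) t) bs"] by simp
      finally show ?thesis .
    qed
    then have "h m ?u + h m ?v = 0"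
      by (rule coeff_eq_0_of_sum_powers[where M = N]) (simp add: N_def)
    then show "h m ?u = - h m ?v" by (simp add: add_eq_0_iff2)
  qed
  moreover have "q m \<in> polys n" for m
    using qk[of m] p(1) unfolding polys_def K_def by auto
  ultimately have "h m \<in> hskew n m" for m
    using qk[of m] by (intro hskewI[of _ "q m"]) (auto simp: h_def K_def)
  then show ?thesis using sum that by blast
qed

text \<open>The monomials are sorted by the exponent of the first variable. Comparing powers of that
  variable transfers skew-symmetry in the remaining ones to each coefficient.\<close>

lemma hskew_Cons:
  assumes "f \<in> hskew (Suc n) m"
  obtains g where "\<And>a. a \<le> m \<Longrightarrow> g a \<in> hskew n (m - a)" "\<And>x xs. f (x # xs) = (\<Sum>a\<le>m. x ^ a * g a xs)"
proof -
  obtain p where p: "skew f" "p \<in> polys (Suc n)" "\<And>k. k \<in> Poly_Mapping.keys p \<Longrightarrow> mdeg (Suc n) k = m"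
    "\<And>xs. length xs = Suc n \<Longrightarrow> f xs = evl xs p" "\<And>xs. length xs \<noteq> Suc n \<Longrightarrow> f xs = 0"
    using assms by (rule hskewE) blast
  \<comment> \<open>Drops the exponent of the first variable and renumbers the others from
    0.\<close>
  define sh where "sh k = Poly_Mapping.map_key Suc k" for k :: "nat \<Rightarrow>\<^sub>0 nat"
  have sh: "Poly_Mapping.lookup (sh k) i = Poly_Mapping.lookup k (Suc i)" for k i
    by (simp add: sh_def map_key.rep_eq)
  define K where "K a = {k \<in> Poly_Mapping.keys p. Poly_Mapping.lookup k 0 = a}" for a
  define q where "q a = (\<Sum>k\<in>K a. Poly_Mapping.single (sh k) (Poly_Mapping.lookup p k))" for a
  define g where "g a xs = (if length xs = n then evl xs (q a) else 0)" for a xs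
  have deg: "mdeg (Suc n) k = Poly_Mapping.lookup k 0 + mdeg n (sh k)" for k
    by (simp add: mdeg_def sh sum.lessThan_Suc_shift del: sum.lessThan_Suc)
  have sum: "f (x # xs) = (\<Sum>a\<le>m. x ^ a * g a xs)" for x xs
  proof (cases "length xs = n")
    case True
    have mon: "mon (x # xs) k = x ^ Poly_Mapping.lookup k 0 * mon xs (sh k)" for k
      by (simp add: mon_def sh prod.lessThan_Suc_shift del: prod.lessThan_Suc)
    have "f (x # xs) = (\<Sum>k\<in>Poly_Mapping.keys p. mon (x # xs) k * Poly_Mapping.lookup p k)"
      using True p(4) by (simp add: weval_def)
    also have "\<dots> = (\<Sum>a\<le>m. \<Sum>k\<in>K a. mon (x # xs) k * Poly_Mapping.lookup p k)"
      unfolding K_def using p(3) deg by (intro sum.group[symmetric]) (auto, metis le_add1)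
    also have "\<dots> = (\<Sum>a\<le>m. x ^ a * g a xs)"
      using True by (simp add: g_def q_def evl_sum_single mon sum_distrib_left K_def mult.assoc)
    finally show ?thesis .
  qed (simp add: g_def p(5))
  have "g a \<in> hskew n (m - a)" if a: "a \<le> m" for a
  proof (rule hskewI)
    have qk: "Poly_Mapping.keys (q a) \<subseteq> sh ` K a"
      unfolding q_def by (rule keys_sum_single_subset)
    show "mdeg n k = m - a" if k: "k \<in> Poly_Mapping.keys (q a)" for k
    proof -
      obtain l where l: "l \<in> K a" "k = sh l" using k qk by blast
      then have "m = a + mdeg n k" using p(3)[of l] deg[of l] by (simp add: K_def)
      then show ?thesis by simp
    qed
    show "q a \<in> polys n"
      unfolding polys_def
    proof (intro CollectI ballI)
      fix k assume "k \<in> Poly_Mapping.keys (q a)"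
      then obtain l where l: "l \<in> Poly_Mapping.keys p" "k = sh l" using qk by (auto simp: K_def)
      show "Poly_Mapping.keys k \<subseteq> {..<n}"
      proof
        fix i assume "i \<in> Poly_Mapping.keys k"
        then have "Suc i \<in> Poly_Mapping.keys l" using l(2) by (simp add: in_keys_iff sh)
        then show "i \<in> {..<n}" using p(2) l(1) by (auto simp: polys_def)
      qed
    qed
    show "g a xs = (if length xs = n then evl xs (q a) else 0)" for xs by (simp add: g_def)
    show "skew (g a)"
    proof (rule skewI)
      fix as bs :: "complex list" and x y
      let ?u = "as @ x # y # bs" and ?v = "as @ y # x # bs"
      have "(\<Sum>b\<le>m. t ^ b * (g b ?u + g b ?v)) = 0" for t
        using sum[of t ?u] sum[of t ?v] skewD[OF p(1), of "t # as" x y bs]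
        by (simp add: distrib_left sum.distrib)
      then have "g a ?u + g a ?v = 0"
        by (rule coeff_eq_0_of_sum_powers) (rule a)
      then show "g a ?u = - g a ?v" by (simp add: add_eq_0_iff2)
    qed
  qed
  then show ?thesis using sum that by blast
qed

text \<open>In one slot the derivative of \<open>(t - y) * (t + y) ^ e\<close> at 0 is
  \<open>(1 - e) * y ^ e\<close>; summed over the slots this is the number of slots minus the
  degree. The constant \<open>c\<close> carries the powers of the arguments already passed.\<close>

lemma lie_der_monomial_derivative:
  fixes es :: "nat list"
  assumes "length es = length xs"
  shows "((\<lambda>t. lie_der t (\<lambda>ys. c * prod_list (map2 (\<lambda>e y. y ^ e) es ys)) xs) has_field_derivative
    (of_nat (length xs) - of_nat (sum_list es)) * (c * prod_list (map2 (\<lambda>e y. y ^ e) es xs))) (at 0)"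
  using assms
proof (induction xs arbitrary: es c)
  case (Cons y xs)
  then obtain e fs where es: "es = e # fs" by (cases es) auto
  define P where "P = prod_list (map2 (\<lambda>e y. y ^ e) fs xs)"
  have "((\<lambda>t. (t - y) * (c * ((t + y) ^ e * P))) has_field_derivative (1 - of_nat e) * (c * y ^ e * P)) (at 0)"
  proof -
    have "((\<lambda>t. (t + y) ^ e) has_field_derivative of_nat e * y ^ (e - 1)) (at 0)"
      by (auto intro!: derivative_eq_intros)
    then have D: "((\<lambda>t. (t - y) * (c * ((t + y) ^ e * P))) has_field_derivative
        c * y ^ e * P - y * (c * (of_nat e * y ^ (e - 1) * P))) (at 0)"
      by (auto intro!: derivative_eq_intros)
    have "y * (of_nat e * y ^ (e - 1)) = of_nat e * y ^ e"
      by (cases e) simp_all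
    then have "y * (c * (of_nat e * y ^ (e - 1) * P)) = of_nat e * (c * y ^ e * P)"
      by (metis mult.assoc mult.left_commute)
    then have "c * y ^ e * P - y * (c * (of_nat e * y ^ (e - 1) * P)) = (1 - of_nat e) * (c * y ^ e * P)"
      by (simp only: left_diff_distrib mult_1)
    with D show ?thesis by (simp only:)
  qed
  from DERIV_add[OF this Cons.IH[of fs "c * y ^ e"]] Cons.prems
  show ?case by (simp add: es P_def algebra_simps)
qed simp

text \<open>To first order at 0 the Lie derivative is the number of arguments minus the Euler
  operator, and a homogeneous function is an eigenvector of the latter.\<close>

lemma lie_der_derivative:
  assumes f: "f \<in> hskew n m" and xs: "length xs = n"
  shows "((\<lambda>t. lie_der t f xs) has_field_derivative (of_nat n - of_nat m) * f xs) (at 0)"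
proof -
  obtain p where p: "\<And>k. k \<in> Poly_Mapping.keys p \<Longrightarrow> mdeg n k = m" "\<And>xs. length xs = n \<Longrightarrow> f xs = evl xs p"
    using f by (rule hskewE) blast
  define es where "es k = map (Poly_Mapping.lookup k) [0..<n]" for k :: "nat \<Rightarrow>\<^sub>0 nat"
  define F where "F k ys = Poly_Mapping.lookup p k * prod_list (map2 (\<lambda>e y. y ^ e) (es k) ys)" for k and ys :: "complex list"
  have mon: "mon ys k = prod_list (map2 (\<lambda>e y. y ^ e) (es k) ys)" if "length ys = n" for ys k
    using prod_nth_eq_prod_list[of "es k" n ys "\<lambda>e y. y ^ e"] that by (simp add: mon_def es_def)
  have fF: "f ys = (\<Sum>k\<in>Poly_Mapping.keys p. F k ys)" if "length ys = n" for ys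
    using that by (simp add: p(2) weval_def mon F_def mult.commute)
  have "lie_der t f xs = (\<Sum>k\<in>Poly_Mapping.keys p. lie_der t (F k) xs)" for t
    unfolding lie_der_sum[symmetric] using fF xs by (intro lie_der_cong) simp
  moreover have "((\<lambda>t. \<Sum>k\<in>Poly_Mapping.keys p. lie_der t (F k) xs) has_field_derivative
      (\<Sum>k\<in>Poly_Mapping.keys p. (of_nat n - of_nat m) * F k xs)) (at 0)"
  proof (rule DERIV_sum)
    fix k assume k: "k \<in> Poly_Mapping.keys p"
    have "sum_list (es k) = m"
      using p(1)[OF k] by (simp add: es_def mdeg_def sum_list_sum_nth atLeast0LessThan)
    then show "((\<lambda>t. lie_der t (F k) xs) has_field_derivative (of_nat n - of_nat m) * F k xs) (at 0)"
      using lie_der_monomial_derivative[of "es k" xs "Poly_Mapping.lookup p k"] xs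
      unfolding F_def by (simp add: es_def)
  qed
  ultimately show ?thesis using fF[OF xs] by (simp add: sum_distrib_left)
qed

lemma homotopy:
  assumes f: "f \<in> hskew (Suc n) m" and d: "\<And>xs. cdiff f xs = 0"
  obtains g where "g \<in> skew_polys n" "\<And>xs. cdiff g xs = (of_nat m - of_nat (Suc n)) * f xs"
proof -
  obtain h where h: "\<And>a. a \<le> m \<Longrightarrow> h a \<in> hskew n (m - a)" "\<And>x xs. f (x # xs) = (\<Sum>a\<le>m. x ^ a * h a xs)"
    using f by (rule hskew_Cons) blast
  \<comment> \<open>The coefficient of the first power of the inserted variable, that is, the
    derivative of the insertion at 0. In degree 0 there is no such power.\<close>
  define g where "g = (if 1 \<le> m then h 1 else (\<lambda>_. 0))"
  have g: "g \<in> skew_polys n"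
  proof (cases "1 \<le> m")
    case True
    then show ?thesis using h(1)[of 1] by (auto simp: g_def intro: hskew_skew_polys)
  next
    case False
    then show ?thesis
      using scale_skew_polys[OF hskew_skew_polys[OF h(1)[of 0]], of 0] by (simp add: g_def)
  qed
  have der: "((\<lambda>t. f (t # ys)) has_field_derivative g ys) (at 0)" for ys
  proof -
    have "((\<lambda>t. \<Sum>a\<le>m. t ^ a * h a ys) has_field_derivative (\<Sum>a\<le>m. (of_nat a * 0 ^ (a - 1)) * h a ys)) (at 0)"
      by (rule DERIV_sum) (auto intro!: derivative_eq_intros)
    moreover have "(\<Sum>a\<le>m. (of_nat a * 0 ^ (a - 1)) * h a ys) = (\<Sum>a\<le>m. if a = 1 then h a ys else 0)"
    proof (rule sum.cong)
      fix a assume "a \<in> {..m}"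
      show "(of_nat a * 0 ^ (a - 1)) * h a ys = (if a = 1 then h a ys else 0)"
      proof (cases a)
        case (Suc b)
        then show ?thesis by (cases b) auto
      qed simp
    qed simp
    moreover have "\<dots> = g ys" by (simp add: g_def)
    ultimately show ?thesis by (simp add: h(2))
  qed
  have "cdiff g xs = (of_nat m - of_nat (Suc n)) * f xs" for xs
  proof (cases "length xs = Suc n")
    case True
    \<comment> \<open>The recursion of \<open>cdiff\<close> is differentiated term by term at
      \<open>t = 0\<close>. Since \<open>f\<close> is closed, the same function is constantly 0, and
      the two derivatives agree.\<close>
    have "((\<lambda>t. cdiff f (t # xs)) has_field_derivative (- ((of_nat (Suc n) - of_nat m) * f xs) - cdiff g xs)) (at 0)"
      unfolding cdiff.simps
      by (intro DERIV_diff DERIV_minus lie_der_derivative[OF f True] cdiff_has_derivative der)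
    moreover have "((\<lambda>t. cdiff f (t # xs)) has_field_derivative 0) (at 0)"
      unfolding d by simp
    ultimately have "- ((of_nat (Suc n) - of_nat m) * f xs) - cdiff g xs = 0"
      by (rule DERIV_unique)
    then show ?thesis by (simp add: algebra_simps)
  next
    case False
    then show ?thesis
      using cdiff_length[of n g xs] skew_polys_length[OF g] skew_polys_length[OF hskew_skew_polys[OF f]] by simp
  qed
  then show ?thesis using g that by blast
qed

text \<open>The differential raises the degree by one, so each component of a cocycle is a cocycle.
  By \<open>homotopy\<close> all of them are exact except the one whose degree is the number of
  arguments.\<close>

lemma cocycle_decompose:
  assumes f: "f \<in> skew_polys (Suc n)" and d: "\<And>xs. cdiff f xs = 0"
  obtains h g where "h \<in> hskew (Suc n) (Suc n)" "\<And>xs. cdiff h xs = 0" "g \<in> skew_polys n"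
    "\<And>xs. f xs = h xs + cdiff g xs"
proof -
  obtain M h where h: "\<And>m. h m \<in> hskew (Suc n) m" "\<And>xs. f xs = (\<Sum>m\<le>M. h m xs)"
    using f by (rule skew_polys_decompose) blast
  \<comment> \<open>Padding by zero above \<open>M\<close> lets the sum run far enough to contain
    degree \<open>Suc n\<close>, which can then be split off.\<close>
  define h' where "h' m = (if m \<le> M then h m else (\<lambda>_. 0))" for m
  have dh: "cdiff (h m) xs = 0" if "m \<le> M" for m xs
  proof (rule coeff_eq_0_of_sum_powers[OF _ that])
    fix t :: complex assume t: "t \<noteq> 0"
    have "0 = cdiff f (map ((*) t) xs)" using d by simp
    also have "\<dots> = t * cdiff (\<lambda>ys. f (map ((*) t) ys)) xs" by (rule cdiff_dilate[symmetric])
    also have "(\<lambda>ys. f (map ((*) t) ys)) = (\<lambda>ys. \<Sum>m\<le>M. t ^ m * h m ys)"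
      unfolding h(2) using hskew_dilate[OF h(1)] by (intro ext sum.cong) auto
    also have "cdiff \<dots> xs = (\<Sum>m\<le>M. t ^ m * cdiff (h m) xs)"
      by (simp add: cdiff_sum cdiff_scale)
    finally show "(\<Sum>m\<le>M. t ^ m * cdiff (h m) xs) = 0" using t by simp
  qed
  have h'0: "(\<lambda>_. 0) \<in> hskew (Suc n) m" for m
    by (rule hskewI[of _ 0]) (simp_all add: skew_def polys_0 id_hom.weval_0)
  have h': "h' m \<in> hskew (Suc n) m" for m using h(1) h'0 by (simp add: h'_def)
  have dh': "cdiff (h' m) xs = 0" for m xs using dh by (simp add: h'_def cdiff_zero)
  have fh': "f xs = (\<Sum>m\<le>max M (Suc n). h' m xs)" for xs
    unfolding h(2) by (rule sum.mono_neutral_cong_left) (auto simp: h'_def)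
  have "\<exists>g. g \<in> skew_polys n \<and> (\<forall>xs. cdiff g xs = (of_nat m - of_nat (Suc n)) * h' m xs)" for m
    using homotopy[OF h' dh'] by metis
  then obtain g where g: "\<And>m. g m \<in> skew_polys n"
    "\<And>m xs. cdiff (g m) xs = (of_nat m - of_nat (Suc n)) * h' m xs" by metis
  \<comment> \<open>The homotopy returns each component times \<open>m - Suc n\<close>; this factor
    is invertible once degree \<open>Suc n\<close> is excluded.\<close>
  define G where "G xs = (\<Sum>m\<in>{..max M (Suc n)} - {Suc n}. inverse (of_nat m - of_nat (Suc n)) * g m xs)" for xs
  have G0: "(\<lambda>_. 0) \<in> skew_polys n" using scale_skew_polys[OF g(1), of 0 0] by simp
  have Gs: "(\<lambda>xs. \<Sum>m\<in>S. inverse (of_nat m - of_nat (Suc n)) * g m xs) \<in> skew_polys n" if "finite S" for S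
    using that
  proof induction
    case (insert m S)
    then show ?case using lin_skew_polys[OF g(1)[of m] insert.IH, of _ 1] by simp
  qed (simp add: G0)
  have "cdiff G xs = (\<Sum>m\<in>{..max M (Suc n)} - {Suc n}. h' m xs)" for xs
  proof -
    have "cdiff G xs = (\<Sum>m\<in>{..max M (Suc n)} - {Suc n}. inverse (of_nat m - of_nat (Suc n)) * cdiff (g m) xs)"
      unfolding G_def cdiff_sum cdiff_scale ..
    also have "\<dots> = (\<Sum>m\<in>{..max M (Suc n)} - {Suc n}. h' m xs)"
    proof (rule sum.cong)
      fix m assume "m \<in> {..max M (Suc n)} - {Suc n}"
      then have "(of_nat m - of_nat (Suc n) :: complex) \<noteq> 0" by (simp del: of_nat_Suc)
      then show "inverse (of_nat m - of_nat (Suc n)) * cdiff (g m) xs = h' m xs"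
        unfolding g(2) by (simp add: mult.assoc[symmetric] del: of_nat_Suc)
    qed simp
    finally show ?thesis .
  qed
  then have "f xs = h' (Suc n) xs + cdiff G xs" for xs
    unfolding fh' by (subst sum.remove[of _ "Suc n"]) auto
  moreover have "G \<in> skew_polys n" using Gs unfolding G_def[abs_def] by simp
  ultimately show ?thesis using that h' dh' by blast
qed

section \<open>Skew-symmetric polynomials of low degree\<close>

fun vdm :: "complex list \<Rightarrow> complex" where
  "vdm [] = 1"
| "vdm (x # xs) = prod_list (map (\<lambda>y. x - y) xs) * vdm xs"

lemma skew_vdm: "skew vdm"
proof (rule skewI)
  fix as bs :: "complex list" and x y
  show "vdm (as @ x # y # bs) = - vdm (as @ y # x # bs)"
  proof (induction as)
    case Nil
    show ?case by (simp add: algebra_simps)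
  next
    case (Cons a as)
    then show ?case by (simp add: mult_ac)
  qed
qed

lemma vdm_dilate: "vdm (map ((*) t) xs) = t ^ (\<Sum>i<length xs. i) * vdm xs"
proof (induction xs)
  case (Cons x xs)
  have "prod_list (map (\<lambda>y. t * x - y) (map ((*) t) xs)) = t ^ length xs * prod_list (map (\<lambda>y. x - y) xs)"
    by (induction xs) (simp_all add: algebra_simps)
  then show ?case unfolding list.map vdm.simps Cons by (simp add: power_add mult_ac)
qed simp

text \<open>Exchanging two equal entries changes the sign but not the list.\<close>

lemma skew_not_distinct:
  assumes "skew f" "\<not> distinct xs"
  shows "f xs = 0"
proof -
  obtain as bs cs x where "xs = as @ x # bs @ x # cs"
    using not_distinct_decomp[OF assms(2)] by auto
  then have "f xs = - f xs" using skew_transpose[OF assms(1), of as x bs x cs] by simp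
  then show ?thesis by simp
qed

text \<open>For comparing degrees: a value that dilation by 2 multiplies by two different powers of
  2 must be zero.\<close>

lemma power_2_eq_iff: "(2 :: complex) ^ a = 2 ^ b \<longleftrightarrow> a = b"
proof
  assume "(2 :: complex) ^ a = 2 ^ b"
  then have "norm ((2 :: complex) ^ a) = norm ((2 :: complex) ^ b)" by (rule arg_cong)
  then show "a = b" unfolding norm_power by simp
qed simp

text \<open>
  As a polynomial in \<open>x\<close> of degree at most \<open>n\<close>, \<open>f(x, x\<^sub>1, \<dots>, x\<^sub>n)\<close> vanishes at \<open>x\<^sub>1, \<dots>, x\<^sub>n\<close>.
\<close>

lemma hskew_vdm:
  assumes "f \<in> hskew n m" "m \<le> (\<Sum>i<n. i)"
  shows "\<exists>c. \<forall>xs. length xs = n \<longrightarrow> f xs = c * vdm xs"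
  using assms
proof (induction n arbitrary: f m)
  case 0
  show ?case by (rule exI[of _ "f []"]) simp
next
  case (Suc n)
  obtain g where g: "\<And>a. a \<le> m \<Longrightarrow> g a \<in> hskew n (m - a)" "\<And>x xs. f (x # xs) = (\<Sum>a\<le>m. x ^ a * g a xs)"
    using Suc.prems(1) by (rule hskew_Cons) blast
  \<comment> \<open>Beyond the power \<open>n\<close> the coefficient has degree less than that of
    \<open>vdm\<close> in \<open>n\<close> variables. By induction it is a multiple of
    \<open>vdm\<close>, and dilation by 2 then forces it to vanish.\<close>
  have g0: "g a xs = 0" if a: "n < a" "a \<le> m" and xs: "length xs = n" for a xs
  proof -
    have lt: "m - a < (\<Sum>i<n. i)" using Suc.prems(2) a by simp
    obtain c where c: "\<And>xs. length xs = n \<Longrightarrow> g a xs = c * vdm xs"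
      using Suc.IH[OF g(1)[OF a(2)]] lt by auto
    have "2 ^ (m - a) * g a xs = c * vdm (map ((*) 2) xs)"
      using hskew_dilate[OF g(1)[OF a(2)], of 2 xs] c[of "map ((*) 2) xs"] xs by simp
    also have "\<dots> = 2 ^ (\<Sum>i<n. i) * g a xs" by (simp add: vdm_dilate c xs)
    finally have "(2 ^ (m - a) - 2 ^ (\<Sum>i<n. i)) * g a xs = 0" by (simp add: left_diff_distrib)
    then show ?thesis using lt by (simp add: power_2_eq_iff)
  qed
  \<comment> \<open>The coefficient of the power \<open>n\<close>, read as 0 if that power does not
    occur. It determines the constant.\<close>
  have "\<exists>c. \<forall>xs. length xs = n \<longrightarrow> (if n \<le> m then g n xs else 0) = c * vdm xs"
  proof (cases "n \<le> m")
    case True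
    then show ?thesis using Suc.IH[OF g(1)[OF True]] Suc.prems(2) by auto
  next
    case False
    then show ?thesis by (intro exI[of _ 0]) simp
  qed
  then obtain c where c: "\<And>xs. length xs = n \<Longrightarrow> (if n \<le> m then g n xs else 0) = c * vdm xs" by blast
  have f: "skew f" using Suc.prems(1) by (rule hskewE)
  have "f ys = c * vdm ys" if ys: "length ys = Suc n" for ys
  proof -
    obtain x xs where x: "ys = x # xs" "length xs = n" using ys by (cases ys) auto
    show ?thesis
    proof (cases "distinct xs")
      case False
      then show ?thesis using skew_not_distinct[OF f, of ys] skew_not_distinct[OF skew_vdm, of ys] x by simp
    next
      case True
      \<comment> \<open>\<open>q\<close> is \<open>f\<close> as a polynomial in its first argument;
        \<open>r\<close> is the candidate. Both have degree at most \<open>n\<close>, the same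
        coefficient at \<open>n\<close>, and the \<open>n\<close> distinct roots in
        \<open>xs\<close>, so they coincide.\<close>
      define q where "q = (\<Sum>a\<le>m. Polynomial.monom (g a xs) a)"
      define r where "r = Polynomial.smult (c * vdm xs) (\<Prod>y\<in>set xs. [:- y, 1:])"
      have pq: "poly q z = f (z # xs)" for z
        by (simp add: q_def poly_sum poly_monom g(2) mult.commute)
      have pr: "poly r z = c * (vdm xs * (\<Prod>y\<in>set xs. z - y))" for z
        by (simp add: r_def poly_prod)
      have card: "card (set xs) = n" using True x(2) by (simp add: distinct_card)
      have dr: "Polynomial.degree (\<Prod>y\<in>set xs. [:- y, 1:]) = n"
        using card by (simp add: degree_prod_sum_eq)
      have lr: "coeff (\<Prod>y\<in>set xs. [:- y, 1:]) n = 1"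
        using lead_coeff_prod[of "\<lambda>y. [:- y, 1:]" "set xs"] by (simp add: dr)
      have cq: "coeff q i = (if i \<le> m then g i xs else 0)" for i
        by (simp add: q_def coeff_sum)
      have "q = r"
      proof (rule poly_eqI_degree_lead_coeff[where n = n and A = "set xs"])
        show "coeff q n = coeff r n" using c[OF x(2)] by (simp add: cq r_def lr)
        show "n \<le> card (set xs)" by (simp add: card)
        show "Polynomial.degree q \<le> n" using g0 x(2) by (intro degree_le) (auto simp: cq)
        show "Polynomial.degree r \<le> n" unfolding r_def using dr degree_smult_le by metis
        show "poly q z = poly r z" if "z \<in> set xs" for z
        proof -
          have "(\<Prod>y\<in>set xs. z - y) = 0" using that by (intro prod_zero) auto
          then show ?thesis using skew_not_distinct[OF f, of "z # xs"] that by (simp add: pq pr)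
        qed
      qed
      then have "f (x # xs) = c * (vdm xs * (\<Prod>y\<in>set xs. x - y))" using pq pr by metis
      then show ?thesis
        using True x by (simp add: prod.distinct_set_conv_list mult_ac)
    qed
  qed
  then show ?case by blast
qed

text \<open>By \<open>hskew_vdm\<close> such a function is a multiple of \<open>vdm\<close>, which
  has the larger degree \<open>\<Sum>i<n. i\<close>; comparing dilations by 2 leaves only
  zero.\<close>

lemma hskew_eq_0:
  assumes f: "f \<in> hskew n m" and lt: "m < (\<Sum>i<n. i)"
  shows "f xs = 0"
proof (cases "length xs = n")
  case True
  obtain c where c: "\<And>xs. length xs = n \<Longrightarrow> f xs = c * vdm xs"
    using hskew_vdm[OF f] lt by auto
  have "2 ^ m * f xs = c * vdm (map ((*) 2) xs)"
    using hskew_dilate[OF f, of 2 xs] c[of "map ((*) 2) xs"] True by simp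
  also have "\<dots> = 2 ^ (\<Sum>i<n. i) * f xs" by (simp add: vdm_dilate c True)
  finally have "(2 ^ m - 2 ^ (\<Sum>i<n. i)) * f xs = 0" by (simp add: left_diff_distrib)
  then show ?thesis using lt by (simp add: power_2_eq_iff)
qed (use skew_polys_length[OF hskew_skew_polys[OF f]] in simp)

lemma skew_length: "skew f \<Longrightarrow> skew (\<lambda>xs. if length xs = n then f xs else 0)"
proof (rule skewI)
  fix as bs :: "complex list" and x y
  assume "skew f"
  then show "(if length (as @ x # y # bs) = n then f (as @ x # y # bs) else 0) =
      - (if length (as @ y # x # bs) = n then f (as @ y # x # bs) else 0)"
    using skewD[of f as x y bs] by simp
qed

lemma skew_polys_lengthI:
  assumes "skew f" "p \<in> polys n" "\<And>xs. length xs = n \<Longrightarrow> f xs = evl xs p"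
  shows "(\<lambda>xs. if length xs = n then f xs else 0) \<in> skew_polys n"
  unfolding skew_polys_def using skew_length[OF assms(1), of n] assms(2,3) by auto

section \<open>Explicit cochains in degrees two and three\<close>

definition vdm3 :: "complex list \<Rightarrow> complex" where
  "vdm3 xs = (if length xs = 3 then vdm xs else 0)"

text \<open>Modulo the sum of the two variables this is -2 times the cube of the first one, the
  cocycle of the central extension of Vir.\<close>

definition cubic2 :: "complex list \<Rightarrow> complex" where
  "cubic2 xs = (if length xs = 2 then prod_list xs * vdm xs else 0)"

lemma length_3E:
  assumes "length xs = 3" obtains a b c where "xs = [a, b, c]"
  using assms by (auto simp: numeral_3_eq_3 length_Suc_conv)

lemma length_2E:
  assumes "length xs = 2" obtains a b where "xs = [a, b]"
  using assms by (auto simp: numeral_2_eq_2 length_Suc_conv)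

lemma vdm3_skew_polys: "vdm3 \<in> skew_polys 3"
proof -
  let ?p = "(X 0 + - X 1) * (X 0 + - X 2) * (X 1 + - X 2) :: complex vpoly"
  have "?p \<in> polys 3" by (intro polys_mult polys_add polys_minus polys_X) simp_all
  moreover have "vdm xs = evl xs ?p" if "length xs = 3" for xs
    using that by (elim length_3E) (simp only: id_hom.weval_simps, simp add: id_hom.weval_X)
  ultimately show ?thesis
    unfolding vdm3_def[abs_def] by (intro skew_polys_lengthI skew_vdm) auto
qed

lemma cubic2_skew_polys: "cubic2 \<in> skew_polys 2"
proof -
  let ?p = "X 0 * X 1 * (X 0 + - X 1) :: complex vpoly"
  have "?p \<in> polys 2" by (intro polys_mult polys_add polys_minus polys_X) simp_all
  moreover have "prod_list xs * vdm xs = evl xs ?p" if "length xs = 2" for xs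
    using that by (elim length_2E) (simp only: id_hom.weval_simps, simp add: id_hom.weval_X)
  moreover have "skew (\<lambda>xs. prod_list xs * vdm xs)"
  proof (rule skewI)
    fix as bs :: "complex list" and x y
    show "prod_list (as @ x # y # bs) * vdm (as @ x # y # bs) = - (prod_list (as @ y # x # bs) * vdm (as @ y # x # bs))"
      using skewD[OF skew_vdm, of as x y bs] by (simp add: mult.left_commute)
  qed
  ultimately show ?thesis
    unfolding cubic2_def[abs_def] by (intro skew_polys_lengthI) auto
qed

lemma cdiff_vdm3: "cdiff vdm3 xs = 0"
proof (cases "length xs = Suc 3")
  case True
  then obtain a b c d where xs: "xs = [a, b, c, d]" by (auto simp: numeral_3_eq_3 length_Suc_conv)
  show ?thesis unfolding xs by (simp add: vdm3_def algebra_simps)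
qed (rule cdiff_length[of 3], simp_all add: vdm3_def)

lemma cdiff_cubic2: "cdiff cubic2 xs = sum_list xs * vdm3 xs"
proof (cases "length xs = 3")
  case True
  then obtain a b c where xs: "xs = [a, b, c]" by (rule length_3E)
  show ?thesis unfolding xs by (simp add: vdm3_def cubic2_def algebra_simps)
next
  case False
  then show ?thesis using cdiff_length[of 2 cubic2 xs] by (simp add: vdm3_def cubic2_def)
qed

lemma hskew_1_0: "f \<in> hskew 1 m \<Longrightarrow> f [x] = x ^ m * f [1]"
  using hskew_dilate[of f 1 m x "[1]"] by simp

text \<open>At three the two sides are equal, which is where the Vandermonde polynomial
  lives.\<close>

lemma degree_lt_sum: "4 \<le> n \<Longrightarrow> n < (\<Sum>i<n. i)" for n :: nat
  by (induction n rule: dec_induct) (auto simp: eval_nat_numeral)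

text \<open>\<open>cocycle_decompose\<close> leaves a closed \<open>h\<close> whose degree is the
  number of arguments. It vanishes for one argument and for at least four, is exact for two, and is
  a multiple of \<open>vdm3\<close> for three.\<close>

lemma basic_cocycle:
  assumes f: "f \<in> skew_polys (Suc n)" and d: "\<And>xs. cdiff f xs = 0"
  shows "\<exists>c g. g \<in> skew_polys n \<and> (\<forall>xs. f xs = c * (if n = 2 then vdm3 xs else 0) + cdiff g xs)"
proof -
  obtain h g where h: "h \<in> hskew (Suc n) (Suc n)" "\<And>xs. cdiff h xs = 0" and g: "g \<in> skew_polys n"
    and fh: "\<And>xs. f xs = h xs + cdiff g xs"
    using f d by (rule cocycle_decompose) blast
  have h0: "h xs = 0" if "length xs \<noteq> Suc n" for xs
    using skew_polys_length[OF hskew_skew_polys[OF h(1)] that] .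
  have "\<exists>c k. k \<in> skew_polys n \<and> (\<forall>xs. h xs = c * (if n = 2 then vdm3 xs else 0) + cdiff k xs)"
  proof -
    have z: "(\<lambda>_. 0) \<in> skew_polys n" using scale_skew_polys[OF g, of 0] by simp
    consider "n = 0" | "n = 1" | "n = 2" | "4 \<le> Suc n" by linarith
    then show ?thesis
    proof cases
      case 1
      have h1: "h \<in> hskew 1 1" using h(1) 1 by simp
      \<comment> \<open>\<open>cdiff h [1, 0]\<close> equals \<open>- h [1]\<close>, so a linear
        function of one argument is closed only if it is zero.\<close>
      have "h [1] = 0" using h(2)[of "[1, 0]"] by simp
      then have "h [x] = 0" for x using hskew_1_0[OF h1, of x] by simp
      then have "h xs = 0" for xs using h0[of xs] 1 by (cases xs rule: remdups_adj.cases) auto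
      then show ?thesis using z 1 by (intro exI[of _ 0] exI[of _ "\<lambda>_. 0"]) (simp add: cdiff_zero)
    next
      case 2
      have h1: "h \<in> hskew (Suc 1) 2" using h(1) 2 by (simp add: numeral_2_eq_2)
      obtain a where a: "\<And>i. i \<le> 2 \<Longrightarrow> a i \<in> hskew 1 (2 - i)" "\<And>x xs. h (x # xs) = (\<Sum>i\<le>2. x ^ i * a i xs)"
        using h1 by (rule hskew_Cons) blast
      define A B C where "A = a 0 [1]" and "B = a 1 [1]" and "C = a 2 [1]"
      have hxy: "h [x, y] = A * y\<^sup>2 + B * x * y + C * x\<^sup>2" for x y
      proof -
        have "h [x, y] = a 0 [y] + x * a 1 [y] + x\<^sup>2 * a 2 [y]"
          unfolding a(2) by (simp add: eval_nat_numeral)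
        then show ?thesis
          using hskew_1_0[OF a(1), of 0 y] hskew_1_0[OF a(1), of 1 y] hskew_1_0[OF a(1), of 2 y]
          by (simp add: A_def B_def C_def algebra_simps)
      qed
      have sk: "skew h" using h(1) by (rule hskewE)
      \<comment> \<open>Skew-symmetry at (1, 1) and at (1, -1) is enough to kill the mixed term and
        to make the two squares opposite.\<close>
      have "2 * (A + B + C) = 0" "2 * (A - B + C) = 0"
        using skew_swap_head[OF sk, of 1 1 "[]"] skew_swap_head[OF sk, of 1 "- 1" "[]"]
        unfolding hxy by (simp_all add: algebra_simps)
      then have ABC: "A + B + C = 0" "A - B + C = 0" by (simp_all only: mult_eq_0_iff, simp_all)
      have "2 * B = (A + B + C) - (A - B + C)" by simp
      then have B: "B = 0" unfolding ABC by simp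
      have "A + C = 0" using ABC(1) unfolding B by simp
      then have A: "A = - C" by (rule eq_neg_iff_add_eq_0[THEN iffD2])
      have hxy': "h [x, y] = C * (x\<^sup>2 - y\<^sup>2)" for x y
        unfolding hxy A B by (simp add: algebra_simps)
      \<comment> \<open>On two arguments the differential of a function of one is
        \<open>- (x - y) * k [x + y]\<close>, so \<open>k\<close> must be \<open>- C\<close> times
        the variable to yield \<open>C * (x\<^sup>2 - y\<^sup>2)\<close>.\<close>
      define k where "k xs = (if length xs = 1 then (- C) * sum_list xs else 0)" for xs :: "complex list"
      have "skew k"
        by (rule skewI) (simp add: k_def)
      moreover have "k xs = (if length xs = 1 then evl xs (cst (- C) * X 0) else 0)" for xs
        by (cases xs) (auto simp: k_def id_hom.weval_mult id_hom.weval_cst id_hom.weval_X)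
      ultimately have "k \<in> skew_polys n"
        unfolding skew_polys_def 2 by (auto intro!: bexI[of _ "cst (- C) * X 0"] polys_mult polys_cst polys_X)
      moreover have "h xs = cdiff k xs" for xs
      proof (cases "length xs = 2")
        case True
        then obtain x y where xs: "xs = [x, y]" by (rule length_2E)
        show ?thesis unfolding xs hxy' by (simp add: k_def power2_eq_square algebra_simps)
      next
        case False
        then show ?thesis using h0[of xs] 2 cdiff_length[of 1 k xs] by (simp add: k_def)
      qed
      ultimately show ?thesis using 2 by (intro exI[of _ 0] exI[of _ k]) simp
    next
      case 3
      \<comment> \<open>Degree 3 equals 0 + 1 + 2, the largest degree that \<open>hskew_vdm\<close>
        admits for three variables.\<close>
      obtain c where c: "\<And>xs. length xs = Suc n \<Longrightarrow> h xs = c * vdm xs"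
        using hskew_vdm[OF h(1)] 3 by (auto simp: eval_nat_numeral)
      have "h xs = c * vdm3 xs" for xs
        using c[of xs] h0[of xs] 3 by (simp add: vdm3_def)
      then show ?thesis using z 3 by (intro exI[of _ c] exI[of _ "\<lambda>_. 0"]) (simp add: cdiff_zero)
    next
      case 4
      then have "h xs = 0" for xs using hskew_eq_0[OF h(1) degree_lt_sum[OF 4]] by simp
      then show ?thesis using z 4 by (intro exI[of _ 0] exI[of _ "\<lambda>_. 0"]) (simp add: cdiff_zero)
    qed
  qed
  then obtain c k where k: "k \<in> skew_polys n" "\<And>xs. h xs = c * (if n = 2 then vdm3 xs else 0) + cdiff k xs"
    by blast
  show ?thesis
    using lin_skew_polys[OF k(1) g, of 1 1] fh k(2)
    by (intro exI[of _ c] exI[of _ "\<lambda>xs. k xs + g xs"]) (simp add: cdiff_add)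
qed

text \<open>
  Both sides are evaluated at multiples of \<open>(1, 2, -3)\<close>, where \<open>\<lambda>\<^sub>1 + \<lambda>\<^sub>2 + \<lambda>\<^sub>3\<close> vanishes. The component of
  degree 3 of \<open>d g\<close> comes from the quadratic part of \<open>g\<close>, which is zero at all \<open>(u, -u)\<close>.
\<close>

lemma vdm3_not_coboundary:
  assumes g: "g \<in> skew_polys 2" and e: "\<And>xs. vdm3 xs = cdiff g xs + sum_list xs * s xs"
  shows False
proof -
  obtain M h where h: "\<And>m. h m \<in> hskew 2 m" "\<And>xs. g xs = (\<Sum>m\<le>M. h m xs)"
    using g by (rule skew_polys_decompose) blast
  let ?v = "[1, 2, - 3] :: complex list"
  \<comment> \<open>The coefficient of \<open>t ^ m\<close> in the difference of the two sides after
    division by \<open>t\<close>. As \<open>cdiff\<close> raises the degree by one, the cubic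
    \<open>vdm3\<close> is met at \<open>m = 2\<close>.\<close>
  define c where "c m = cdiff (if m \<le> M then h m else (\<lambda>_. 0)) ?v - (if m = 2 then vdm3 ?v else 0)" for m
  have v: "vdm3 ?v = - 20" by (simp add: vdm3_def)
  have "(\<Sum>m\<le>max M 2. t ^ m * c m) = 0" if "t \<noteq> 0" for t
  proof -
    have "t * (\<Sum>m\<le>M. t ^ m * cdiff (h m) ?v) = t * cdiff (\<lambda>ys. \<Sum>m\<le>M. t ^ m * h m ys) ?v"
      by (simp only: cdiff_sum cdiff_scale)
    also have "(\<lambda>ys. \<Sum>m\<le>M. t ^ m * h m ys) = (\<lambda>ys. g (map ((*) t) ys))"
      unfolding h(2) using hskew_dilate[OF h(1)] by (intro ext sum.cong) auto
    also have "t * cdiff \<dots> ?v = cdiff g (map ((*) t) ?v)" by (rule cdiff_dilate)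
    also have "\<dots> = vdm3 (map ((*) t) ?v)" unfolding e by simp
    also have "\<dots> = t * (t ^ 2 * vdm3 ?v)" by (simp add: vdm3_def algebra_simps power2_eq_square)
    finally have "(\<Sum>m\<le>M. t ^ m * cdiff (h m) ?v) = t ^ 2 * vdm3 ?v" using that by simp
    moreover have "(\<Sum>m\<le>M. t ^ m * cdiff (h m) ?v) = (\<Sum>m\<le>max M 2. t ^ m * cdiff (if m \<le> M then h m else (\<lambda>_. 0)) ?v)"
      by (rule sum.mono_neutral_cong_left) (auto simp: cdiff_zero)
    moreover have "t ^ 2 * vdm3 ?v = (\<Sum>m\<le>max M 2. t ^ m * (if m = 2 then vdm3 ?v else 0))"
      by (simp add: if_distrib sum.delta cong: if_cong)
    ultimately show ?thesis
      unfolding c_def right_diff_distrib sum_subtractf by simp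
  qed
  then have "c 2 = 0" by (rule coeff_eq_0_of_sum_powers[where M = "max M 2"]) (assumption, rule max.cobounded2)
  \<comment> \<open>The swap and the dilation by -1 carry (u, -u) to the same point; the former
    changes the sign, the latter does not, since the degree is even.\<close>
  moreover have "h 2 [u, - u] = 0" for u
  proof -
    have "h 2 [- u, u] = h 2 [u, - u]"
      using hskew_dilate[OF h(1), of 2 "- 1" "[u, - u]"] by simp
    moreover have "h 2 [- u, u] = - h 2 [u, - u]"
      by (rule skew_swap_head[OF skew_polys_skew[OF hskew_skew_polys[OF h(1)]]])
    ultimately show ?thesis by simp
  qed
  \<comment> \<open>Any two entries of \<open>?v\<close> add up to minus the third, so
    \<open>cdiff (h 2) ?v\<close> involves only points of the form (u, -u).\<close>
  from this[of 1] this[of 2] this[of 3] this[of "- 1"] this[of "- 2"] this[of "- 3"]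
  have "cdiff (h 2) ?v = 0"
    using skew_swap_head[OF skew_polys_skew[OF hskew_skew_polys[OF h(1)[of 2]]], of 1 "- 1" "[]"]
      skew_swap_head[OF skew_polys_skew[OF hskew_skew_polys[OF h(1)[of 2]]], of 2 "- 2" "[]"] by simp
  ultimately show False by (auto simp: c_def v cdiff_zero split: if_splits)
qed

text \<open>Polynomials form an integral domain, and the sum of the variables is not zero because it
  takes the value \<open>Suc n\<close> at (1, ..., 1). With no variables it would be the empty
  sum.\<close>

lemma sum_list_mult_eq_0:
  assumes f: "f \<in> skew_polys (Suc n)" and z: "\<And>xs. sum_list xs * f xs = 0"
  shows "f xs = 0"
proof -
  obtain p where p: "p \<in> polys (Suc n)" "\<And>xs. f xs = (if length xs = Suc n then evl xs p else 0)"
    using f unfolding skew_polys_def by auto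
  define s where "s = (\<Sum>i<Suc n. X i :: complex vpoly)"
  have s: "s \<in> polys (Suc n)" unfolding s_def by (intro polys_sum polys_X) simp
  have es: "evl xs s = sum_list xs" if "length xs = Suc n" for xs
    using that by (simp add: s_def id_hom.weval_sum id_hom.weval_X sum_list_sum_nth atLeast0LessThan del: sum.lessThan_Suc)
  have "s * p = 0"
  proof (rule evl_eq_0_imp)
    show "s * p \<in> polys (Suc n)" using s p(1) by (rule polys_mult)
    show "evl xs (s * p) = 0" if "length xs = Suc n" for xs
      using z[of xs] p(2)[of xs] that by (simp add: id_hom.weval_mult es)
  qed
  moreover have "s \<noteq> 0"
  proof
    assume "s = 0"
    then have "evl (replicate (Suc n) 1) s = 0" by (simp add: id_hom.weval_0)
    then have "of_nat (Suc n) = (0 :: complex)" using es[of "replicate (Suc n) 1"] by (simp add: sum_list_replicate)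
    then show False by (simp del: of_nat_Suc)
  qed
  ultimately have "p = 0" by simp
  then show ?thesis by (simp add: p(2) id_hom.weval_0)
qed

lemma cdiff_sum_list: "cdiff (\<lambda>ys. sum_list ys * f ys) xs = sum_list xs * cdiff f xs"
  using cdiff_sum_list_mult[of 0 f xs] by simp

lemma reduced_cocycle:
  assumes f: "f \<in> skew_polys (Suc n)" and h: "h \<in> skew_polys (Suc (Suc n))"
    and d: "\<And>xs. cdiff f xs = sum_list xs * h xs"
  shows "\<exists>c c' g s. g \<in> skew_polys n \<and> s \<in> skew_polys (Suc n) \<and>
    (\<forall>xs. f xs = c * (if n = 2 then vdm3 xs else 0) + c' * (if n = 1 then cubic2 xs else 0) + cdiff g xs + sum_list xs * s xs)"
proof -
  \<comment> \<open>\<partial> commutes with the differential, so \<partial> of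
    \<open>cdiff h\<close> is the double differential of \<open>f\<close>, and \<partial> is
    injective here.\<close>
  have "cdiff h xs = 0" for xs
  proof (rule sum_list_mult_eq_0)
    show "cdiff h \<in> skew_polys (Suc (Suc (Suc n)))" using h by (rule cdiff_skew_polys)
    have "cdiff f = (\<lambda>xs. sum_list xs * h xs)" using d by blast
    then show "sum_list xs * cdiff h xs = 0" for xs
      using cdiff_cdiff[of f xs] by (simp add: cdiff_sum_list)
  qed
  then obtain c' s where s: "s \<in> skew_polys (Suc n)"
    "\<And>xs. h xs = c' * (if Suc n = 2 then vdm3 xs else 0) + cdiff s xs"
    using basic_cocycle[OF h] by blast
  \<comment> \<open>\<open>h\<close> can have a Vandermonde part only if it takes three arguments,
    that is for \<open>n = 1\<close>; then \<partial> of this part is the differential of a multiple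
    of \<open>cubic2\<close>.\<close>
  define b where "b xs = (if n = 1 then cubic2 xs else 0)" for xs
  have b: "b \<in> skew_polys (Suc n)"
  proof (cases "n = 1")
    case True
    then show ?thesis using cubic2_skew_polys by (simp add: b_def[abs_def] numeral_2_eq_2)
  next
    case False
    then show ?thesis using scale_skew_polys[OF f, of 0] by (simp add: b_def[abs_def])
  qed
  have db: "cdiff b xs = sum_list xs * (if Suc n = 2 then vdm3 xs else 0)" for xs
    using cdiff_cubic2[of xs] by (simp add: b_def[abs_def] cdiff_zero)
  \<comment> \<open>\<open>c'\<close> accounts for the Vandermonde part of \<open>h\<close> and
    \<open>s\<close> for its exact part, so what remains of \<open>f\<close> is closed in the basic
    complex.\<close>
  define f' where "f' xs = f xs - c' * b xs - sum_list xs * s xs" for xs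
  have f': "f' \<in> skew_polys (Suc n)"
    unfolding f'_def[abs_def]
    by (intro diff_skew_polys scale_skew_polys sum_list_mult_skew_polys f b s)
  have "cdiff f' xs = 0" for xs
    unfolding f'_def[abs_def] cdiff_diff cdiff_scale cdiff_sum_list d db s(2) by (simp add: algebra_simps)
  from basic_cocycle[OF f' this] obtain c g where g: "g \<in> skew_polys n"
    "\<And>xs. f' xs = c * (if n = 2 then vdm3 xs else 0) + cdiff g xs" by blast
  have "f xs = c * (if n = 2 then vdm3 xs else 0) + c' * (if n = 1 then cubic2 xs else 0) + cdiff g xs + sum_list xs * s xs" for xs
    using g(2)[of xs] unfolding f'_def b_def by (simp only: diff_eq_eq ac_simps)
  then show ?thesis using g(1) s(1) by blast
qed

text \<open>Applying the differential gives \<partial> of \<open>vdm3\<close> on one side and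
  \<partial> of \<open>cdiff s\<close> on the other. Cancelling \<partial> would make
  \<open>vdm3\<close> exact.\<close>

lemma cubic2_not_coboundary:
  assumes g: "g \<in> skew_polys 1" and s: "s \<in> skew_polys 2" and e: "\<And>xs. cubic2 xs = cdiff g xs + sum_list xs * s xs"
  shows False
proof -
  have c: "cubic2 = (\<lambda>xs. cdiff g xs + sum_list xs * s xs)" using e by blast
  have "sum_list xs * vdm3 xs = sum_list xs * cdiff s xs" for xs
    unfolding cdiff_cubic2[symmetric] c by (simp add: cdiff_add cdiff_cdiff cdiff_sum_list)
  then have 1: "sum_list xs * (vdm3 xs - cdiff s xs) = 0" for xs
    by (simp add: right_diff_distrib)
  have 2: "(\<lambda>xs. vdm3 xs - cdiff s xs) \<in> skew_polys (Suc 2)"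
    using diff_skew_polys[OF vdm3_skew_polys] cdiff_skew_polys[OF s] by simp
  have "vdm3 xs = cdiff s xs + sum_list xs * 0" for xs
    using sum_list_mult_eq_0[OF 2 1, of xs] by simp
  then show False by (rule vdm3_not_coboundary[OF s])
qed

section \<open>Quotients and complexes of vector spaces\<close>

lemma has_dim_0I:
  assumes V: "vectorspace class_ring V" and c: "carrier V = {\<zero>\<^bsub>V\<^esub>}"
  shows "has_dim V 0"
proof -
  interpret vectorspace class_ring V by fact
  have "span {} = carrier V"
    unfolding c by (subst finite_span) (auto simp: lincomb_def)
  then have A: "finite {} \<and> card {} = 0 \<and> {} \<subseteq> carrier V \<and> span {} = carrier V" by simp
  then have "fin_dim" unfolding fin_dim_def by blast
  moreover have "dim = 0" unfolding dim_def by (rule Least_equality) (use A in blast, simp)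
  ultimately show ?thesis using V unfolding has_dim_def by blast
qed

lemma has_dim_1I:
  assumes V: "vectorspace class_ring V" and x: "x \<in> carrier V" "x \<noteq> \<zero>\<^bsub>V\<^esub>"
    and g: "\<And>v. v \<in> carrier V \<Longrightarrow> \<exists>c. v = c \<odot>\<^bsub>V\<^esub> x"
  shows "has_dim V 1"
proof -
  interpret vectorspace class_ring V by fact
  have "span {x} = carrier V"
  proof
    show "span {x} \<subseteq> carrier V" using x(1) by (simp add: span_is_subset2)
    show "carrier V \<subseteq> span {x}"
    proof
      fix v assume "v \<in> carrier V"
      then obtain c where c: "v = c \<odot>\<^bsub>V\<^esub> x" using g by blast
      have "lincomb (\<lambda>_. c) {x} = c \<odot>\<^bsub>V\<^esub> x"
        using x(1) by (simp add: lincomb_def)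
      then show "v \<in> span {x}" unfolding span_def c by (intro CollectI exI[of _ "\<lambda>_. c"] exI[of _ "{x}"]) auto
    qed
  qed
  then have A: "finite {x} \<and> card {x} = 1 \<and> {x} \<subseteq> carrier V \<and> span {x} = carrier V" using x(1) by simp
  then have "fin_dim" unfolding fin_dim_def by blast
  moreover have "dim = 1" unfolding dim_def
  proof (rule Least_equality)
    show "\<exists>A. finite A \<and> card A = 1 \<and> A \<subseteq> carrier V \<and> span A = carrier V" using A by blast
    fix n assume "\<exists>A. finite A \<and> card A = n \<and> A \<subseteq> carrier V \<and> span A = carrier V"
    then obtain A where A: "finite A" "card A = n" "span A = carrier V" by blast
    \<comment> \<open>An empty generating set would force \<open>x\<close> to be zero, so the least
      size is 1.\<close>
    have "span {} = {\<zero>\<^bsub>V\<^esub>}" by (subst finite_span) (auto simp: lincomb_def)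
    then have "A \<noteq> {}" using A x by auto
    then show "1 \<le> n" using A by (simp add: Suc_leI card_gt_0_iff flip: A(2))
  qed
  ultimately show ?thesis using V unfolding has_dim_def by blast
qed

section \<open>Quotients of vector spaces\<close>

locale vs_quotient =
  fixes V :: "(complex, 'v) module" (structure) and W :: "'v set"
  assumes sub: "subspace class_ring W V"
begin

sublocale vectorspace class_ring V
  using sub by (rule subspace.vs)

sublocale W: submodule class_ring W V
  using sub by (rule subspace.submod)

sublocale abelian_subgroup W V
proof (rule abelian_subgroupI3)
  show "additive_subgroup W V"
  proof (rule additive_subgroup.intro, rule M.add.subgroupI)
    show "W \<noteq> {}" using W.zero_closed by blast
    show "\<ominus>\<^bsub>V\<^esub> w \<in> W" if "w \<in> W" for w
    proof -
      have "w \<in> carrier V" using that W.subset by blast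
      then have "\<ominus>\<^bsub>V\<^esub> w = (- 1) \<odot>\<^bsub>V\<^esub> w" using smult_minus_1[of w] by (simp add: class_ring_simps)
      then show ?thesis using that by simp
    qed
  qed (use W.subset in auto)
qed (rule M.abelian_group_axioms)

lemma carrier_smult: "v \<in> carrier V \<Longrightarrow> c \<odot> v \<in> carrier V"
  by (rule Module.module.smult_closed[OF W.module]) simp_all

abbreviation Q where "Q \<equiv> quotient_space V W"

lemma carrier_Q: "carrier Q = (\<lambda>v. W +> v) ` carrier V"
  by (auto simp: quotient_space_def A_RCOSETS_def')

lemma add_Q: "v \<in> carrier V \<Longrightarrow> w \<in> carrier V \<Longrightarrow> (W +> v) \<oplus>\<^bsub>Q\<^esub> (W +> w) = W +> (v \<oplus> w)"
  by (simp add: quotient_space_def a_rcos_sum)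

lemma zero_Q: "\<zero>\<^bsub>Q\<^esub> = W +> \<zero>"
  by (simp add: quotient_space_def a_rcos_const)

lemma coset_eq: "v \<in> carrier V \<Longrightarrow> u \<in> W +> v \<Longrightarrow> W +> u = W +> v"
  using a_repr_independence' by metis

lemma coset_add: "v \<in> carrier V \<Longrightarrow> w \<in> W \<Longrightarrow> W +> (w \<oplus> v) = W +> v"
  by (rule coset_eq) (auto simp: a_r_coset_def')

lemma coset_mem: "u \<in> W +> v \<Longrightarrow> \<exists>w\<in>W. u = w \<oplus> v"
  by (auto simp: a_r_coset_def')

lemma self_mem: "v \<in> carrier V \<Longrightarrow> v \<in> W +> v"
  by (rule a_rcos_self)

text \<open>Maps on cosets are written as unions over all representatives; when every representative
  yields the same set, the union is that set. This gives well-definedness for both the scalar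
  multiplication and the reduced differential.\<close>

lemma coset_UN:
  assumes "v \<in> carrier V" "\<And>w. w \<in> W \<Longrightarrow> F (w \<oplus> v) = F v"
  shows "(\<Union>u\<in>W +> v. F u) = F v"
  using coset_mem[of _ v] self_mem[OF assms(1)] assms(2) by auto

lemma smult_Q: "v \<in> carrier V \<Longrightarrow> c \<odot>\<^bsub>Q\<^esub> (W +> v) = W +> (c \<odot> v)"
proof -
  assume v: "v \<in> carrier V"
  have "(\<Union>u\<in>W +> v. W +> (c \<odot> u)) = W +> (c \<odot> v)"
  proof (rule coset_UN[OF v])
    fix w assume w: "w \<in> W"
    then have "c \<odot> (w \<oplus> v) = (c \<odot> w) \<oplus> (c \<odot> v)" using v W.subset by (intro smult_r_distr) auto
    then show "W +> (c \<odot> (w \<oplus> v)) = W +> (c \<odot> v)" using coset_add[of "c \<odot> v" "c \<odot> w"] v w by simp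
  qed
  then show ?thesis by (simp add: quotient_space_def)
qed

lemma coset_eq_zero_iff: "v \<in> carrier V \<Longrightarrow> W +> v = \<zero>\<^bsub>Q\<^esub> \<longleftrightarrow> v \<in> W"
  using self_mem[of v] a_rcos_const[of v] by (auto simp: quotient_space_def)

lemma class_ring_smult:
  assumes "v \<in> carrier V"
  shows "(a * b) \<odot> v = a \<odot> (b \<odot> v)" "(a + b) \<odot> v = a \<odot> v \<oplus> b \<odot> v" "1 \<odot> v = v"
  using smult_assoc1[of a b v] smult_l_distr[of a b v] smult_one[of v] assms by simp_all

lemma vectorspace_Q: "vectorspace class_ring Q"
proof (rule vs_criteria)
  show "field (class_ring :: complex ring)" by (rule class_field)
  show "\<forall>v\<in>carrier Q. \<exists>neg_v\<in>carrier Q. v \<oplus>\<^bsub>Q\<^esub> neg_v = \<zero>\<^bsub>Q\<^esub>"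
  proof
    fix v assume "v \<in> carrier Q"
    then obtain u where u: "u \<in> carrier V" "v = W +> u" by (auto simp: carrier_Q)
    then show "\<exists>neg_v\<in>carrier Q. v \<oplus>\<^bsub>Q\<^esub> neg_v = \<zero>\<^bsub>Q\<^esub>"
      by (intro bexI[of _ "W +> (\<ominus> u)"]) (auto simp: add_Q zero_Q carrier_Q M.r_neg)
  qed
qed (auto simp: carrier_Q add_Q zero_Q smult_Q M.a_ac smult_r_distr class_ring_smult)

end

section \<open>Complexes and criteria for the dimension of cohomology\<close>

locale vs_complex =
  fixes C :: "nat \<Rightarrow> (complex, 'v) module" and d :: "nat \<Rightarrow> 'v \<Rightarrow> 'v"
  assumes vs: "vectorspace class_ring (C n)"
    and d_closed: "x \<in> carrier (C n) \<Longrightarrow> d n x \<in> carrier (C (Suc n))"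
    and d_add: "x \<in> carrier (C n) \<Longrightarrow> y \<in> carrier (C n) \<Longrightarrow> d n (x \<oplus>\<^bsub>C n\<^esub> y) = d n x \<oplus>\<^bsub>C (Suc n)\<^esub> d n y"
    and d_smult: "x \<in> carrier (C n) \<Longrightarrow> d n (c \<odot>\<^bsub>C n\<^esub> x) = c \<odot>\<^bsub>C (Suc n)\<^esub> d n x"
    and dd: "x \<in> carrier (C n) \<Longrightarrow> d (Suc n) (d n x) = \<zero>\<^bsub>C (Suc (Suc n))\<^esub>"
begin

lemma linear_map: "linear_map class_ring (C n) (C (Suc n)) (d n)"
proof (intro linear_map.intro mod_hom.intro mod_hom_axioms.intro vs)
  have m: "module class_ring (C n)" for n using vs[of n] by (simp add: vectorspace_def)
  show "module class_ring (C n)" "module class_ring (C (Suc n))" by (rule m)+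
  show "d n \<in> LinearCombinations.module_hom class_ring (C n) (C (Suc n))"
    by (auto simp: LinearCombinations.module_hom_def d_closed d_add d_smult)
qed

lemma d_zero: "d n \<zero>\<^bsub>C n\<^esub> = \<zero>\<^bsub>C (Suc n)\<^esub>"
proof -
  interpret linear_map class_ring "C n" "C (Suc n)" "d n" by (rule linear_map)
  show ?thesis by simp
qed

lemma vs_cocycles: "vectorspace class_ring ((C n)\<lparr>carrier := cocycles C d n\<rparr>)"
proof -
  interpret linear_map class_ring "C n" "C (Suc n)" "d n" by (rule linear_map)
  have "cocycles C d n = ker" by (auto simp: cocycles_def ker_def)
  then show ?thesis using V.subspace_is_vs[OF kerT_is_subspace] by simp
qed

lemma zero_closed: "\<zero>\<^bsub>C n\<^esub> \<in> carrier (C n)"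
proof -
  interpret vectorspace class_ring "C n" by (rule vs)
  show ?thesis by simp
qed

lemma coboundaries_cocycles: "x \<in> coboundaries C d n \<Longrightarrow> x \<in> cocycles C d n"
  by (auto simp: coboundaries_def cocycles_def dd d_closed d_zero zero_closed split: nat.splits)

lemma subspace_coboundaries: "subspace class_ring (coboundaries C d n) (C n)"
proof (cases n)
  case 0
  interpret vectorspace class_ring "C 0" by (rule vs)
  have "module class_ring (C 0)" using vs[of 0] by (simp add: vectorspace_def)
  then show ?thesis
    unfolding 0 by (intro subspace.intro submodule.intro vs) (auto simp: coboundaries_def)
next
  case (Suc m)
  interpret linear_map class_ring "C m" "C (Suc m)" "d m" by (rule linear_map)
  have "coboundaries C d n = im" by (auto simp: coboundaries_def Suc im_def)
  then show ?thesis using imT_is_subspace Suc by simp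
qed

lemma quotient_cohomology: "vs_quotient ((C n)\<lparr>carrier := cocycles C d n\<rparr>) (coboundaries C d n)"
proof -
  interpret B: submodule class_ring "coboundaries C d n" "C n"
    using subspace_coboundaries by (rule subspace.submod)
  show ?thesis
    by (intro vs_quotient.intro subspace.intro submodule.intro vs_cocycles)
       (use vs_cocycles[of n] coboundaries_cocycles in \<open>auto simp: vectorspace_def\<close>)
qed

lemma cohomology_0I:
  assumes "\<And>x. x \<in> cocycles C d n \<Longrightarrow> x \<in> coboundaries C d n"
  shows "has_dim (cohomology C d n) 0"
proof -
  interpret Q: vs_quotient "(C n)\<lparr>carrier := cocycles C d n\<rparr>" "coboundaries C d n"
    by (rule quotient_cohomology)
  show ?thesis unfolding cohomology_def
  proof (rule has_dim_0I)
    show "vectorspace class_ring Q.Q" by (rule Q.vectorspace_Q)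
    show "carrier Q.Q = {\<zero>\<^bsub>Q.Q\<^esub>}"
    proof
      show "{\<zero>\<^bsub>Q.Q\<^esub>} \<subseteq> carrier Q.Q"
        unfolding Q.zero_Q Q.carrier_Q using Q.M.zero_closed by blast
      show "carrier Q.Q \<subseteq> {\<zero>\<^bsub>Q.Q\<^esub>}"
      proof
        fix v assume "v \<in> carrier Q.Q"
        then obtain x where x: "x \<in> cocycles C d n" "v = coboundaries C d n +>\<^bsub>(C n)\<lparr>carrier := cocycles C d n\<rparr>\<^esub> x"
          by (auto simp: Q.carrier_Q)
        then show "v \<in> {\<zero>\<^bsub>Q.Q\<^esub>}"
          using Q.coset_eq_zero_iff[of x] assms by simp
      qed
    qed
  qed
qed

lemma cohomology_1I:
  assumes w: "w \<in> cocycles C d n" "w \<notin> coboundaries C d n"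
    and g: "\<And>x. x \<in> cocycles C d n \<Longrightarrow> \<exists>c. \<exists>b\<in>coboundaries C d n. x = b \<oplus>\<^bsub>C n\<^esub> c \<odot>\<^bsub>C n\<^esub> w"
  shows "has_dim (cohomology C d n) 1"
proof -
  interpret Q: vs_quotient "(C n)\<lparr>carrier := cocycles C d n\<rparr>" "coboundaries C d n"
    by (rule quotient_cohomology)
  let ?Z = "(C n)\<lparr>carrier := cocycles C d n\<rparr>" and ?B = "coboundaries C d n"
  show ?thesis unfolding cohomology_def
  proof (rule has_dim_1I[where x = "?B +>\<^bsub>?Z\<^esub> w"])
    show "vectorspace class_ring Q.Q" by (rule Q.vectorspace_Q)
    show "?B +>\<^bsub>?Z\<^esub> w \<in> carrier Q.Q" using w(1) by (auto simp: Q.carrier_Q)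
    show "?B +>\<^bsub>?Z\<^esub> w \<noteq> \<zero>\<^bsub>Q.Q\<^esub>" using w Q.coset_eq_zero_iff[of w] by simp
    fix v assume "v \<in> carrier Q.Q"
    then obtain x where x: "x \<in> cocycles C d n" "v = ?B +>\<^bsub>?Z\<^esub> x" by (auto simp: Q.carrier_Q)
    then obtain c b where b: "b \<in> ?B" "x = b \<oplus>\<^bsub>C n\<^esub> c \<odot>\<^bsub>C n\<^esub> w" using g by blast
    have "c \<odot>\<^bsub>?Z\<^esub> w \<in> carrier ?Z" using w(1) by (intro Q.carrier_smult) auto
    then have "v = ?B +>\<^bsub>?Z\<^esub> (c \<odot>\<^bsub>?Z\<^esub> w)"
      using Q.coset_add[of "c \<odot>\<^bsub>?Z\<^esub> w" b] b x by simp
    then show "\<exists>c. v = c \<odot>\<^bsub>Q.Q\<^esub> (?B +>\<^bsub>?Z\<^esub> w)"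
      using Q.smult_Q[of w c] w(1) by (intro exI[of _ c]) simp
  qed
qed

end

section \<open>Quotient complexes\<close>

locale quotient_complex = vs_complex C d
  for C :: "nat \<Rightarrow> (complex, 'v) module" and d +
  fixes S :: "nat \<Rightarrow> 'v set"
  assumes S_subspace: "subspace class_ring (S n) (C n)"
    and S_d: "x \<in> S n \<Longrightarrow> d n x \<in> S (Suc n)"
begin

sublocale S: vs_quotient "C n" "S n" for n
  using S_subspace by (rule vs_quotient.intro)

abbreviation R where "R n \<equiv> quotient_space (C n) (S n)"

definition dR where "dR n T = (\<Union>x\<in>T. S (Suc n) +>\<^bsub>C (Suc n)\<^esub> d n x)"

lemma dR_coset: "v \<in> carrier (C n) \<Longrightarrow> dR n (S n +>\<^bsub>C n\<^esub> v) = S (Suc n) +>\<^bsub>C (Suc n)\<^esub> d n v"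
proof -
  assume v: "v \<in> carrier (C n)"
  show ?thesis unfolding dR_def
  proof (rule S.coset_UN[OF v])
    fix w assume w: "w \<in> S n"
    then have "w \<in> carrier (C n)" using S.W.subset by blast
    then show "S (Suc n) +>\<^bsub>C (Suc n)\<^esub> d n (w \<oplus>\<^bsub>C n\<^esub> v) = S (Suc n) +>\<^bsub>C (Suc n)\<^esub> d n v"
      using S.coset_add[OF d_closed[OF v] S_d[OF w]] v by (simp add: d_add)
  qed
qed

sublocale R: vs_complex R dR
proof (rule vs_complex.intro)
  show "vectorspace class_ring (R n)" for n by (rule S.vectorspace_Q)
  fix n
  show "dR n x \<in> carrier (R (Suc n))" if "x \<in> carrier (R n)" for x
    using that by (auto simp: S.carrier_Q dR_coset d_closed)
  show "dR n (x \<oplus>\<^bsub>R n\<^esub> y) = dR n x \<oplus>\<^bsub>R (Suc n)\<^esub> dR n y" if "x \<in> carrier (R n)" "y \<in> carrier (R n)" for x y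
    using that by (auto simp: S.carrier_Q dR_coset d_closed S.add_Q d_add)
  show "dR n (c \<odot>\<^bsub>R n\<^esub> x) = c \<odot>\<^bsub>R (Suc n)\<^esub> dR n x" if "x \<in> carrier (R n)" for x c
    using that by (auto simp: S.carrier_Q dR_coset d_closed S.smult_Q d_smult)
  show "dR (Suc n) (dR n x) = \<zero>\<^bsub>R (Suc (Suc n))\<^esub>" if "x \<in> carrier (R n)" for x
    using that by (auto simp: S.carrier_Q dR_coset d_closed dd S.zero_Q)
qed

lemma cocycles_R: "T \<in> cocycles R dR n \<longleftrightarrow> (\<exists>v\<in>carrier (C n). T = S n +>\<^bsub>C n\<^esub> v \<and> d n v \<in> S (Suc n))"
proof -
  have "dR n (S n +>\<^bsub>C n\<^esub> v) = \<zero>\<^bsub>R (Suc n)\<^esub> \<longleftrightarrow> d n v \<in> S (Suc n)" if "v \<in> carrier (C n)" for v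
    unfolding dR_coset[OF that] using d_closed[OF that] by (rule S.coset_eq_zero_iff)
  then show ?thesis unfolding cocycles_def S.carrier_Q by blast
qed

lemma coboundaries_R: "coboundaries R dR n = (\<lambda>b. S n +>\<^bsub>C n\<^esub> b) ` coboundaries C d n"
proof (cases n)
  case 0
  then show ?thesis by (simp add: coboundaries_def S.zero_Q)
next
  case (Suc m)
  then show ?thesis by (auto simp: coboundaries_def S.carrier_Q dR_coset image_image intro!: image_eqI)
qed

text \<open>Cosets are eliminated here and in the next criterion: a reduced cocycle is handled as an
  element of \<open>C n\<close> whose differential lies in \<open>S (Suc n)\<close>, so that
  identities between functions can be used.\<close>

lemma cohomology_R_0I:
  assumes "\<And>v. v \<in> carrier (C n) \<Longrightarrow> d n v \<in> S (Suc n) \<Longrightarrow> \<exists>s\<in>S n. \<exists>b\<in>coboundaries C d n. v = s \<oplus>\<^bsub>C n\<^esub> b"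
  shows "has_dim (cohomology R dR n) 0"
proof (rule R.cohomology_0I)
  fix T assume "T \<in> cocycles R dR n"
  then obtain v where v: "v \<in> carrier (C n)" "T = S n +>\<^bsub>C n\<^esub> v" "d n v \<in> S (Suc n)" by (auto simp: cocycles_R)
  then obtain s b where sb: "s \<in> S n" "b \<in> coboundaries C d n" "v = s \<oplus>\<^bsub>C n\<^esub> b" using assms by blast
  then have "T = S n +>\<^bsub>C n\<^esub> b"
    using S.coset_add[of b n s] coboundaries_cocycles[of b n] v(2) by (simp add: cocycles_def)
  then show "T \<in> coboundaries R dR n" using sb by (auto simp: coboundaries_R)
qed

lemma cohomology_R_1I:
  assumes w: "w \<in> carrier (C n)" "d n w \<in> S (Suc n)"
    "\<And>s b. s \<in> S n \<Longrightarrow> b \<in> coboundaries C d n \<Longrightarrow> w \<noteq> s \<oplus>\<^bsub>C n\<^esub> b"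
    and g: "\<And>v. v \<in> carrier (C n) \<Longrightarrow> d n v \<in> S (Suc n) \<Longrightarrow>
      \<exists>c. \<exists>s\<in>S n. \<exists>b\<in>coboundaries C d n. v = s \<oplus>\<^bsub>C n\<^esub> (b \<oplus>\<^bsub>C n\<^esub> c \<odot>\<^bsub>C n\<^esub> w)"
  shows "has_dim (cohomology R dR n) 1"
proof (rule R.cohomology_1I)
  have bc: "b \<in> carrier (C n)" if "b \<in> coboundaries C d n" for b
    using coboundaries_cocycles[OF that] by (simp add: cocycles_def)
  show "S n +>\<^bsub>C n\<^esub> w \<in> cocycles R dR n" using w by (auto simp: cocycles_R)
  show "S n +>\<^bsub>C n\<^esub> w \<notin> coboundaries R dR n"
  proof
    assume "S n +>\<^bsub>C n\<^esub> w \<in> coboundaries R dR n"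
    then obtain b where b: "b \<in> coboundaries C d n" "S n +>\<^bsub>C n\<^esub> w = S n +>\<^bsub>C n\<^esub> b" by (auto simp: coboundaries_R)
    then have "w \<in> S n +>\<^bsub>C n\<^esub> b" using S.self_mem[OF w(1)] by simp
    then show False using S.coset_mem w(3) b(1) by blast
  qed
  fix T assume "T \<in> cocycles R dR n"
  then obtain v where v: "v \<in> carrier (C n)" "T = S n +>\<^bsub>C n\<^esub> v" "d n v \<in> S (Suc n)" by (auto simp: cocycles_R)
  then obtain c s b where sb: "s \<in> S n" "b \<in> coboundaries C d n" "v = s \<oplus>\<^bsub>C n\<^esub> (b \<oplus>\<^bsub>C n\<^esub> c \<odot>\<^bsub>C n\<^esub> w)" using g by blast
  have cw: "c \<odot>\<^bsub>C n\<^esub> w \<in> carrier (C n)" using w(1) by (rule S.carrier_smult)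
  then have "T = S n +>\<^bsub>C n\<^esub> (b \<oplus>\<^bsub>C n\<^esub> c \<odot>\<^bsub>C n\<^esub> w)"
    using S.coset_add[of "b \<oplus>\<^bsub>C n\<^esub> c \<odot>\<^bsub>C n\<^esub> w" n s] sb v(2) bc by simp
  also have "\<dots> = (S n +>\<^bsub>C n\<^esub> b) \<oplus>\<^bsub>R n\<^esub> c \<odot>\<^bsub>R n\<^esub> (S n +>\<^bsub>C n\<^esub> w)"
    using S.add_Q[OF bc[OF sb(2)] cw] S.smult_Q[OF w(1)] by simp
  finally show "\<exists>c. \<exists>b\<in>coboundaries R dR n. T = b \<oplus>\<^bsub>R n\<^esub> c \<odot>\<^bsub>R n\<^esub> (S n +>\<^bsub>C n\<^esub> w)"
    using sb(2) by (intro exI[of _ c] bexI[of _ "S n +>\<^bsub>C n\<^esub> b"]) (auto simp: coboundaries_R)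
qed

end

section \<open>Cohomology of the Virasoro conformal algebra\<close>

text \<open>The inverse of taking the value on (L, ..., L). By \<open>represents_unique\<close> the
  choice is forced on \<open>skew_polys n\<close>.\<close>

definition coch :: "nat \<Rightarrow> (complex list \<Rightarrow> complex) \<Rightarrow> complex poly list \<Rightarrow> complex vpoly" where
  "coch n f = (SOME \<gamma>. represents n f \<gamma>)"

lemma represents_coch: "f \<in> skew_polys n \<Longrightarrow> represents n f (coch n f)"
  unfolding coch_def using represents_exists by (rule someI_ex)

lemma coch_eqI: "f \<in> skew_polys n \<Longrightarrow> represents n f \<gamma> \<Longrightarrow> coch n f = \<gamma>"
  using represents_coch represents_unique by blast

lemma basic_cochains_eq: "Vir_triv.basic_cochains n = coch n ` skew_polys n"
proof
  show "Vir_triv.basic_cochains n \<subseteq> coch n ` skew_polys n"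
  proof
    fix \<gamma> assume "\<gamma> \<in> Vir_triv.basic_cochains n"
    then obtain f where "f \<in> skew_polys n" "represents n f \<gamma>" by (rule cochain_represents)
    then show "\<gamma> \<in> coch n ` skew_polys n" using coch_eqI by (intro image_eqI[of _ _ f]) auto
  qed
  show "coch n ` skew_polys n \<subseteq> Vir_triv.basic_cochains n"
    using represents_cochain[OF skew_polys_skew represents_coch] by blast
qed

lemma coch_inj: "f \<in> skew_polys n \<Longrightarrow> g \<in> skew_polys n \<Longrightarrow> coch n f = coch n g \<longleftrightarrow> f = g"
  using represents_fun_unique[of f n g "coch n f"] represents_coch by metis

lemma zero_skew_polys: "(\<lambda>_. 0) \<in> skew_polys n"
  unfolding skew_polys_def by (auto simp: skew_def id_hom.weval_0 intro!: bexI[of _ 0] polys_0)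

lemma add_skew_polys: "f \<in> skew_polys n \<Longrightarrow> g \<in> skew_polys n \<Longrightarrow> (\<lambda>xs. f xs + g xs) \<in> skew_polys n"
  using lin_skew_polys[of f n g 1 1] by simp

abbreviation C where "C \<equiv> Vir_triv.basic_complex"
abbreviation d where "d \<equiv> Vir_triv.basic_diff"
abbreviation S where "S n \<equiv> Vir_triv.basic_der n ` Vir_triv.basic_cochains n"

lemma carrier_C: "carrier (C n) = coch n ` skew_polys n"
  by (simp add: Vir_triv.basic_complex_def basic_cochains_eq)

lemma zero_C: "\<zero>\<^bsub>C n\<^esub> = coch n (\<lambda>_. 0)"
proof -
  have "represents n (\<lambda>_. 0) (\<lambda>_. 0)" by (simp add: represents_def polys_0 id_hom.weval_0)
  then show ?thesis using coch_eqI[OF zero_skew_polys] by (simp add: Vir_triv.basic_complex_def)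
qed

lemma add_C:
  assumes "f \<in> skew_polys n" "g \<in> skew_polys n"
  shows "coch n f \<oplus>\<^bsub>C n\<^esub> coch n g = coch n (\<lambda>xs. f xs + g xs)"
proof -
  have "represents n (\<lambda>xs. f xs + g xs) (\<lambda>as. coch n f as + coch n g as)"
    using represents_lin[OF represents_coch[OF assms(1)] represents_coch[OF assms(2)], of 1 1] by (simp add: cst_1)
  then show ?thesis using coch_eqI[OF add_skew_polys[OF assms]] by (simp add: Vir_triv.basic_complex_def)
qed

lemma smult_C:
  assumes "f \<in> skew_polys n"
  shows "c \<odot>\<^bsub>C n\<^esub> coch n f = coch n (\<lambda>xs. c * f xs)"
proof -
  have "represents n (\<lambda>xs. c * f xs) (\<lambda>as. cst c * coch n f as)"
    using represents_lin[OF represents_coch[OF assms] represents_coch[OF assms], of c 0] by (simp add: cst_0)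
  then show ?thesis using coch_eqI[OF scale_skew_polys[OF assms]] by (simp add: Vir_triv.basic_complex_def pmul_mult)
qed

lemma diff_coch: "f \<in> skew_polys n \<Longrightarrow> d n (coch n f) = coch (Suc n) (cdiff f)"
  using coch_eqI[OF cdiff_skew_polys represents_diff[OF _ represents_coch]] by simp

lemma der_coch: "f \<in> skew_polys n \<Longrightarrow> Vir_triv.basic_der n (coch n f) = coch n (\<lambda>xs. sum_list xs * f xs)"
  using coch_eqI[OF sum_list_mult_skew_polys represents_der[OF represents_coch]] by simp

lemma S_eq: "S n = (\<lambda>f. coch n (\<lambda>xs. sum_list xs * f xs)) ` skew_polys n"
  unfolding basic_cochains_eq image_image using der_coch by (intro image_cong) auto

lemmas C_simps = carrier_C zero_C add_C smult_C diff_coch zero_skew_polys add_skew_polys scale_skew_polys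
  cdiff_skew_polys sum_list_mult_skew_polys

lemma vectorspace_C: "vectorspace class_ring (C n)"
proof (rule vs_criteria)
  show "field (class_ring :: complex ring)" by (rule class_field)
  show "\<forall>v\<in>carrier (C n). \<exists>w\<in>carrier (C n). v \<oplus>\<^bsub>C n\<^esub> w = \<zero>\<^bsub>C n\<^esub>"
  proof
    fix v assume "v \<in> carrier (C n)"
    then obtain f where f: "f \<in> skew_polys n" "v = coch n f" by (auto simp: carrier_C)
    have "coch n (\<lambda>xs. - 1 * f xs) \<in> carrier (C n)"
      unfolding carrier_C using scale_skew_polys[OF f(1)] by (rule imageI)
    moreover have "v \<oplus>\<^bsub>C n\<^esub> coch n (\<lambda>xs. - 1 * f xs) = \<zero>\<^bsub>C n\<^esub>"
      unfolding f(2) add_C[OF f(1) scale_skew_polys[OF f(1)]] zero_C by simp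
    ultimately show "\<exists>w\<in>carrier (C n). v \<oplus>\<^bsub>C n\<^esub> w = \<zero>\<^bsub>C n\<^esub>" by blast
  qed
qed (auto simp: C_simps algebra_simps)

interpretation Vir_complex: vs_complex C d
proof (rule vs_complex.intro)
  fix n x y and c :: complex
  show "vectorspace class_ring (C n)" by (rule vectorspace_C)
  show "d n x \<in> carrier (C (Suc n))" if "x \<in> carrier (C n)"
    using that by (auto simp: C_simps)
  show "d n (x \<oplus>\<^bsub>C n\<^esub> y) = d n x \<oplus>\<^bsub>C (Suc n)\<^esub> d n y" if "x \<in> carrier (C n)" "y \<in> carrier (C n)"
    using that by (auto simp: C_simps cdiff_add[abs_def])
  show "d n (c \<odot>\<^bsub>C n\<^esub> x) = c \<odot>\<^bsub>C (Suc n)\<^esub> d n x" if "x \<in> carrier (C n)"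
    using that by (auto simp: C_simps cdiff_scale[abs_def])
  show "d (Suc n) (d n x) = \<zero>\<^bsub>C (Suc (Suc n))\<^esub>" if "x \<in> carrier (C n)"
    using that by (auto simp: C_simps cdiff_cdiff[abs_def])
qed

interpretation Vir_quotient: quotient_complex C d S
proof (intro quotient_complex.intro quotient_complex_axioms.intro Vir_complex.vs_complex_axioms)
  show "subspace class_ring (S n) (C n)" for n
  proof (intro subspace.intro submodule.intro vectorspace_C)
    show "module class_ring (C n)" using vectorspace_C[of n] by (simp add: vectorspace_def)
    show "S n \<subseteq> carrier (C n)" by (auto simp: S_eq C_simps)
    show "v \<oplus>\<^bsub>C n\<^esub> w \<in> S n" if vw: "v \<in> S n" "w \<in> S n" for v w
    proof -
      obtain f g where "f \<in> skew_polys n" "v = coch n (\<lambda>xs. sum_list xs * f xs)"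
        "g \<in> skew_polys n" "w = coch n (\<lambda>xs. sum_list xs * g xs)" using vw unfolding S_eq by blast
      then show ?thesis
        unfolding S_eq by (intro image_eqI[of _ _ "\<lambda>xs. f xs + g xs"]) (simp_all add: C_simps distrib_left)
    qed
    show "\<zero>\<^bsub>C n\<^esub> \<in> S n"
      unfolding S_eq by (rule image_eqI[of _ _ "\<lambda>_. 0"]) (simp_all add: C_simps)
    show "c \<odot>\<^bsub>C n\<^esub> v \<in> S n" if v: "v \<in> S n" for c v
    proof -
      obtain f where "f \<in> skew_polys n" "v = coch n (\<lambda>xs. sum_list xs * f xs)" using v unfolding S_eq by blast
      then show ?thesis
        unfolding S_eq by (intro image_eqI[of _ _ "\<lambda>xs. c * f xs"]) (simp_all add: C_simps mult.left_commute)
    qed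
  qed
  show "d n v \<in> S (Suc n)" if v: "v \<in> S n" for n v
  proof -
    obtain f where "f \<in> skew_polys n" "v = coch n (\<lambda>xs. sum_list xs * f xs)" using v unfolding S_eq by blast
    then show ?thesis
      unfolding S_eq by (intro image_eqI[of _ _ "cdiff f"]) (simp_all add: C_simps cdiff_sum_list[abs_def])
  qed
qed

lemma reduced_cohomology_eq: "Vir_triv.reduced_cohomology = cohomology Vir_quotient.R Vir_quotient.dR"
proof -
  have "Vir_triv.reduced_complex = Vir_quotient.R"
    by (rule ext) (simp add: Vir_triv.reduced_complex_def)
  moreover have "Vir_triv.reduced_diff = Vir_quotient.dR"
    by (intro ext) (simp add: Vir_triv.reduced_diff_def Vir_quotient.dR_def)
  ultimately show ?thesis by (simp add: Vir_triv.reduced_cohomology_def)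
qed

section \<open>Cocycles and coboundaries as functions\<close>

lemma cocyclesE:
  assumes "x \<in> cocycles C d n"
  obtains f where "f \<in> skew_polys n" "x = coch n f" "\<And>xs. cdiff f xs = 0"
proof -
  obtain f where f: "f \<in> skew_polys n" "x = coch n f" using assms by (auto simp: cocycles_def carrier_C)
  then have "coch (Suc n) (cdiff f) = coch (Suc n) (\<lambda>_. 0)"
    using assms by (simp add: cocycles_def diff_coch zero_C)
  then have "cdiff f = (\<lambda>_. 0)" using f by (simp add: coch_inj C_simps)
  then show ?thesis using f that by metis
qed

lemma cocyclesI: "f \<in> skew_polys n \<Longrightarrow> (\<And>xs. cdiff f xs = 0) \<Longrightarrow> coch n f \<in> cocycles C d n"
  by (auto simp: cocycles_def C_simps intro!: arg_cong[of _ _ "coch (Suc n)"])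

lemma coboundaries_0: "coboundaries C d 0 = {coch 0 (\<lambda>_. 0)}"
  by (simp add: coboundaries_def zero_C)

lemma coboundaries_Suc: "coboundaries C d (Suc n) = (\<lambda>g. coch (Suc n) (cdiff g)) ` skew_polys n"
  unfolding coboundaries_def nat.case carrier_C image_image using diff_coch by (intro image_cong) auto

text \<open>The element 1 of the module \<complex>, viewed as a function of no arguments.\<close>

definition unit0 :: "complex list \<Rightarrow> complex" where
  "unit0 xs = (if xs = [] then 1 else 0)"

lemma unit0_skew_polys: "unit0 \<in> skew_polys 0"
proof -
  have "skew unit0" by (rule skewI) (simp add: unit0_def)
  then show ?thesis
    unfolding skew_polys_def by (auto simp: unit0_def id_hom.weval_1 intro!: bexI[of _ 1] polys_1)
qed

lemma skew_polys_0: "f \<in> skew_polys 0 \<Longrightarrow> f = (\<lambda>xs. f [] * unit0 xs)"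
  using skew_polys_length[of f 0] by (auto simp: unit0_def fun_eq_iff)

text \<open>On a single argument there is no slot to modify and no pair to bracket; this reflects
  the zero action of Vir.\<close>

lemma cdiff_skew_polys_0: "f \<in> skew_polys 0 \<Longrightarrow> cdiff f xs = 0"
proof (cases "length xs = 1")
  case True
  then obtain x where "xs = [x]" by (auto simp: length_Suc_conv)
  then show ?thesis by simp
qed (use cdiff_length[of 0 f xs] skew_polys_length[of f 0] in auto)

section \<open>Dimensions of basic and reduced cohomology\<close>

lemma basic_cohomology_dim: "has_dim (cohomology C d q) (if q = 0 \<or> q = 3 then 1 else 0)"
proof (cases q)
  case 0
  have "has_dim (cohomology C d 0) 1"
  proof (rule Vir_complex.cohomology_1I)
    show "coch 0 unit0 \<in> cocycles C d 0" by (intro cocyclesI unit0_skew_polys cdiff_skew_polys_0)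
    have "unit0 \<noteq> (\<lambda>_. 0)" by (auto simp: fun_eq_iff unit0_def)
    then show "coch 0 unit0 \<notin> coboundaries C d 0"
      by (simp add: coboundaries_0 coch_inj unit0_skew_polys zero_skew_polys)
    fix x assume "x \<in> cocycles C d 0"
    then obtain f where f: "f \<in> skew_polys 0" "x = coch 0 f" by (rule cocyclesE)
    have "coch 0 (\<lambda>_. 0) \<oplus>\<^bsub>C 0\<^esub> f [] \<odot>\<^bsub>C 0\<^esub> coch 0 unit0 = coch 0 (\<lambda>xs. f [] * unit0 xs)"
      by (simp add: C_simps unit0_skew_polys)
    then have "x = coch 0 (\<lambda>_. 0) \<oplus>\<^bsub>C 0\<^esub> f [] \<odot>\<^bsub>C 0\<^esub> coch 0 unit0"
      unfolding f(2) skew_polys_0[OF f(1), symmetric] by (rule sym)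
    then show "\<exists>c. \<exists>b\<in>coboundaries C d 0. x = b \<oplus>\<^bsub>C 0\<^esub> c \<odot>\<^bsub>C 0\<^esub> coch 0 unit0"
      unfolding coboundaries_0 by blast
  qed
  then show ?thesis using 0 by simp
next
  case (Suc n)
  show ?thesis
  proof (cases "n = 2")
    case True
    have v: "vdm3 \<in> skew_polys (Suc n)" using vdm3_skew_polys True by simp
    have "has_dim (cohomology C d (Suc n)) 1"
    proof (rule Vir_complex.cohomology_1I)
      show "coch (Suc n) vdm3 \<in> cocycles C d (Suc n)" by (intro cocyclesI v cdiff_vdm3)
      show "coch (Suc n) vdm3 \<notin> coboundaries C d (Suc n)"
      proof
        assume "coch (Suc n) vdm3 \<in> coboundaries C d (Suc n)"
        then obtain g where g: "g \<in> skew_polys n" "vdm3 = cdiff g"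
          using v by (auto simp: coboundaries_Suc coch_inj cdiff_skew_polys)
        then show False using vdm3_not_coboundary[of g "\<lambda>_. 0"] True by simp
      qed
      fix x assume "x \<in> cocycles C d (Suc n)"
      then obtain f where f: "f \<in> skew_polys (Suc n)" "x = coch (Suc n) f" "\<And>xs. cdiff f xs = 0" by (rule cocyclesE) blast
      obtain c g where g: "g \<in> skew_polys n" "\<And>xs. f xs = c * vdm3 xs + cdiff g xs"
        using basic_cocycle[OF f(1,3)] True by auto
      have "f = (\<lambda>xs. cdiff g xs + c * vdm3 xs)" using g(2) by (simp add: fun_eq_iff add.commute)
      then have "x = coch (Suc n) (cdiff g) \<oplus>\<^bsub>C (Suc n)\<^esub> c \<odot>\<^bsub>C (Suc n)\<^esub> coch (Suc n) vdm3"
        by (simp add: C_simps v f(2) g(1))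
      then show "\<exists>c. \<exists>b\<in>coboundaries C d (Suc n). x = b \<oplus>\<^bsub>C (Suc n)\<^esub> c \<odot>\<^bsub>C (Suc n)\<^esub> coch (Suc n) vdm3"
        unfolding coboundaries_Suc using g(1) by blast
    qed
    then show ?thesis using Suc True by simp
  next
    case False
    have "has_dim (cohomology C d (Suc n)) 0"
    proof (rule Vir_complex.cohomology_0I)
      fix x assume "x \<in> cocycles C d (Suc n)"
      then obtain f where f: "f \<in> skew_polys (Suc n)" "x = coch (Suc n) f" "\<And>xs. cdiff f xs = 0" by (rule cocyclesE) blast
      obtain g where g: "g \<in> skew_polys n" "\<And>xs. f xs = cdiff g xs"
        using basic_cocycle[OF f(1,3)] False by auto
      have "f = cdiff g" using g(2) by blast
      then show "x \<in> coboundaries C d (Suc n)" unfolding coboundaries_Suc f(2) using g(1) by blast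
    qed
    then show ?thesis using Suc False by simp
  qed
qed

lemma reduced_cohomology_dim:
  "has_dim (cohomology Vir_quotient.R Vir_quotient.dR q) (if q = 0 \<or> q = 2 \<or> q = 3 then 1 else 0)"
proof (cases q)
  case 0
  \<comment> \<open>Without variables the sum is empty, so \<partial> acts by zero in degree 0 and
    the constants survive in the quotient.\<close>
  have S0: "S 0 = {coch 0 (\<lambda>_. 0)}"
  proof -
    have "(\<lambda>xs. sum_list xs * f xs) = (\<lambda>_. 0)" if "f \<in> skew_polys 0" for f
    proof
      fix xs show "sum_list xs * f xs = 0"
        using skew_polys_length[OF that, of xs] by (cases "xs = []") simp_all
    qed
    then show ?thesis unfolding S_eq using zero_skew_polys[of 0] by auto
  qed
  have "has_dim (cohomology Vir_quotient.R Vir_quotient.dR 0) 1"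
  proof (rule Vir_quotient.cohomology_R_1I)
    show "coch 0 unit0 \<in> carrier (C 0)" by (simp add: carrier_C unit0_skew_polys)
    have "cdiff unit0 = (\<lambda>xs. sum_list xs * 0)" using cdiff_skew_polys_0[OF unit0_skew_polys] by (simp add: fun_eq_iff)
    then show "d 0 (coch 0 unit0) \<in> S (Suc 0)"
      unfolding S_eq diff_coch[OF unit0_skew_polys] by (intro image_eqI[of _ _ "\<lambda>_. 0"]) (simp_all add: zero_skew_polys)
    have "unit0 \<noteq> (\<lambda>_. 0)" by (auto simp: fun_eq_iff unit0_def)
    then show "coch 0 unit0 \<noteq> s \<oplus>\<^bsub>C 0\<^esub> b" if "s \<in> S 0" "b \<in> coboundaries C d 0" for s b
      using that unfolding S0 coboundaries_0 by (simp add: C_simps coch_inj unit0_skew_polys)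
    fix v assume "v \<in> carrier (C 0)"
    then obtain f where f: "f \<in> skew_polys 0" "v = coch 0 f" by (auto simp: carrier_C)
    have "coch 0 (\<lambda>_. 0) \<oplus>\<^bsub>C 0\<^esub> (coch 0 (\<lambda>_. 0) \<oplus>\<^bsub>C 0\<^esub> f [] \<odot>\<^bsub>C 0\<^esub> coch 0 unit0) = coch 0 (\<lambda>xs. f [] * unit0 xs)"
      by (simp add: C_simps unit0_skew_polys)
    then have "v = coch 0 (\<lambda>_. 0) \<oplus>\<^bsub>C 0\<^esub> (coch 0 (\<lambda>_. 0) \<oplus>\<^bsub>C 0\<^esub> f [] \<odot>\<^bsub>C 0\<^esub> coch 0 unit0)"
      unfolding f(2) skew_polys_0[OF f(1), symmetric] by (rule sym)
    then show "\<exists>c. \<exists>s\<in>S 0. \<exists>b\<in>coboundaries C d 0. v = s \<oplus>\<^bsub>C 0\<^esub> (b \<oplus>\<^bsub>C 0\<^esub> c \<odot>\<^bsub>C 0\<^esub> coch 0 unit0)"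
      unfolding S0 coboundaries_0 by blast
  qed
  then show ?thesis using 0 by simp
next
  case (Suc n)
  \<comment> \<open>The summands are grouped as an element of \<open>S (Suc n)\<close>, a coboundary
    and a multiple of a generator, the shape that \<open>cohomology_R_1I\<close> asks for.\<close>
  have cocycle: "\<exists>c c' g s. g \<in> skew_polys n \<and> s \<in> skew_polys (Suc n) \<and> v = coch (Suc n) (\<lambda>xs. sum_list xs * s xs +
      (cdiff g xs + (c * (if n = 2 then vdm3 xs else 0) + c' * (if n = 1 then cubic2 xs else 0))))"
    if v: "v \<in> carrier (C (Suc n))" "d (Suc n) v \<in> S (Suc (Suc n))" for v
  proof -
    obtain f where f: "f \<in> skew_polys (Suc n)" "v = coch (Suc n) f" using v(1) by (auto simp: carrier_C)
    obtain h where h: "h \<in> skew_polys (Suc (Suc n))" "coch (Suc (Suc n)) (cdiff f) = coch (Suc (Suc n)) (\<lambda>xs. sum_list xs * h xs)"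
      using v(2) unfolding S_eq f(2) diff_coch[OF f(1)] by blast
    then have "cdiff f = (\<lambda>xs. sum_list xs * h xs)"
      using f(1) by (simp add: coch_inj C_simps)
    then have "cdiff f xs = sum_list xs * h xs" for xs by (rule fun_cong)
    from reduced_cocycle[OF f(1) h(1) this] obtain c c' g s where g: "g \<in> skew_polys n" "s \<in> skew_polys (Suc n)"
      "\<And>xs. f xs = c * (if n = 2 then vdm3 xs else 0) + c' * (if n = 1 then cubic2 xs else 0) + cdiff g xs + sum_list xs * s xs"
      by blast
    have "f = (\<lambda>xs. sum_list xs * s xs +
      (cdiff g xs + (c * (if n = 2 then vdm3 xs else 0) + c' * (if n = 1 then cubic2 xs else 0))))"
      unfolding fun_eq_iff g(3) by (simp add: ac_simps)
    then show ?thesis using g(1,2) f(2) by blast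
  qed
  \<comment> \<open>Degrees 2 and 3 run alike, with \<open>w\<close> being \<open>cubic2\<close> for
    \<open>n = 1\<close> and \<open>vdm3\<close> for \<open>n = 2\<close>. Here \<open>h\<close>
    shows that \<open>w\<close> is closed modulo \<partial>, \<open>ne\<close> that its class is not
    zero, and \<open>gen\<close> that it spans.\<close>
  have one: "has_dim (cohomology Vir_quotient.R Vir_quotient.dR (Suc n)) 1"
    if w: "w \<in> skew_polys (Suc n)" "\<And>xs. cdiff w xs = sum_list xs * h xs" "h \<in> skew_polys (Suc (Suc n))"
      and ne: "\<And>g s. g \<in> skew_polys n \<Longrightarrow> s \<in> skew_polys (Suc n) \<Longrightarrow> (\<And>xs. w xs = cdiff g xs + sum_list xs * s xs) \<Longrightarrow> False"
      and gen: "\<And>c c'. \<exists>a. \<forall>xs. c * (if n = 2 then vdm3 xs else 0) + c' * (if n = 1 then cubic2 xs else 0) = a * w xs"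
    for w h
  proof (rule Vir_quotient.cohomology_R_1I)
    show "coch (Suc n) w \<in> carrier (C (Suc n))" using w(1) by (simp add: carrier_C)
    have "cdiff w = (\<lambda>xs. sum_list xs * h xs)" using w(2) by blast
    then show "d (Suc n) (coch (Suc n) w) \<in> S (Suc (Suc n))"
      unfolding S_eq diff_coch[OF w(1)] using w(3) by simp
    show "coch (Suc n) w \<noteq> s \<oplus>\<^bsub>C (Suc n)\<^esub> b" if sb: "s \<in> S (Suc n)" "b \<in> coboundaries C d (Suc n)" for s b
    proof
      obtain r g where rg: "r \<in> skew_polys (Suc n)" "s = coch (Suc n) (\<lambda>xs. sum_list xs * r xs)"
        "g \<in> skew_polys n" "b = coch (Suc n) (cdiff g)"
        using sb unfolding S_eq coboundaries_Suc by blast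
      assume "coch (Suc n) w = s \<oplus>\<^bsub>C (Suc n)\<^esub> b"
      then have "w = (\<lambda>xs. sum_list xs * r xs + cdiff g xs)"
        using rg w(1) by (simp add: C_simps coch_inj)
      then have "w xs = cdiff g xs + sum_list xs * r xs" for xs by (simp add: add.commute)
      then show False using ne rg by blast
    qed
    fix v assume "v \<in> carrier (C (Suc n))" "d (Suc n) v \<in> S (Suc (Suc n))"
    then obtain c c' g s where g: "g \<in> skew_polys n" "s \<in> skew_polys (Suc n)" "v = coch (Suc n) (\<lambda>xs. sum_list xs * s xs +
      (cdiff g xs + (c * (if n = 2 then vdm3 xs else 0) + c' * (if n = 1 then cubic2 xs else 0))))"
      using cocycle by blast
    obtain a where a: "\<And>xs. c * (if n = 2 then vdm3 xs else 0) + c' * (if n = 1 then cubic2 xs else 0) = a * w xs"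
      using gen by blast
    have "v = coch (Suc n) (\<lambda>xs. sum_list xs * s xs) \<oplus>\<^bsub>C (Suc n)\<^esub> (coch (Suc n) (cdiff g) \<oplus>\<^bsub>C (Suc n)\<^esub> a \<odot>\<^bsub>C (Suc n)\<^esub> coch (Suc n) w)"
      unfolding g(3) a using g(1,2) w(1) by (simp add: C_simps)
    then show "\<exists>c. \<exists>s\<in>S (Suc n). \<exists>b\<in>coboundaries C d (Suc n). v = s \<oplus>\<^bsub>C (Suc n)\<^esub> (b \<oplus>\<^bsub>C (Suc n)\<^esub> c \<odot>\<^bsub>C (Suc n)\<^esub> coch (Suc n) w)"
      unfolding S_eq coboundaries_Suc using g(1,2) by blast
  qed
  consider "n = 1" | "n = 2" | "n \<noteq> 1" "n \<noteq> 2" by blast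
  then show ?thesis
  proof cases
    case 1
    have "has_dim (cohomology Vir_quotient.R Vir_quotient.dR (Suc n)) 1"
    proof (rule one)
      show "cubic2 \<in> skew_polys (Suc n)" using cubic2_skew_polys 1 by (simp add: numeral_2_eq_2)
      show "vdm3 \<in> skew_polys (Suc (Suc n))" using vdm3_skew_polys 1 by (simp add: numeral_3_eq_3)
      show "cdiff cubic2 xs = sum_list xs * vdm3 xs" for xs by (rule cdiff_cubic2)
      show False if "g \<in> skew_polys n" "s \<in> skew_polys (Suc n)" "\<And>xs. cubic2 xs = cdiff g xs + sum_list xs * s xs" for g s
        using that cubic2_not_coboundary[of g s] 1 by (simp add: numeral_2_eq_2)
      show "\<exists>a. \<forall>xs. c * (if n = 2 then vdm3 xs else 0) + c' * (if n = 1 then cubic2 xs else 0) = a * cubic2 xs" for c c'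
        using 1 by (intro exI[of _ c']) simp
    qed
    then show ?thesis using Suc 1 by (simp add: numeral_2_eq_2)
  next
    case 2
    have "has_dim (cohomology Vir_quotient.R Vir_quotient.dR (Suc n)) 1"
    proof (rule one)
      show "vdm3 \<in> skew_polys (Suc n)" using vdm3_skew_polys 2 by simp
      show "(\<lambda>_. 0) \<in> skew_polys (Suc (Suc n))" by (rule zero_skew_polys)
      show "cdiff vdm3 xs = sum_list xs * 0" for xs by (simp add: cdiff_vdm3)
      show False if "g \<in> skew_polys n" "s \<in> skew_polys (Suc n)" "\<And>xs. vdm3 xs = cdiff g xs + sum_list xs * s xs" for g s
        using that vdm3_not_coboundary[of g s] 2 by simp
      show "\<exists>a. \<forall>xs. c * (if n = 2 then vdm3 xs else 0) + c' * (if n = 1 then cubic2 xs else 0) = a * vdm3 xs" for c c'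
        using 2 by (intro exI[of _ c]) simp
    qed
    then show ?thesis using Suc 2 by simp
  next
    case 3
    have "has_dim (cohomology Vir_quotient.R Vir_quotient.dR (Suc n)) 0"
    proof (rule Vir_quotient.cohomology_R_0I)
      fix v assume "v \<in> carrier (C (Suc n))" "d (Suc n) v \<in> S (Suc (Suc n))"
      then obtain g s where g: "g \<in> skew_polys n" "s \<in> skew_polys (Suc n)"
        "v = coch (Suc n) (\<lambda>xs. sum_list xs * s xs + cdiff g xs)"
        using cocycle[of v] 3 by auto
      then have "v = coch (Suc n) (\<lambda>xs. sum_list xs * s xs) \<oplus>\<^bsub>C (Suc n)\<^esub> coch (Suc n) (cdiff g)"
        by (simp add: C_simps)
      then show "\<exists>s\<in>S (Suc n). \<exists>b\<in>coboundaries C d (Suc n). v = s \<oplus>\<^bsub>C (Suc n)\<^esub> b"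
        unfolding S_eq coboundaries_Suc using g(1,2) by blast
    qed
    then show ?thesis using Suc 3 by simp
  qed
qed

theorem theorem7p1:
  fixes q :: nat
  shows "has_dim (Vir_triv.basic_cohomology q) (if q = 0 \<or> q = 3 then 1 else 0) \<and>
    has_dim (Vir_triv.reduced_cohomology q) (if q = 0 \<or> q = 2 \<or> q = 3 then 1 else 0)"
  unfolding Vir_triv.basic_cohomology_def reduced_cohomology_eq
  using basic_cohomology_dim reduced_cohomology_dim by blast

end
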